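(* Let $(M,\nabla)$ be a connected smooth $n$-dimensional manifold ($n\ge 2$) with a symmetric (torsion-free) linear connection $\nabla$. Let $a>0$ be a real constant, let the total space $T^*M$ be endowed with the non-proper natural Riemann extension $\overline g_1$ (with constants $a$ and $b=0$), and let $P_1$ be the endomorphism field of $T(T^*M)$ determined by $$P_1X^C=X^C+2C(\nabla X),\qquad P_1\alpha^V=-\alpha^V$$ for all vector fields $X$ and all differential 1-forms $\alpha$ on $M$. Then $(T^*M,P_1,\overline g_1)$ is an almost para-Hermitian manifold. Moreover: (i) if $M$ is not flat (resp. $M$ is flat), then $(T^*M,P_1,\overline g_1)$ is almost para-Kähler (resp. para-Kähler); (ii) $P_1$ is harmonic on $(T^*M,\overline g_1)$.
   Context: **Cotangent bundle and lifts.** Points of $T^*M$ are pairs $(x,\omega)$, $x\in M$, $\omega\in T^*_xM$. A chart $(x^1,\dots,x^n)$ of $M$ induces coordinates $(x^1,\dots,x^n,\omega_1,\dots,\omega_n)$ on $T^*M$, with $\omega=\omega_i\,dx^i$; put $\partial_i=\partial/\partial x^i$, $\partial_{i*}=\partial/\partial\omega_i$. For a vector field $X=X^i\partial_i$ on $M$: - the vertical lift $X^V$ is the function $X^V(x,\omega)=\omega(X_x)$ on $T^*M$; - the complete lift $X^C$ is the vector field on $T^*M$ with $X^C(Z^V)=[X,Z]^V$ for all vector fields $Z$ on $M$; locally $X^C=\sum_i X^i\partial_i-\sum_{h,i}\omega_h(\partial_iX^h)\partial_{i*}$. For a 1-form $\alpha=\sum_i\alpha_i dx^i$ on $M$, the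 vertical lift $\alpha^V$ is the vector field $\alpha^V=\sum_i\alpha_i\partial_{i*}$ on $T^*M$. For a $(1,1)$ tensor field $T$ on $M$, the contracted vector field $C(T)$ on $T^*M$ is determined by $C(T)(Z^V)_{(x,\omega)}=\omega((TZ)_x)$ for all vector fields $Z$ on $M$; it is vertical, with $C(T)_{(x,\omega)}$ being the vertical vector corresponding to the covector $\omega\circ T_x$. Here $\nabla X$ denotes the $(1,1)$ tensor field $Z\mapsto\nabla_ZX$. **Non-proper natural Riemann extension.** For a constant $a>0$ it is the semi-Riemannian metric $\overline g_1$ on $T^*M$ of signature $(n,n)$ given by $$(\overline g_1)_{(x,\omega)}(X^C,Y^C)=-a\,\omega(\nabla_{X_x}Y+\nabla_{Y_x}X),$$ $$(\overline g_1)_{(x,\omega)}(X^C,\alpha^V)=a\,\alpha_x(X_x),\qquad (\overline g_1)_{(x,\omega)}(\alpha^V,\beta^V)=0$$ for all vector fields $X,Y$ and 1-forms $\alpha,\beta$ on $M$. **Para-Hermitian notions.** An almost para-complex structure on a $2n$-dimensional manifold $N$ is a $(1,1)$ tensor field $P$ with $P\neq\pm\mathrm{Id}$, $P^2=\mathrm{Id}$ whose $\pm1$-eigendistributions have the same rank. $(N,P,g)$ is almost para-Hermitian if $P$ is an almost para-complex structure and $g$ is a semi-Riemannian metric with $g(PX,PY)=-g(X,Y)$. Put $\Omega(X,Y)=g(X,PY)$. $(N,P,g)$ is para-Kähler if $\nabla^gP=0$, where $\nabla^g$ is the Levi-Civita connection of $g$, and almost para-Kähler if $d\Omega=0$. **Flatness.**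 $M$ is flat if the curvature tensor $R$ of $\nabla$ vanishes identically. **Harmonicity.** A $(1,1)$ tensor field $T$ on a semi-Riemannian manifold $(N,h)$ is harmonic if $T$, viewed as an endomorphism field $T:(TN,h^C)\to(TN,h^C)$, is a harmonic map, where $h^C$ is the complete lift of $h$ to $TN$ (in induced coordinates $(x^i,y^i)$: $h^C=y^k(\partial_kh_{ij})dx^idx^j+2h_{ij}dx^idy^j$). By a known result this is equivalent to $\delta T=0$, where $\delta T=\mathrm{trace}_h\{(X,Y)\mapsto(\nabla^h_XT)Y\}$ and $\nabla^h$ is the Levi-Civita connection of $h$. *)

theory Defs
  imports "HOL-Analysis.Analysis" "HOL-Library.Function_Algebras"
begin

section \<open>Preliminaries\<close>

instantiation "fun" :: (type, real_vector) real_vector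
begin

definition scaleR_fun :: "real \<Rightarrow> ('a \<Rightarrow> 'b) \<Rightarrow> 'a \<Rightarrow> 'b"
  where "scaleR_fun r f = (\<lambda>x. r *\<^sub>R f x)"

instance
  by standard
    (auto simp: scaleR_fun_def plus_fun_def fun_eq_iff scaleR_add_right scaleR_add_left)

end

definition linear_on :: "'a::real_vector set \<Rightarrow> ('a \<Rightarrow> 'b::real_vector) \<Rightarrow> bool"
  where "linear_on V f \<longleftrightarrow>
    (\<forall>v\<in>V. \<forall>w\<in>V. \<forall>r s. f (r *\<^sub>R v + s *\<^sub>R w) = r *\<^sub>R f v + s *\<^sub>R f w)"

text \<open>\<open>smooth_on S\<close> is the class \<open>C\<^sup>\<infinity>\<close>; it is meant for open sets \<open>S\<close> of a Euclidean space,
  where \<open>ck_on k S\<close> is the usual class of \<open>k\<close> times continuously differentiable maps.\<close>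

primrec ck_on :: "nat \<Rightarrow> 'a::real_normed_vector set \<Rightarrow> ('a \<Rightarrow> 'b::real_normed_vector) \<Rightarrow> bool"
  where
    "ck_on 0 S f \<longleftrightarrow> continuous_on S f"
  | "ck_on (Suc k) S f \<longleftrightarrow> (\<forall>x\<in>S. f differentiable (at x)) \<and>
       (\<forall>v. ck_on k S (\<lambda>x. frechet_derivative f (at x) v))"

definition smooth_on :: "'a::real_normed_vector set \<Rightarrow> ('a \<Rightarrow> 'b::real_normed_vector) \<Rightarrow> bool"
  where "smooth_on S f \<longleftrightarrow> (\<forall>k. ck_on k S f)"


section \<open>Smooth manifolds\<close>

text \<open>A manifold modelled on the Euclidean space \<open>'v\<close> (so of dimension \<open>DIM('v)\<close>) is given by an
  atlas. A chart is a pair of its domain and its coordinate map, whose values outside the domain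
  are irrelevant. The underlying set and the topology are those determined by the atlas.\<close>

type_synonym ('a, 'v) chart = "'a set \<times> ('a \<Rightarrow> 'v)"

definition chart_img :: "('a, 'v) chart \<Rightarrow> 'v set"
  where "chart_img c = snd c ` fst c"

definition chart_inv :: "('a, 'v) chart \<Rightarrow> 'v \<Rightarrow> 'a"
  where "chart_inv c = inv_into (fst c) (snd c)"

definition transition :: "('a, 'v) chart \<Rightarrow> ('a, 'v) chart \<Rightarrow> 'v \<Rightarrow> 'v"
  where "transition c d = snd d \<circ> chart_inv c"

definition points :: "('a, 'v) chart set \<Rightarrow> 'a set"
  where "points A = (\<Union>c\<in>A. fst c)"

definition manifold_topology :: "('a, 'v::euclidean_space) chart set \<Rightarrow> 'a topology"
  where "manifold_topology A =
    topology (\<lambda>S. S \<subseteq> points A \<and> (\<forall>c\<in>A. open (snd c ` (S \<inter> fst c))))"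

definition smooth_manifold :: "('a, 'v::euclidean_space) chart set \<Rightarrow> bool"
  where "smooth_manifold A \<longleftrightarrow>
    (\<forall>c\<in>A. inj_on (snd c) (fst c) \<and> open (chart_img c)) \<and>
    (\<forall>c\<in>A. \<forall>d\<in>A. open (snd c ` (fst c \<inter> fst d)) \<and>
       smooth_on (snd c ` (fst c \<inter> fst d)) (transition c d)) \<and>
    Hausdorff_space (manifold_topology A) \<and>
    second_countable (manifold_topology A)"

lemma openin_manifold_topology:
  assumes "smooth_manifold A"
  shows "openin (manifold_topology A) S \<longleftrightarrow>
    S \<subseteq> points A \<and> (\<forall>c\<in>A. open (snd c ` (S \<inter> fst c)))"
proof -
  have "istopology (\<lambda>S. S \<subseteq> points A \<and> (\<forall>c\<in>A. open (snd c ` (S \<inter> fst c))))"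
    unfolding istopology_def
  proof (intro conjI allI impI ballI; (elim conjE)?)
    fix S T c
    assume S: "\<forall>c\<in>A. open (snd c ` (S \<inter> fst c))" and T: "\<forall>c\<in>A. open (snd c ` (T \<inter> fst c))"
      and c: "c \<in> A"
    have "inj_on (snd c) (fst c)"
      using assms c by (auto simp: smooth_manifold_def)
    then have "snd c ` (S \<inter> T \<inter> fst c) = snd c ` (S \<inter> fst c) \<inter> snd c ` (T \<inter> fst c)"
      by (auto simp: inj_on_def)
    then show "open (snd c ` (S \<inter> T \<inter> fst c))"
      using S T c by auto
  next
    fix \<K> c
    assume \<K>: "\<forall>K\<in>\<K>. K \<subseteq> points A \<and> (\<forall>c\<in>A. open (snd c ` (K \<inter> fst c)))" and c: "c \<in> A"
    have "snd c ` (\<Union>\<K> \<inter> fst c) = (\<Union>K\<in>\<K>. snd c ` (K \<inter> fst c))"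
      by auto
    then show "open (snd c ` (\<Union>\<K> \<inter> fst c))"
      using \<K> c by auto
  qed auto
  then show ?thesis
    unfolding manifold_topology_def by (simp add: topology_inverse')
qed

definition charts_at :: "('a, 'v) chart set \<Rightarrow> 'a \<Rightarrow> ('a, 'v) chart set"
  where "charts_at A p = {c \<in> A. p \<in> fst c}"

text \<open>Used where an object is given by a formula in a chart which does not depend on the chart.\<close>

definition chart_at :: "('a, 'v) chart set \<Rightarrow> 'a \<Rightarrow> ('a, 'v) chart"
  where "chart_at A p = (SOME c. c \<in> charts_at A p)"

definition smooth_fun :: "('a, 'v::euclidean_space) chart set \<Rightarrow> ('a \<Rightarrow> real) \<Rightarrow> bool"
  where "smooth_fun A f \<longleftrightarrow> (\<forall>c\<in>A. smooth_on (chart_img c) (f \<circ> chart_inv c))"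


section \<open>Tangent vectors and tensor fields\<close>

text \<open>A tangent vector at \<open>p\<close> assigns to each chart \<open>c\<close> around \<open>p\<close> its component vector in \<open>'v\<close>,
  subject to the transformation law given by the Jacobians; it is \<open>0\<close> on all other pairs \<open>c\<close>,
  so that it is determined by its components.
  All conditions on fields concern the points of the manifold only.\<close>

type_synonym ('a, 'v) tvec = "('a, 'v) chart \<Rightarrow> 'v"
type_synonym ('a, 'v) vfield = "'a \<Rightarrow> ('a, 'v) tvec"
type_synonym ('a, 'v) covec = "('a, 'v) tvec \<Rightarrow> real"
type_synonym ('a, 'v) endo = "'a \<Rightarrow> ('a, 'v) tvec \<Rightarrow> ('a, 'v) tvec"
type_synonym ('a, 'v) bilin = "'a \<Rightarrow> ('a, 'v) tvec \<Rightarrow> ('a, 'v) tvec \<Rightarrow> real"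

definition jacobian ::
    "('a, 'v::euclidean_space) chart \<Rightarrow> ('a, 'v) chart \<Rightarrow> 'a \<Rightarrow> 'v \<Rightarrow> 'v"
  where "jacobian c d p = frechet_derivative (transition c d) (at (snd c p))"

definition tangent_space ::
    "('a, 'v::euclidean_space) chart set \<Rightarrow> 'a \<Rightarrow> ('a, 'v) tvec set"
  where "tangent_space A p =
    {v. (\<forall>c. c \<notin> charts_at A p \<longrightarrow> v c = 0) \<and>
        (\<forall>c\<in>charts_at A p. \<forall>d\<in>charts_at A p. v d = jacobian c d p (v c))}"

text \<open>The tangent vector at \<open>p\<close> with component vector \<open>w\<close> in the chart \<open>c\<close> around \<open>p\<close>.\<close>

definition of_chart ::
    "('a, 'v::euclidean_space) chart set \<Rightarrow> ('a, 'v) chart \<Rightarrow> 'a \<Rightarrow> 'v \<Rightarrow> ('a, 'v) tvec"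
  where "of_chart A c p w = (\<lambda>d. if d \<in> charts_at A p then jacobian c d p w else 0)"

text \<open>Covectors vanish off the tangent space by convention, so that distinct covectors are
  distinct functions.\<close>

definition cotangent_space ::
    "('a, 'v::euclidean_space) chart set \<Rightarrow> 'a \<Rightarrow> ('a, 'v) covec set"
  where "cotangent_space A p =
    {\<omega>. linear_on (tangent_space A p) \<omega> \<and> (\<forall>v. v \<notin> tangent_space A p \<longrightarrow> \<omega> v = 0)}"

definition vector_field :: "('a, 'v::euclidean_space) chart set \<Rightarrow> ('a, 'v) vfield \<Rightarrow> bool"
  where "vector_field A X \<longleftrightarrow>
    (\<forall>p\<in>points A. X p \<in> tangent_space A p) \<and>
    (\<forall>c\<in>A. smooth_on (chart_img c) (\<lambda>u. X (chart_inv c u) c))"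

definition one_form :: "('a, 'v::euclidean_space) chart set \<Rightarrow> ('a \<Rightarrow> ('a, 'v) covec) \<Rightarrow> bool"
  where "one_form A \<alpha> \<longleftrightarrow>
    (\<forall>p\<in>points A. \<alpha> p \<in> cotangent_space A p) \<and>
    (\<forall>c\<in>A. \<forall>w. smooth_on (chart_img c)
       (\<lambda>u. \<alpha> (chart_inv c u) (of_chart A c (chart_inv c u) w)))"

definition tensor11 :: "('a, 'v::euclidean_space) chart set \<Rightarrow> ('a, 'v) endo \<Rightarrow> bool"
  where "tensor11 A T \<longleftrightarrow>
    (\<forall>p\<in>points A. linear_on (tangent_space A p) (T p) \<and>
       (\<forall>v\<in>tangent_space A p. T p v \<in> tangent_space A p)) \<and>
    (\<forall>c\<in>A. \<forall>w. smooth_on (chart_img c)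
       (\<lambda>u. T (chart_inv c u) (of_chart A c (chart_inv c u) w) c))"

text \<open>The components of a \<open>(0,2)\<close> tensor field in the coordinates of the chart \<open>c\<close>.\<close>

definition in_chart ::
    "('a, 'v::euclidean_space) chart set \<Rightarrow> ('a, 'v) bilin \<Rightarrow> ('a, 'v) chart
      \<Rightarrow> 'v \<Rightarrow> 'v \<Rightarrow> 'v \<Rightarrow> real"
  where "in_chart A g c u x y =
    g (chart_inv c u) (of_chart A c (chart_inv c u) x) (of_chart A c (chart_inv c u) y)"

definition tensor02 :: "('a, 'v::euclidean_space) chart set \<Rightarrow> ('a, 'v) bilin \<Rightarrow> bool"
  where "tensor02 A g \<longleftrightarrow>
    (\<forall>p\<in>points A. \<forall>v\<in>tangent_space A p.
       linear_on (tangent_space A p) (g p v) \<and> linear_on (tangent_space A p) (\<lambda>w. g p w v)) \<and>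
    (\<forall>c\<in>A. \<forall>x y. smooth_on (chart_img c) (\<lambda>u. in_chart A g c u x y))"

definition symmetric_tensor02 :: "('a, 'v::euclidean_space) chart set \<Rightarrow> ('a, 'v) bilin \<Rightarrow> bool"
  where "symmetric_tensor02 A g \<longleftrightarrow> tensor02 A g \<and>
    (\<forall>p\<in>points A. \<forall>v\<in>tangent_space A p. \<forall>w\<in>tangent_space A p. g p v w = g p w v)"

definition form_index :: "'a::real_vector set \<Rightarrow> ('a \<Rightarrow> 'a \<Rightarrow> real) \<Rightarrow> nat"
  where "form_index V b =
    Max {dim S |S. subspace S \<and> S \<subseteq> V \<and> (\<forall>v\<in>S. v \<noteq> 0 \<longrightarrow> b v v < 0)}"

definition semi_riemannian_metric ::
    "('a, 'v::euclidean_space) chart set \<Rightarrow> ('a, 'v) bilin \<Rightarrow> bool"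
  where "semi_riemannian_metric A g \<longleftrightarrow>
    symmetric_tensor02 A g \<and>
    (\<forall>p\<in>points A. \<forall>v\<in>tangent_space A p. (\<forall>w\<in>tangent_space A p. g p v w = 0) \<longrightarrow> v = 0) \<and>
    (\<exists>k. \<forall>p\<in>points A. form_index (tangent_space A p) (g p) = k)"


section \<open>Differential operators\<close>

text \<open>The derivative \<open>v(f)\<close> of a function in the direction of a tangent vector at \<open>p\<close>.\<close>

definition dir_deriv ::
    "('a, 'v::euclidean_space) chart set \<Rightarrow> 'a \<Rightarrow> ('a, 'v) tvec \<Rightarrow> ('a \<Rightarrow> real) \<Rightarrow> real"
  where "dir_deriv A p v f =
    (let c = chart_at A p in frechet_derivative (f \<circ> chart_inv c) (at (snd c p)) (v c))"

definition lie_bracket ::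
    "('a, 'v::euclidean_space) chart set \<Rightarrow> ('a, 'v) vfield \<Rightarrow> ('a, 'v) vfield \<Rightarrow> ('a, 'v) vfield"
  where "lie_bracket A X Y p = (\<lambda>c. if c \<in> charts_at A p then
      frechet_derivative (\<lambda>u. Y (chart_inv c u) c) (at (snd c p)) (X p c)
    - frechet_derivative (\<lambda>u. X (chart_inv c u) c) (at (snd c p)) (Y p c) else 0)"

text \<open>\<open>D p v X\<close> is the covariant derivative \<open>\<nabla>\<^sub>v X\<close> of the vector field \<open>X\<close> in the direction of the
  tangent vector \<open>v\<close> at \<open>p\<close>; being defined for single vectors \<open>v\<close> amounts to function-linearity
  in that argument.\<close>

type_synonym ('a, 'v) connection = "'a \<Rightarrow> ('a, 'v) tvec \<Rightarrow> ('a, 'v) vfield \<Rightarrow> ('a, 'v) tvec"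

definition linear_connection ::
    "('a, 'v::euclidean_space) chart set \<Rightarrow> ('a, 'v) connection \<Rightarrow> bool"
  where "linear_connection A D \<longleftrightarrow>
    (\<forall>X Z. vector_field A X \<longrightarrow> vector_field A Z \<longrightarrow> vector_field A (\<lambda>p. D p (Z p) X)) \<and>
    (\<forall>p\<in>points A.
      (\<forall>X. vector_field A X \<longrightarrow> linear_on (tangent_space A p) (\<lambda>v. D p v X) \<and>
         (\<forall>v\<in>tangent_space A p. D p v X \<in> tangent_space A p)) \<and>
      (\<forall>v\<in>tangent_space A p. \<forall>X Y. vector_field A X \<longrightarrow> vector_field A Y \<longrightarrow>
         D p v (\<lambda>q. X q + Y q) = D p v X + D p v Y) \<and>
      (\<forall>v\<in>tangent_space A p. \<forall>f X. smooth_fun A f \<longrightarrow> vector_field A X \<longrightarrow>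
         D p v (\<lambda>q. f q *\<^sub>R X q) = dir_deriv A p v f *\<^sub>R X p + f p *\<^sub>R D p v X))"

definition torsion_free ::
    "('a, 'v::euclidean_space) chart set \<Rightarrow> ('a, 'v) connection \<Rightarrow> bool"
  where "torsion_free A D \<longleftrightarrow>
    (\<forall>X Y. vector_field A X \<longrightarrow> vector_field A Y \<longrightarrow>
      (\<forall>p\<in>points A. D p (X p) Y - D p (Y p) X = lie_bracket A X Y p))"

definition flat :: "('a, 'v::euclidean_space) chart set \<Rightarrow> ('a, 'v) connection \<Rightarrow> bool"
  where "flat A D \<longleftrightarrow>
    (\<forall>X Y Z. vector_field A X \<longrightarrow> vector_field A Y \<longrightarrow> vector_field A Z \<longrightarrow>
      (\<forall>p\<in>points A. D p (X p) (\<lambda>q. D q (Y q) Z) - D p (Y p) (\<lambda>q. D q (X q) Z)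
         - D p (lie_bracket A X Y p) Z = 0))"

definition levi_civita ::
    "('a, 'v::euclidean_space) chart set \<Rightarrow> ('a, 'v) bilin \<Rightarrow> ('a, 'v) connection \<Rightarrow> bool"
  where "levi_civita A g D \<longleftrightarrow> linear_connection A D \<and> torsion_free A D \<and>
    (\<forall>X Y. vector_field A X \<longrightarrow> vector_field A Y \<longrightarrow>
      (\<forall>p\<in>points A. \<forall>v\<in>tangent_space A p.
         dir_deriv A p v (\<lambda>q. g q (X q) (Y q)) = g p (D p v X) (Y p) + g p (X p) (D p v Y)))"

definition parallel11 ::
    "('a, 'v::euclidean_space) chart set \<Rightarrow> ('a, 'v) connection \<Rightarrow> ('a, 'v) endo \<Rightarrow> bool"
  where "parallel11 A D T \<longleftrightarrow>
    (\<forall>X. vector_field A X \<longrightarrow> (\<forall>p\<in>points A. \<forall>v\<in>tangent_space A p.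
       D p v (\<lambda>q. T q (X q)) - T p (D p v X) = 0))"

text \<open>The condition \<open>d\<Omega> = 0\<close> for a 2-form \<open>\<Omega>\<close>; the normalisation of \<open>d\<close> is immaterial.\<close>

definition closed_2form :: "('a, 'v::euclidean_space) chart set \<Rightarrow> ('a, 'v) bilin \<Rightarrow> bool"
  where "closed_2form A \<Omega> \<longleftrightarrow>
    (\<forall>X Y Z. vector_field A X \<longrightarrow> vector_field A Y \<longrightarrow> vector_field A Z \<longrightarrow>
      (\<forall>p\<in>points A.
          dir_deriv A p (X p) (\<lambda>q. \<Omega> q (Y q) (Z q))
        - dir_deriv A p (Y p) (\<lambda>q. \<Omega> q (X q) (Z q))
        + dir_deriv A p (Z p) (\<lambda>q. \<Omega> q (X q) (Y q))
        - \<Omega> p (lie_bracket A X Y p) (Z p)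
        + \<Omega> p (lie_bracket A X Z p) (Y p)
        - \<Omega> p (lie_bracket A Y Z p) (X p) = 0))"


section \<open>Para-Hermitian structures\<close>

definition almost_para_complex ::
    "('a, 'v::euclidean_space) chart set \<Rightarrow> ('a, 'v) endo \<Rightarrow> bool"
  where "almost_para_complex A P \<longleftrightarrow>
    even (DIM('v)) \<and> tensor11 A P \<and>
    \<not> (\<forall>p\<in>points A. \<forall>v\<in>tangent_space A p. P p v = v) \<and>
    \<not> (\<forall>p\<in>points A. \<forall>v\<in>tangent_space A p. P p v = - v) \<and>
    (\<forall>p\<in>points A. (\<forall>v\<in>tangent_space A p. P p (P p v) = v) \<and>
       dim {v \<in> tangent_space A p. P p v = v} = dim {v \<in> tangent_space A p. P p v = - v})"

definition almost_para_hermitian ::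
    "('a, 'v::euclidean_space) chart set \<Rightarrow> ('a, 'v) endo \<Rightarrow> ('a, 'v) bilin \<Rightarrow> bool"
  where "almost_para_hermitian A P g \<longleftrightarrow>
    smooth_manifold A \<and> almost_para_complex A P \<and> semi_riemannian_metric A g \<and>
    (\<forall>p\<in>points A. \<forall>v\<in>tangent_space A p. \<forall>w\<in>tangent_space A p.
       g p (P p v) (P p w) = - g p v w)"

definition almost_para_kahler ::
    "('a, 'v::euclidean_space) chart set \<Rightarrow> ('a, 'v) endo \<Rightarrow> ('a, 'v) bilin \<Rightarrow> bool"
  where "almost_para_kahler A P g \<longleftrightarrow>
    almost_para_hermitian A P g \<and> closed_2form A (\<lambda>p v w. g p v (P p w))"

definition para_kahler ::
    "('a, 'v::euclidean_space) chart set \<Rightarrow> ('a, 'v) endo \<Rightarrow> ('a, 'v) bilin \<Rightarrow> bool"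
  where "para_kahler A P g \<longleftrightarrow>
    almost_para_hermitian A P g \<and> (\<exists>D. levi_civita A g D \<and> parallel11 A D P)"


section \<open>Harmonic maps and harmonic endomorphism fields\<close>

text \<open>First in coordinates: \<open>G u\<close> is the matrix of a metric at the coordinate point \<open>u\<close>.
  \<open>christoffel G u x y\<close> is the vector \<open>\<Gamma>\<^sup>k\<^sub>i\<^sub>j x\<^sup>i y\<^sup>j\<close> for the Levi-Civita connection,
  and \<open>sharp (G u) b\<close> for a basis vector \<open>b\<close> is the vector \<open>G\<^sup>i\<^sup>j\<close> with \<open>b\<close> in the role of \<open>i\<close>.\<close>

definition christoffel :: "('v \<Rightarrow> 'v \<Rightarrow> 'v \<Rightarrow> real) \<Rightarrow> 'v::euclidean_space \<Rightarrow> 'v \<Rightarrow> 'v \<Rightarrow> 'v"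
  where "christoffel G u x y = (THE z. \<forall>w. 2 * G u z w =
      frechet_derivative (\<lambda>u'. G u' y w) (at u) x
    + frechet_derivative (\<lambda>u'. G u' x w) (at u) y
    - frechet_derivative (\<lambda>u'. G u' x y) (at u) w)"

definition sharp :: "('v \<Rightarrow> 'v \<Rightarrow> real) \<Rightarrow> 'v::euclidean_space \<Rightarrow> 'v"
  where "sharp b x = (THE z. \<forall>w. b z w = x \<bullet> w)"

text \<open>The tension field \<open>trace\<^sub>G \<nabla>dF\<close>, that is
  \<open>G\<^sup>i\<^sup>j (\<partial>\<^sub>i\<partial>\<^sub>jF - \<Gamma>\<^sup>k\<^sub>i\<^sub>j \<partial>\<^sub>kF + \<Gamma>'(F)(\<partial>\<^sub>iF, \<partial>\<^sub>jF))\<close>, of a map from \<open>G\<close> to \<open>H\<close>.\<close>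

definition tension ::
    "('v \<Rightarrow> 'v \<Rightarrow> 'v \<Rightarrow> real) \<Rightarrow> ('w \<Rightarrow> 'w \<Rightarrow> 'w \<Rightarrow> real) \<Rightarrow>
      ('v::euclidean_space \<Rightarrow> 'w::euclidean_space) \<Rightarrow> 'v \<Rightarrow> 'w"
  where "tension G H F u =
    (\<Sum>b\<in>Basis. let b' = sharp (G u) b; DF = (\<lambda>u. frechet_derivative F (at u)) in
        frechet_derivative (\<lambda>u'. DF u' b') (at u) b
      - DF u (christoffel G u b b')
      + christoffel H (F u) (DF u b) (DF u b'))"

text \<open>The tension field is a section of \<open>f\<^sup>*TB\<close>, so its vanishing may be tested in any pair of
  charts around \<open>p\<close> and \<open>f p\<close>.\<close>

definition harmonic_map ::
    "('a, 'v::euclidean_space) chart set \<Rightarrow> ('a, 'v) bilin \<Rightarrow>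
     ('b, 'w::euclidean_space) chart set \<Rightarrow> ('b, 'w) bilin \<Rightarrow> ('a \<Rightarrow> 'b) \<Rightarrow> bool"
  where "harmonic_map A g B h f \<longleftrightarrow>
    (\<forall>p\<in>points A. \<exists>c\<in>charts_at A p. \<exists>d\<in>charts_at B (f p).
       f ` fst c \<subseteq> fst d \<and>
       smooth_on (chart_img c) (snd d \<circ> f \<circ> chart_inv c) \<and>
       (\<forall>u\<in>chart_img c.
          tension (in_chart A g c) (in_chart B h d) (snd d \<circ> f \<circ> chart_inv c) u = 0))"

definition tan_chart ::
    "('a, 'v::euclidean_space) chart set \<Rightarrow> ('a, 'v) chart
      \<Rightarrow> ('a \<times> ('a, 'v) tvec, 'v \<times> 'v) chart"
  where "tan_chart A c =
    ({(p, v). p \<in> fst c \<and> v \<in> tangent_space A p}, \<lambda>(p, v). (snd c p, v c))"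

definition tangent_bundle ::
    "('a, 'v::euclidean_space) chart set \<Rightarrow> ('a \<times> ('a, 'v) tvec, 'v \<times> 'v) chart set"
  where "tangent_bundle A = tan_chart A ` A"

text \<open>\<open>h\<^sup>C = y\<^sup>k \<partial>\<^sub>kh\<^sub>i\<^sub>j dx\<^sup>i dx\<^sup>j + 2 h\<^sub>i\<^sub>j dx\<^sup>i dy\<^sup>j\<close>, evaluated on vectors with induced components
  \<open>(\<xi>, \<xi>')\<close> and \<open>(\<eta>, \<eta>')\<close>.\<close>

definition complete_lift_metric ::
    "('a, 'v::euclidean_space) chart set \<Rightarrow> ('a, 'v) bilin
      \<Rightarrow> ('a \<times> ('a, 'v) tvec, 'v \<times> 'v) bilin"
  where "complete_lift_metric A h = (\<lambda>(p, v) \<Xi> H.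
    (let c = chart_at A p; u = snd c p; G = in_chart A h c;
         (\<xi>, \<xi>') = \<Xi> (tan_chart A c); (\<eta>, \<eta>') = H (tan_chart A c) in
     frechet_derivative (\<lambda>u'. G u' \<xi> \<eta>) (at u) (v c) + G u \<xi> \<eta>' + G u \<eta> \<xi>'))"

definition harmonic_endo ::
    "('a, 'v::euclidean_space) chart set \<Rightarrow> ('a, 'v) bilin \<Rightarrow> ('a, 'v) endo \<Rightarrow> bool"
  where "harmonic_endo A h T \<longleftrightarrow>
    harmonic_map (tangent_bundle A) (complete_lift_metric A h)
      (tangent_bundle A) (complete_lift_metric A h) (\<lambda>(p, v). (p, T p v))"


section \<open>The cotangent bundle and lifts to it\<close>

text \<open>The components \<open>\<omega>\<^sub>i\<close> of a covector are collected in the vector \<open>\<Sum> \<omega>\<^sub>i e\<^sub>i\<close> of the model space.\<close>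

definition covec_comp ::
    "('a, 'v::euclidean_space) chart set \<Rightarrow> ('a, 'v) chart \<Rightarrow> 'a \<Rightarrow> ('a, 'v) covec \<Rightarrow> 'v"
  where "covec_comp A c p \<omega> = (\<Sum>b\<in>Basis. \<omega> (of_chart A c p b) *\<^sub>R b)"

definition cot_chart ::
    "('a, 'v::euclidean_space) chart set \<Rightarrow> ('a, 'v) chart
      \<Rightarrow> ('a \<times> ('a, 'v) covec, 'v \<times> 'v) chart"
  where "cot_chart A c =
    ({(p, \<omega>). p \<in> fst c \<and> \<omega> \<in> cotangent_space A p},
     \<lambda>(p, \<omega>). (snd c p, covec_comp A c p \<omega>))"

definition cotangent_bundle ::
    "('a, 'v::euclidean_space) chart set \<Rightarrow> ('a \<times> ('a, 'v) covec, 'v \<times> 'v) chart set"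
  where "cotangent_bundle A = cot_chart A ` A"

text \<open>The vertical vector \<open>\<Sum> \<eta>\<^sub>i \<partial>\<^sub>i\<^sub>*\<close> at \<open>(p, \<omega>)\<close> corresponding to the covector \<open>\<eta>\<close> at \<open>p\<close>.\<close>

definition vertical_vec ::
    "('a, 'v::euclidean_space) chart set \<Rightarrow> 'a \<times> ('a, 'v) covec \<Rightarrow> ('a, 'v) covec
      \<Rightarrow> ('a \<times> ('a, 'v) covec, 'v \<times> 'v) tvec"
  where "vertical_vec A = (\<lambda>(p, \<omega>) \<eta>. let c = chart_at A p in
    of_chart (cotangent_bundle A) (cot_chart A c) (p, \<omega>) (0, covec_comp A c p \<eta>))"

text \<open>\<open>\<alpha>\<^sup>V = \<Sum> \<alpha>\<^sub>i \<partial>\<^sub>i\<^sub>*\<close>\<close>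

definition vertical_lift ::
    "('a, 'v::euclidean_space) chart set \<Rightarrow> ('a \<Rightarrow> ('a, 'v) covec)
      \<Rightarrow> ('a \<times> ('a, 'v) covec, 'v \<times> 'v) vfield"
  where "vertical_lift A \<alpha> = (\<lambda>(p, \<omega>). vertical_vec A (p, \<omega>) (\<alpha> p))"

text \<open>\<open>C(T)\<close> is at \<open>(p, \<omega>)\<close> the vertical vector corresponding to \<open>\<omega> \<circ> T\<^sub>p\<close>.\<close>

definition contracted ::
    "('a, 'v::euclidean_space) chart set \<Rightarrow> ('a, 'v) endo
      \<Rightarrow> ('a \<times> ('a, 'v) covec, 'v \<times> 'v) vfield"
  where "contracted A T = (\<lambda>(p, \<omega>). vertical_vec A (p, \<omega>) (\<lambda>v. \<omega> (T p v)))"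

text \<open>\<open>X\<^sup>C = \<Sum> X\<^sup>i \<partial>\<^sub>i - \<Sum> \<omega>\<^sub>h (\<partial>\<^sub>iX\<^sup>h) \<partial>\<^sub>i\<^sub>*\<close>, the vector field on the cotangent bundle with
  \<open>X\<^sup>C(Z\<^sup>V) = [X,Z]\<^sup>V\<close> for all \<open>Z\<close>, where \<open>Z\<^sup>V(p, \<omega>) = \<omega>(Z\<^sub>p)\<close>.\<close>

definition complete_lift ::
    "('a, 'v::euclidean_space) chart set \<Rightarrow> ('a, 'v) vfield
      \<Rightarrow> ('a \<times> ('a, 'v) covec, 'v \<times> 'v) vfield"
  where "complete_lift A X = (\<lambda>(p, \<omega>). let c = chart_at A p in
    of_chart (cotangent_bundle A) (cot_chart A c) (p, \<omega>)
      (X p c, - (\<Sum>b\<in>Basis. (covec_comp A c p \<omega> \<bullet>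
          frechet_derivative (\<lambda>u. X (chart_inv c u) c) (at (snd c p)) b) *\<^sub>R b)))"

text \<open>Nondegeneracy and the signature \<open>(n,n)\<close> follow from the identities below.\<close>

definition nonproper_riemann_extension ::
    "('a, 'v::euclidean_space) chart set \<Rightarrow> ('a, 'v) connection \<Rightarrow> real
      \<Rightarrow> ('a \<times> ('a, 'v) covec, 'v \<times> 'v) bilin \<Rightarrow> bool"
  where "nonproper_riemann_extension A D a g \<longleftrightarrow>
    symmetric_tensor02 (cotangent_bundle A) g \<and>
    (\<forall>(p, \<omega>)\<in>points (cotangent_bundle A).
      (\<forall>X Y. vector_field A X \<longrightarrow> vector_field A Y \<longrightarrow>
         g (p, \<omega>) (complete_lift A X (p, \<omega>)) (complete_lift A Y (p, \<omega>)) =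
           - a * \<omega> (D p (X p) Y + D p (Y p) X)) \<and>
      (\<forall>X \<alpha>. vector_field A X \<longrightarrow> one_form A \<alpha> \<longrightarrow>
         g (p, \<omega>) (complete_lift A X (p, \<omega>)) (vertical_lift A \<alpha> (p, \<omega>)) = a * \<alpha> p (X p)) \<and>
      (\<forall>\<alpha> \<beta>. one_form A \<alpha> \<longrightarrow> one_form A \<beta> \<longrightarrow>
         g (p, \<omega>) (vertical_lift A \<alpha> (p, \<omega>)) (vertical_lift A \<beta> (p, \<omega>)) = 0))"

end

theory Submission
  imports Defs
begin

text \<open>In the coordinates \<open>(x, \<omega>)\<close> of the cotangent bundle induced by a chart with Christoffel symbols \<open>\<Gamma>\<close>
  the metric is \<open>g ((x, x'), (y, y')) = a (x \<bullet> y' + y \<bullet> x' - 2 \<omega> \<bullet> \<Gamma> x y)\<close> and the structure is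
  \<open>P (x, x') = (x, 2 \<omega> \<circ> \<Gamma> (\<cdot>, x) - x')\<close>, because the complete lift of a field which is constant near a
  point is \<open>(x, 0)\<close> there. Hence \<open>P\<close> is a para-Hermitian involution, and \<open>g (X, P Y) = a (y \<bullet> x' - x \<bullet> y')\<close>
  has constant coefficients, so it is closed. Computing the Christoffel symbols of \<open>g\<close> gives
  \<open>(\<nabla>\<^sub>Z P) X = (0, 2 \<omega> \<circ> R (\<cdot>, x) z)\<close>. This vanishes if \<open>M\<close> is flat. Its trace always vanishes, since the
  dual of a horizontal basis vector is vertical and the expression needs both \<open>x\<close> and \<open>z\<close>. Finally the
  tension field of \<open>T : (TN, h\<^sup>C) \<rightarrow> (TN, h\<^sup>C)\<close> is the vertical vector \<open>2 \<delta>T\<close>.\<close>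

section \<open>Smooth maps between Euclidean spaces\<close>

text \<open>The obstacle is that the global notions only accept fields on the whole manifold: a
  connection takes an entire vector field, and \<open>g\<close> and \<open>P\<close> are prescribed
  on lifts of global fields and 1-forms. Coordinate fields must therefore be extended by cutoffs,
  whose smoothness rests on the Hausdorff property, and locality of \<open>D\<close> must be derived
  before Christoffel symbols make sense. After that, every tangent vector of the cotangent bundle is
  a value of a complete lift plus a value of a vertical lift, so \<open>g\<close> and
  \<open>P\<close> are known in every induced chart. The remaining computations live on open sets of
  Euclidean spaces, in \<open>local_metric\<close>, \<open>local_endo\<close> and
  \<open>local_extension\<close>. For \<open>para_kahler\<close> a Levi-Civita connection has to be
  exhibited; it is assembled from the coordinate symbols of each chart, where the second derivatives
  of the transition maps cancel. Harmonicity is shown as vanishing tension between complete lifts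
  rather than quoted as vanishing divergence.\<close>

lemma frechet_derivative_eq: "(f has_derivative f') (at x) \<Longrightarrow> frechet_derivative f (at x) = f'"
  by (rule frechet_derivative_at [symmetric])

lemma ck_on_subset: "ck_on k T f \<Longrightarrow> S \<subseteq> T \<Longrightarrow> ck_on k S f"
  by (induction k arbitrary: f) (auto intro: continuous_on_subset)

text \<open>Openness enters because each derivative looks at a full neighbourhood of the point. The
  induction generalises over both functions, since the step passes to the pair of their directional
  derivatives.\<close>

lemma ck_on_cong:
  fixes f g :: "'a::real_normed_vector \<Rightarrow> 'b::real_normed_vector"
  assumes "open S" "\<And>x. x \<in> S \<Longrightarrow> f x = g x"
  shows "ck_on k S f \<longleftrightarrow> ck_on k S g"
  using assms(2)
proof (induction k arbitrary: f g)
  case 0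
  then show ?case by (simp cong: continuous_on_cong)
next
  case (Suc k)
  have *: "ck_on (Suc k) S g'" if f: "ck_on (Suc k) S f'" and eq: "\<And>x. x \<in> S \<Longrightarrow> f' x = g' x" for f' g' :: "'a \<Rightarrow> 'b"
  proof -
    have "g' differentiable (at x)" if "x \<in> S" for x
      using f eq that assms(1) has_derivative_transform_within_open[of f' _ x UNIV S g']
      by (auto simp: differentiable_def) blast
    moreover have "frechet_derivative f' (at x) = frechet_derivative g' (at x)" if "x \<in> S" for x
      using f eq that assms(1) frechet_derivative_transform_within_open[of f' x S g'] by auto
    then have "ck_on k S (\<lambda>x. frechet_derivative g' (at x) v)" for v
      using f Suc.IH[of "\<lambda>x. frechet_derivative f' (at x) v" "\<lambda>x. frechet_derivative g' (at x) v"]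
      by simp
    ultimately show ?thesis by simp
  qed
  show ?case
    using *[of f g] *[of g f] Suc.prems by metis
qed

lemma ck_on_SucD: "ck_on (Suc k) S f \<Longrightarrow> ck_on k S f"
proof (induction k arbitrary: f)
  case 0
  then show ?case
    by (simp add: differentiable_at_imp_differentiable_on differentiable_imp_continuous_on)
next
  case (Suc k)
  then show ?case by (metis ck_on.simps(2))
qed

lemma ck_on_local:
  assumes "\<And>x. x \<in> S \<Longrightarrow> \<exists>T. open T \<and> x \<in> T \<and> ck_on k T f"
  shows "ck_on k S f"
  using assms
proof (induction k arbitrary: f)
  case 0
  then have "\<forall>x\<in>S. isCont f x"
    by (metis ck_on.simps(1) continuous_on_eq_continuous_at)
  then show ?case by (simp add: continuous_at_imp_continuous_on)
next
  case (Suc k)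
  have "\<exists>T. open T \<and> x \<in> T \<and> ck_on k T (\<lambda>x. frechet_derivative f (at x) v)" if "x \<in> S" for x v
    using Suc.prems[OF that] by auto
  then have "ck_on k S (\<lambda>x. frechet_derivative f (at x) v)" for v
    by (rule Suc.IH)
  moreover have "f differentiable (at x)" if "x \<in> S" for x
    using Suc.prems[OF that] by auto
  ultimately show ?case by simp
qed

lemma ck_on_const [simp]: "ck_on k S (\<lambda>x. c)"
proof (induction k arbitrary: c)
  case 0
  then show ?case by simp
next
  case (Suc k)
  then show ?case by (simp add: frechet_derivative_const)
qed

lemma ck_on_linear:
  assumes "bounded_linear f" "open S" "ck_on k S h"
  shows "ck_on k S (\<lambda>x. f (h x))"
  using assms(3)
proof (induction k arbitrary: h)
  case 0
  then show ?case using assms(1) by (simp add: bounded_linear.continuous_on)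
next
  case (Suc k)
  have *: "((\<lambda>x. f (h x)) has_derivative (\<lambda>v. f (frechet_derivative h (at x) v))) (at x)"
    if "x \<in> S" for x
    using Suc.prems that frechet_derivative_works[of h "at x"]
    by (auto intro: bounded_linear.has_derivative[OF assms(1)])
  have "ck_on k S (\<lambda>x. frechet_derivative (\<lambda>x. f (h x)) (at x) v)" for v
    by (subst ck_on_cong[OF assms(2), of _ "\<lambda>x. f (frechet_derivative h (at x) v)"])
       (use Suc fun_cong[OF frechet_derivative_eq[OF *]] in auto)
  then show ?case using * by (auto simp: differentiable_def)
qed

lemma ck_on_add:
  assumes "open S" "ck_on k S f" "ck_on k S g"
  shows "ck_on k S (\<lambda>x. f x + g x)"
  using assms(2,3)
proof (induction k arbitrary: f g)
  case 0
  then show ?case by (simp add: continuous_on_add)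
next
  case (Suc k)
  have "ck_on k S (\<lambda>x. frechet_derivative (\<lambda>x. f x + g x) (at x) v)" for v
    by (subst ck_on_cong[OF assms(1), of _ "\<lambda>x. frechet_derivative f (at x) v + frechet_derivative g (at x) v"])
       (use Suc in \<open>auto intro!: fun_cong[OF frechet_derivative_eq] has_derivative_add
         simp: frechet_derivative_works[symmetric]\<close>)
  then show ?case using Suc.prems by auto
qed

text \<open>Leibniz rule: the derivative is a sum of two products of the same kind with one factor
  differentiated, so the induction varies both \<open>f\<close> and \<open>g\<close>. One statement
  covers scaling, inner products and real multiplication.\<close>

lemma ck_on_bilinear:
  assumes "bounded_bilinear pr" "open S" "ck_on k S f" "ck_on k S g"
  shows "ck_on k S (\<lambda>x. pr (f x) (g x))"
  using assms(3,4)
proof (induction k arbitrary: f g)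
  case 0
  then show ?case by (simp add: bounded_bilinear.continuous_on[OF assms(1)])
next
  case (Suc k)
  have *: "((\<lambda>x. pr (f x) (g x)) has_derivative
      (\<lambda>v. pr (f x) (frechet_derivative g (at x) v) + pr (frechet_derivative f (at x) v) (g x))) (at x)"
    if "x \<in> S" for x
    using Suc.prems that frechet_derivative_works[of f "at x"] frechet_derivative_works[of g "at x"]
    by (auto intro: bounded_bilinear.FDERIV[OF assms(1)])
  have "ck_on k S (\<lambda>x. frechet_derivative (\<lambda>x. pr (f x) (g x)) (at x) v)" for v
    by (subst ck_on_cong[OF assms(2), of _
         "\<lambda>x. pr (f x) (frechet_derivative g (at x) v) + pr (frechet_derivative f (at x) v) (g x)"])
       (use fun_cong[OF frechet_derivative_eq[OF *]] Suc.prems in \<open>auto intro!: ck_on_add assms(2) Suc.IH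
          ck_on_SucD[OF Suc.prems(1)] ck_on_SucD[OF Suc.prems(2)]\<close>)
  then show ?case using * by (auto simp: differentiable_def)
qed

lemma ck_on_sum:
  assumes "open S" "\<And>i. i \<in> I \<Longrightarrow> ck_on k S (f i)"
  shows "ck_on k S (\<lambda>x. \<Sum>i\<in>I. f i x)"
  using assms(2) by (induction I rule: infinite_finite_induct) (auto intro: ck_on_add assms(1))

lemma linear_Basis_sum:
  fixes f :: "'a::euclidean_space \<Rightarrow> 'b::real_vector"
  assumes "linear f"
  shows "f x = (\<Sum>b\<in>Basis. (x \<bullet> b) *\<^sub>R f b)"
  using euclidean_representation[of x] linear_sum[OF assms] linear_scale[OF assms] by (metis (no_types, lifting) sum.cong)

text \<open>The outer derivative is applied to a direction that itself varies with the point.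
  Expanding that direction in a basis turns the chain rule into a finite sum of products, to which
  the induction hypothesis applies; this is where the middle space is Euclidean.\<close>

lemma ck_on_compose:
  fixes f :: "'a::real_normed_vector \<Rightarrow> 'b::euclidean_space"
  assumes "open S" "open T" "f ` S \<subseteq> T" "ck_on k T g" "ck_on k S f"
  shows "ck_on k S (\<lambda>x. g (f x))"
  using assms(4,5)
proof (induction k arbitrary: g)
  case 0
  then show ?case using assms(3) continuous_on_compose2 by fastforce
next
  case (Suc k)
  have *: "((\<lambda>x. g (f x)) has_derivative
      (\<lambda>v. frechet_derivative g (at (f x)) (frechet_derivative f (at x) v))) (at x)"
    if "x \<in> S" for x
    using Suc.prems that frechet_derivative_works[of f "at x"] frechet_derivative_works[of g "at (f x)"]
      assms(3) by (auto intro: has_derivative_compose)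
  have lin: "linear (frechet_derivative g (at (f x)))" if "x \<in> S" for x
    using that Suc.prems assms(3) by (auto intro: linear_frechet_derivative)
  have "ck_on k S (\<lambda>x. frechet_derivative (\<lambda>x. g (f x)) (at x) v)" for v
  proof (subst ck_on_cong[OF assms(1)])
    fix x assume "x \<in> S"
    then show "frechet_derivative (\<lambda>x. g (f x)) (at x) v =
       (\<Sum>b\<in>Basis. (frechet_derivative f (at x) v \<bullet> b) *\<^sub>R frechet_derivative g (at (f x)) b)"
      by (subst linear_Basis_sum[OF lin, symmetric]) (auto simp: fun_cong[OF frechet_derivative_eq[OF *]])
  next
    show "ck_on k S (\<lambda>x. \<Sum>b\<in>Basis. (frechet_derivative f (at x) v \<bullet> b) *\<^sub>R frechet_derivative g (at (f x)) b)"
      using Suc.prems by (intro ck_on_sum ck_on_bilinear[OF bounded_bilinear_scaleR] assms(1) Suc.IH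
          ck_on_linear[OF bounded_linear_inner_left] ck_on_SucD[OF Suc.prems(2)]) auto
  qed
  then show ?case using * by (auto simp: differentiable_def)
qed

lemma smooth_on_subset: "smooth_on T f \<Longrightarrow> S \<subseteq> T \<Longrightarrow> smooth_on S f"
  unfolding smooth_on_def by (blast intro: ck_on_subset)

lemma smooth_on_cong:
  "open S \<Longrightarrow> (\<And>x. x \<in> S \<Longrightarrow> f x = g x) \<Longrightarrow> smooth_on S f \<longleftrightarrow> smooth_on S g"
  unfolding smooth_on_def using ck_on_cong by blast

lemma smooth_on_local:
  "(\<And>x. x \<in> S \<Longrightarrow> \<exists>T. open T \<and> x \<in> T \<and> smooth_on T f) \<Longrightarrow> smooth_on S f"
  unfolding smooth_on_def by (meson ck_on_local)

lemma smooth_on_differentiable: "smooth_on S f \<Longrightarrow> x \<in> S \<Longrightarrow> f differentiable (at x)"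
  unfolding smooth_on_def by (metis ck_on.simps(2))

lemma smooth_on_has_derivative:
  "smooth_on S f \<Longrightarrow> x \<in> S \<Longrightarrow> (f has_derivative frechet_derivative f (at x)) (at x)"
  using smooth_on_differentiable frechet_derivative_works by blast

lemma smooth_on_frechet: "smooth_on S f \<Longrightarrow> smooth_on S (\<lambda>x. frechet_derivative f (at x) v)"
  unfolding smooth_on_def by (metis ck_on.simps(2))

lemma smooth_on_linear_frechet: "smooth_on S f \<Longrightarrow> x \<in> S \<Longrightarrow> linear (frechet_derivative f (at x))"
  by (simp add: linear_frechet_derivative smooth_on_differentiable)

lemma smooth_on_continuous: "smooth_on S f \<Longrightarrow> continuous_on S f"
  unfolding smooth_on_def by (metis ck_on.simps(1))

lemma smooth_on_const [simp]: "smooth_on S (\<lambda>x. c)"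
  by (simp add: smooth_on_def)

lemma smooth_on_linear: "bounded_linear f \<Longrightarrow> open S \<Longrightarrow> smooth_on S h \<Longrightarrow> smooth_on S (\<lambda>x. f (h x))"
  by (simp add: smooth_on_def ck_on_linear)

lemma smooth_on_ident: "smooth_on S (\<lambda>x. x)"
proof -
  have "ck_on k S (\<lambda>x. x)" for k
    by (cases k) (auto simp: frechet_derivative_ident)
  then show ?thesis by (simp add: smooth_on_def)
qed

lemma smooth_on_bilinear:
  "bounded_bilinear pr \<Longrightarrow> open S \<Longrightarrow> smooth_on S f \<Longrightarrow> smooth_on S g \<Longrightarrow>
    smooth_on S (\<lambda>x. pr (f x) (g x))"
  by (simp add: smooth_on_def ck_on_bilinear)

lemma smooth_on_add:
  "open S \<Longrightarrow> smooth_on S f \<Longrightarrow> smooth_on S g \<Longrightarrow> smooth_on S (\<lambda>x. f x + g x)"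
  by (simp add: smooth_on_def ck_on_add)

lemma smooth_on_minus: "open S \<Longrightarrow> smooth_on S f \<Longrightarrow> smooth_on S (\<lambda>x. - f x)"
  using smooth_on_linear[OF bounded_linear_minus[OF bounded_linear_ident]] by blast

lemma smooth_on_diff:
  "open S \<Longrightarrow> smooth_on S f \<Longrightarrow> smooth_on S g \<Longrightarrow> smooth_on S (\<lambda>x. f x - g x)"
  using smooth_on_add[of S f "\<lambda>x. - g x"] smooth_on_minus[of S g] by simp

lemma smooth_on_sum:
  "open S \<Longrightarrow> (\<And>i. i \<in> I \<Longrightarrow> smooth_on S (f i)) \<Longrightarrow> smooth_on S (\<lambda>x. \<Sum>i\<in>I. f i x)"
  by (simp add: smooth_on_def ck_on_sum)

lemmas smooth_on_scaleR = smooth_on_bilinear[OF bounded_bilinear_scaleR]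
  and smooth_on_inner = smooth_on_bilinear[OF bounded_bilinear_inner]
  and smooth_on_mult = smooth_on_bilinear[OF bounded_bilinear_mult]
  and smooth_on_fst = smooth_on_linear[OF bounded_linear_fst]
  and smooth_on_snd = smooth_on_linear[OF bounded_linear_snd]

lemma smooth_on_Pair:
  assumes "open S" "smooth_on S f" "smooth_on S g"
  shows "smooth_on S (\<lambda>x. (f x, g x))"
proof -
  have "smooth_on S (\<lambda>x. (f x, 0) + (0, g x))"
    by (intro smooth_on_add assms
        smooth_on_linear[OF bounded_linear_Pair[OF bounded_linear_ident bounded_linear_zero]]
        smooth_on_linear[OF bounded_linear_Pair[OF bounded_linear_zero bounded_linear_ident]])
  then show ?thesis by simp
qed

lemma smooth_on_compose:
  fixes f :: "'a::real_normed_vector \<Rightarrow> 'b::euclidean_space"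
  shows "open S \<Longrightarrow> open T \<Longrightarrow> f ` S \<subseteq> T \<Longrightarrow> smooth_on T g \<Longrightarrow> smooth_on S f \<Longrightarrow>
    smooth_on S (\<lambda>x. g (f x))"
  by (simp add: smooth_on_def ck_on_compose)

text \<open>Families of linear maps are treated as plain functions \<open>L x w\<close>, smooth in
  \<open>x\<close> for each fixed \<open>w\<close>, with no norm on a space of operators. Expanding
  the moving argument in a basis reduces to this case.\<close>

lemma smooth_on_apply_linear:
  fixes h :: "'a::real_normed_vector \<Rightarrow> 'b::euclidean_space"
  assumes "open S" "\<And>x. x \<in> S \<Longrightarrow> linear (L x)" "\<And>w. smooth_on S (\<lambda>x. L x w)" "smooth_on S h"
  shows "smooth_on S (\<lambda>x. L x (h x))"
proof -
  have "smooth_on S (\<lambda>x. \<Sum>b\<in>Basis. (h x \<bullet> b) *\<^sub>R L x b)"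
    by (intro smooth_on_sum smooth_on_scaleR smooth_on_inner smooth_on_const assms)
  then show ?thesis
    by (subst smooth_on_cong[OF assms(1)]) (auto intro: linear_Basis_sum assms(2))
qed

lemma smooth_on_apply_bilinear:
  fixes h :: "'a::real_normed_vector \<Rightarrow> 'b::euclidean_space"
    and k :: "'a \<Rightarrow> 'c::euclidean_space"
  assumes "open S" "\<And>x. x \<in> S \<Longrightarrow> bilinear (B x)" "\<And>v w. smooth_on S (\<lambda>x. B x v w)"
    "smooth_on S h" "smooth_on S k"
  shows "smooth_on S (\<lambda>x. B x (h x) (k x))"
proof -
  have *: "smooth_on S (\<lambda>x. B x v (k x))" for v
    by (rule smooth_on_apply_linear) (use assms in \<open>auto simp: bilinear_def\<close>)
  show ?thesis
    by (rule smooth_on_apply_linear[of S "\<lambda>x v. B x v (k x)"])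
       (use assms * in \<open>auto simp: bilinear_def\<close>)
qed

lemma smooth_on_frechet_apply:
  fixes f :: "'a::euclidean_space \<Rightarrow> 'b::real_normed_vector"
  assumes "open S" "smooth_on S f" "smooth_on S h"
  shows "smooth_on S (\<lambda>x. frechet_derivative f (at x) (h x))"
  by (rule smooth_on_apply_linear)
     (use assms in \<open>auto intro: smooth_on_frechet smooth_on_linear_frechet\<close>)

text \<open>A product rule for \<open>L x (h x)\<close>. Differentiability for each fixed argument
  suffices because the argument space is finite dimensional: in a basis the expression is a finite
  sum of products.\<close>

lemma has_derivative_apply_linear:
  fixes h :: "'a::real_normed_vector \<Rightarrow> 'b::euclidean_space"
  assumes "open S" "x0 \<in> S" "\<And>x. x \<in> S \<Longrightarrow> linear (L x)"
    and diff: "\<And>w. (\<lambda>x. L x w) differentiable (at x0)"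
    and h: "(h has_derivative h') (at x0)"
  shows "((\<lambda>x. L x (h x)) has_derivative
    (\<lambda>v. frechet_derivative (\<lambda>x. L x (h x0)) (at x0) v + L x0 (h' v))) (at x0)"
proof -
  have D: "((\<lambda>x. L x w) has_derivative frechet_derivative (\<lambda>x. L x w) (at x0)) (at x0)" for w
    using diff frechet_derivative_works by blast
  have main: "((\<lambda>x. L x (k x)) has_derivative
    (\<lambda>v. \<Sum>b\<in>Basis. (k x0 \<bullet> b) *\<^sub>R frechet_derivative (\<lambda>x. L x b) (at x0) v + (k' v \<bullet> b) *\<^sub>R L x0 b)) (at x0)"
    if k: "(k has_derivative k') (at x0)" for k k'
    by (rule has_derivative_transform_within_open[of "\<lambda>x. \<Sum>b\<in>Basis. (k x \<bullet> b) *\<^sub>R L x b" _ _ _ S])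
       (auto intro!: derivative_eq_intros k D assms(2) linear_Basis_sum[OF assms(3), symmetric] simp: assms(1))
  \<comment> \<open>Freezing the argument at \<open>h x0\<close> and applying \<open>main\<close> to
    a constant function identifies the first group of terms.\<close>
  have "frechet_derivative (\<lambda>x. L x (h x0)) (at x0) v =
      (\<Sum>b\<in>Basis. (h x0 \<bullet> b) *\<^sub>R frechet_derivative (\<lambda>x. L x b) (at x0) v)" for v
    using main[OF has_derivative_const, of "h x0"] by (simp add: frechet_derivative_eq)
  moreover have "L x0 (h' v) = (\<Sum>b\<in>Basis. (h' v \<bullet> b) *\<^sub>R L x0 b)" for v
    by (rule linear_Basis_sum[OF assms(3)[OF assms(2)]])
  ultimately show ?thesis
    using main[OF h] by (simp add: sum.distrib)
qed

lemma has_derivative_apply_bilinear: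
  fixes h :: "'a::real_normed_vector \<Rightarrow> 'b::euclidean_space"
    and k :: "'a \<Rightarrow> 'c::euclidean_space"
  assumes "open S" "x0 \<in> S" "\<And>x. x \<in> S \<Longrightarrow> bilinear (B x)"
    and diff: "\<And>w z. (\<lambda>x. B x w z) differentiable (at x0)"
    and h: "(h has_derivative h') (at x0)" and k: "(k has_derivative k') (at x0)"
  shows "((\<lambda>x. B x (h x) (k x)) has_derivative
    (\<lambda>v. frechet_derivative (\<lambda>x. B x (h x0) (k x0)) (at x0) v + B x0 (h' v) (k x0) + B x0 (h x0) (k' v)))
    (at x0)"
proof -
  have 1: "((\<lambda>x. B x w (k x)) has_derivative
    (\<lambda>v. frechet_derivative (\<lambda>x. B x w (k x0)) (at x0) v + B x0 w (k' v))) (at x0)" for w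
    by (rule has_derivative_apply_linear[OF assms(1,2)]) (use assms in \<open>auto simp: bilinear_def\<close>)
  have "((\<lambda>x. B x (h x) (k x)) has_derivative
    (\<lambda>v. frechet_derivative (\<lambda>x. B x (h x0) (k x)) (at x0) v + B x0 (h' v) (k x0))) (at x0)"
    by (rule has_derivative_apply_linear[OF assms(1,2), of "\<lambda>x v. B x v (k x)"])
       (use assms(3) h differentiableI[OF 1] in \<open>auto simp: bilinear_def\<close>)
  then show ?thesis
    using 1[of "h x0"] by (simp add: frechet_derivative_eq algebra_simps)
qed


lemma linear_frechet_param:
  assumes "open S" "u \<in> S" and lin: "\<And>u. u \<in> S \<Longrightarrow> linear (L u)"
    and diff: "\<And>x. (\<lambda>u. L u x) differentiable (at u)"
  shows "linear (\<lambda>x. frechet_derivative (\<lambda>u. L u x) (at u) z)"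
proof -
  have D: "((\<lambda>u. L u x) has_derivative frechet_derivative (\<lambda>u. L u x) (at u)) (at u)" for x
    using diff frechet_derivative_works by blast
  have add: "((\<lambda>u. L u (x + y)) has_derivative
      (\<lambda>z. frechet_derivative (\<lambda>u. L u x) (at u) z + frechet_derivative (\<lambda>u. L u y) (at u) z)) (at u)" for x y
    by (rule has_derivative_transform_within_open[OF has_derivative_add[OF D D] assms(1,2)])
       (simp add: linear_add[OF lin])
  have scale: "((\<lambda>u. L u (r *\<^sub>R x)) has_derivative
      (\<lambda>z. r *\<^sub>R frechet_derivative (\<lambda>u. L u x) (at u) z)) (at u)" for r x
    by (rule has_derivative_transform_within_open[OF has_derivative_scaleR_right[OF D] assms(1,2)])
       (simp add: linear_scale[OF lin])
  show ?thesis
    by (intro linearI) (simp_all add: frechet_derivative_eq[OF add] frechet_derivative_eq[OF scale])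
qed

lemma bilinear_frechet_param:
  assumes "open S" "u \<in> S" and "\<And>u. u \<in> S \<Longrightarrow> bilinear (B u)"
    and "\<And>x y. (\<lambda>u. B u x y) differentiable (at u)"
  shows "bilinear (\<lambda>x y. frechet_derivative (\<lambda>u. B u x y) (at u) z)"
  unfolding bilinear_def
  by (intro conjI allI linear_frechet_param[OF assms(1,2)]) (use assms(3,4) in \<open>auto simp: bilinear_def\<close>)

section \<open>Flat functions and smooth cutoffs\<close>

text \<open>All derivatives are supplied at once as a sequence, so one induction on the order of
  differentiability suffices.\<close>

lemma smooth_on_real:
  fixes f :: "nat \<Rightarrow> real \<Rightarrow> real"
  assumes "\<And>k x. (f k has_real_derivative f (Suc k) x) (at x)"
  shows "smooth_on UNIV (f k)"
proof -
  have D: "(f k has_derivative (\<lambda>v. v * f (Suc k) x)) (at x)" for k x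
    using assms[of k x] by (simp add: has_field_derivative_def mult_commute_abs)
  have "ck_on m UNIV (f k)" for m
  proof (induction m arbitrary: k)
    case 0
    then show ?case
      using assms by (auto intro!: continuous_at_imp_continuous_on DERIV_isCont)
  next
    case (Suc m)
    then show ?case
      using D by (auto simp: frechet_derivative_eq[OF D] differentiable_def
          intro!: ck_on_linear[OF bounded_linear_mult_right])
  qed
  then show ?thesis by (simp add: smooth_on_def)
qed

text \<open>The polynomial parameter makes the family closed under differentiation;
  \<open>p = 1\<close> is the classical function \<open>exp (- 1 / t)\<close> extended by
  zero.\<close>

definition flat_fun :: "real poly \<Rightarrow> real \<Rightarrow> real"
  where "flat_fun p t = (if t > 0 then poly p (1 / t) * exp (- 1 / t) else 0)"

text \<open>The extra power makes the induction over the coefficients go through, as the recursion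
  of \<open>poly\<close> multiplies by the variable.\<close>

lemma poly_div_exp_tendsto_0: "((\<lambda>s. s ^ k * poly p s / exp s) \<longlongrightarrow> (0::real)) at_top"
proof (induction p arbitrary: k)
  case 0
  then show ?case by simp
next
  case (pCons a p)
  have "((\<lambda>s. a * (s ^ k / exp s) + s ^ Suc k * poly p s / exp s) \<longlongrightarrow> a * 0 + 0) at_top"
    by (intro tendsto_intros tendsto_power_div_exp_0 pCons.IH)
  then show ?case by (simp add: algebra_simps add_divide_distrib)
qed

lemma flat_fun_tendsto_0: "(flat_fun p \<longlongrightarrow> 0) (at 0)"
proof -
  have "((\<lambda>t. poly p (inverse t) / exp (inverse t)) \<longlongrightarrow> 0) (at_right (0::real))"
    using filterlim_compose[OF poly_div_exp_tendsto_0[of 0 p] filterlim_inverse_at_top_right] by simp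
  moreover have "\<forall>\<^sub>F t in at_right 0. poly p (inverse t) / exp (inverse t) = flat_fun p t"
    by (auto simp: eventually_at_filter flat_fun_def exp_minus divide_inverse intro!: always_eventually)
  ultimately have "(flat_fun p \<longlongrightarrow> 0) (at_right 0)"
    using tendsto_cong by fastforce
  moreover have "(flat_fun p \<longlongrightarrow> 0) (at_left 0)"
    by (rule tendsto_eventually) (auto simp: eventually_at_filter flat_fun_def)
  ultimately show ?thesis
    by (simp add: filterlim_at_split)
qed

text \<open>For positive \<open>t\<close> the chain rule brings out a factor \<open>1 / t^2\<close>,
  which is the polynomial \<open>[:0, 0, 1:]\<close> in \<open>1 / t\<close>, times
  \<open>p - pderiv p\<close>: the exponential contributes \<open>p\<close>, the polynomial its
  derivative with a minus sign.\<close>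

lemma flat_fun_has_derivative:
  "(flat_fun p has_real_derivative flat_fun ([:0, 0, 1:] * (p - pderiv p)) t) (at t)"
proof -
  consider "t > 0" | "t < 0" | "t = 0" by linarith
  then show ?thesis
  proof cases
    case 1
    have "((\<lambda>t. poly p (1 / t) * exp (- 1 / t)) has_real_derivative
        poly ([:0, 0, 1:] * (p - pderiv p)) (1 / t) * exp (- 1 / t)) (at t)"
      using 1 by (auto intro!: derivative_eq_intros DERIV_chain2[OF poly_DERIV]
          simp: field_simps power2_eq_square)
    then have "(flat_fun p has_real_derivative poly ([:0, 0, 1:] * (p - pderiv p)) (1 / t) * exp (- 1 / t)) (at t)"
      by (rule has_field_derivative_transform_within_open[of _ _ _ "{0<..}"])
         (use 1 in \<open>auto simp: flat_fun_def\<close>)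
    then show ?thesis using 1 by (simp add: flat_fun_def)
  next
    case 2
    have "(flat_fun p has_real_derivative 0) (at t)"
      by (rule has_field_derivative_transform_within_open[of "\<lambda>_. 0" _ _ "{..<0}"])
         (use 2 in \<open>auto simp: flat_fun_def\<close>)
    then show ?thesis using 2 by (simp add: flat_fun_def)
  next
    case 3
    \<comment> \<open>Dividing by \<open>h\<close> multiplies the polynomial in \<open>1 / h\<close>
      by its variable, so the difference quotient at zero belongs to the family again and tends to
      zero.\<close>
    have "(\<lambda>h. (flat_fun p (0 + h) - flat_fun p 0) / h) = flat_fun (pCons 0 p)"
      by (auto simp: flat_fun_def fun_eq_iff)
    then show ?thesis
      using flat_fun_tendsto_0[of "pCons 0 p"] 3 by (simp add: DERIV_def) (simp add: flat_fun_def)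
  qed
qed

lemma smooth_on_flat_fun: "smooth_on UNIV (flat_fun p)"
proof -
  define q where "q k = ((\<lambda>p. [:0, 0, 1:] * (p - pderiv p)) ^^ k) p" for k
  have "smooth_on UNIV (flat_fun (q 0))"
    by (rule smooth_on_real[of "\<lambda>k. flat_fun (q k)"])
       (use flat_fun_has_derivative[of "q _"] in \<open>simp add: q_def\<close>)
  then show ?thesis by (simp add: q_def)
qed

text \<open>With the flat function \<open>f\<close> the cutoff is \<open>f (1 - M f (t)) / f (1)\<close>, which is \<open>1\<close> for
  \<open>t \<le> 0\<close> and vanishes as soon as \<open>M f (t) \<ge> 1\<close>; this needs no division by a function.\<close>

lemma smooth_bump:
  fixes x0 :: "'a::euclidean_space"
  assumes "0 < r" "r < R"
  obtains \<beta> :: "'a \<Rightarrow> real" where "smooth_on UNIV \<beta>" "\<And>x. dist x0 x \<le> r \<Longrightarrow> \<beta> x = 1"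
    "\<And>x. dist x0 x \<ge> R \<Longrightarrow> \<beta> x = 0"
proof -
  define f where "f = flat_fun 1"
  have f: "f t = (if t > 0 then exp (- 1 / t) else 0)" for t
    by (simp add: f_def flat_fun_def)
  have sf: "smooth_on UNIV f"
    by (simp add: f_def smooth_on_flat_fun)
  \<comment> \<open>A polynomial in \<open>x\<close>, hence smooth where the distance itself is not;
    it is nonpositive exactly on the inner ball.\<close>
  define s where "s x = (x - x0) \<bullet> (x - x0) - r\<^sup>2" for x
  \<comment> \<open>This constant makes \<open>M * f (s x)\<close> equal to 1 on the sphere of
    radius \<open>R\<close>, and at least 1 beyond it because \<open>f\<close> increases.\<close>
  define M where "M = 1 / f (R\<^sup>2 - r\<^sup>2)"
  define \<beta> where "\<beta> x = f (1 - M * f (s x)) * (1 / f 1)" for x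
  have pos: "R\<^sup>2 - r\<^sup>2 > 0"
    using assms by (simp add: power_strict_mono)
  have s: "s x = (dist x0 x)\<^sup>2 - r\<^sup>2" for x
    by (simp add: s_def dist_norm power2_norm_eq_inner inner_diff_left inner_diff_right inner_commute)
  have "smooth_on UNIV s"
    unfolding s_def by (intro smooth_on_diff smooth_on_inner smooth_on_ident smooth_on_const open_UNIV)
  then have "smooth_on UNIV (\<lambda>x. f (s x))"
    by (intro smooth_on_compose[OF _ _ _ sf]) auto
  then have "smooth_on UNIV (\<lambda>x. 1 - M * f (s x))"
    by (intro smooth_on_diff smooth_on_mult smooth_on_const open_UNIV)
  then have "smooth_on UNIV (\<lambda>x. f (1 - M * f (s x)))"
    by (intro smooth_on_compose[OF _ _ _ sf]) auto
  then have "smooth_on UNIV \<beta>"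
    unfolding \<beta>_def by (intro smooth_on_mult smooth_on_const open_UNIV)
  moreover have "\<beta> x = 1" if "dist x0 x \<le> r" for x
  proof -
    have "s x \<le> 0" using that assms by (simp add: s power_mono)
    then show ?thesis by (simp add: \<beta>_def f)
  qed
  moreover have "\<beta> x = 0" if "dist x0 x \<ge> R" for x
  proof -
    have "s x \<ge> R\<^sup>2 - r\<^sup>2"
      using that assms by (simp add: s power_mono)
    then have "f (s x) \<ge> f (R\<^sup>2 - r\<^sup>2)" using pos by (simp add: f frac_le)
    moreover have "f (R\<^sup>2 - r\<^sup>2) > 0" using pos by (simp add: f)
    ultimately have "M * f (s x) \<ge> 1" by (simp add: M_def)
    then show ?thesis by (simp add: \<beta>_def f)
  qed
  ultimately show ?thesis by (rule that)
qed

section \<open>Symmetry of second derivatives\<close>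

text \<open>The mean value theorem is applied twice, once along \<open>v\<close> to the difference
  of \<open>f\<close> and its translate by \<open>h *\<^sub>R w\<close>, then along \<open>w\<close>
  to the derivative; the hypothesis keeps the whole parallelogram inside \<open>S\<close>.\<close>

lemma second_difference_mean_value:
  fixes f :: "'a::real_normed_vector \<Rightarrow> real"
  assumes h: "h > 0" and f: "\<And>s t. 0 \<le> s \<Longrightarrow> s \<le> h \<Longrightarrow> 0 \<le> t \<Longrightarrow> t \<le> h \<Longrightarrow> x + s *\<^sub>R v + t *\<^sub>R w \<in> S"
    and "smooth_on S f"
  shows "\<exists>s t. 0 < s \<and> s < h \<and> 0 < t \<and> t < h \<and>
    f (x + h *\<^sub>R v + h *\<^sub>R w) - f (x + h *\<^sub>R v) - f (x + h *\<^sub>R w) + f x =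
    h * h * frechet_derivative (\<lambda>y. frechet_derivative f (at y) v) (at (x + s *\<^sub>R v + t *\<^sub>R w)) w"
proof -
  have D: "((\<lambda>s. k (y + s *\<^sub>R z)) has_real_derivative frechet_derivative k (at (y + s *\<^sub>R z)) z) (at s)"
    if "smooth_on S k" "y + s *\<^sub>R z \<in> S" for y z s and k :: "'a \<Rightarrow> real"
  proof -
    have k: "(k has_derivative frechet_derivative k (at (y + s *\<^sub>R z))) (at (y + s *\<^sub>R z))"
      using that by (rule smooth_on_has_derivative)
    have "((\<lambda>s. k (y + s *\<^sub>R z)) has_derivative (\<lambda>t. frechet_derivative k (at (y + s *\<^sub>R z)) (t *\<^sub>R z))) (at s)"
      by (rule has_derivative_compose[of "\<lambda>s. y + s *\<^sub>R z" _ _ _ k, OF _ k])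
         (auto intro!: derivative_eq_intros)
    then show ?thesis
      using linear_scale[OF has_derivative_linear[OF k]]
      by (simp add: has_field_derivative_def mult_commute_abs)
  qed
  define d where "d y = frechet_derivative f (at y) v" for y
  have sd: "smooth_on S d"
    unfolding d_def using assms(3) by (rule smooth_on_frechet)
  have "\<exists>s. 0 < s \<and> s < h \<and>
    (f (x + h *\<^sub>R w + h *\<^sub>R v) - f (x + h *\<^sub>R v)) - (f (x + h *\<^sub>R w + 0 *\<^sub>R v) - f (x + 0 *\<^sub>R v)) =
     (h - 0) * (d (x + h *\<^sub>R w + s *\<^sub>R v) - d (x + s *\<^sub>R v))"
    unfolding d_def using f[of _ h] f[of _ 0] h
    by (intro MVT2[of 0 h "\<lambda>s. f (x + h *\<^sub>R w + s *\<^sub>R v) - f (x + s *\<^sub>R v)"] DERIV_diff D assms(3))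
       (auto simp: algebra_simps)
  then obtain s where s: "0 < s" "s < h" and
    eq: "f (x + h *\<^sub>R w + h *\<^sub>R v) - f (x + h *\<^sub>R v) - (f (x + h *\<^sub>R w) - f x) =
      h * (d (x + h *\<^sub>R w + s *\<^sub>R v) - d (x + s *\<^sub>R v))"
    by auto
  have "\<exists>t. 0 < t \<and> t < h \<and> d (x + s *\<^sub>R v + h *\<^sub>R w) - d (x + s *\<^sub>R v + 0 *\<^sub>R w) =
     (h - 0) * frechet_derivative d (at (x + s *\<^sub>R v + t *\<^sub>R w)) w"
    using f[of s] h s by (intro MVT2 D sd) auto
  then obtain t where t: "0 < t" "t < h" and
    eq': "d (x + s *\<^sub>R v + h *\<^sub>R w) - d (x + s *\<^sub>R v) = h * frechet_derivative d (at (x + s *\<^sub>R v + t *\<^sub>R w)) w"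
    by auto
  have "f (x + h *\<^sub>R v + h *\<^sub>R w) - f (x + h *\<^sub>R v) - f (x + h *\<^sub>R w) + f x =
      h * (d (x + s *\<^sub>R v + h *\<^sub>R w) - d (x + s *\<^sub>R v))"
    using eq by (simp add: algebra_simps)
  then have "f (x + h *\<^sub>R v + h *\<^sub>R w) - f (x + h *\<^sub>R v) - f (x + h *\<^sub>R w) + f x =
      h * h * frechet_derivative d (at (x + s *\<^sub>R v + t *\<^sub>R w)) w"
    by (simp add: eq')
  then show ?thesis
    using s t unfolding d_def by blast
qed

text \<open>The second difference is symmetric in \<open>v\<close> and \<open>w\<close>, so the two
  mixed derivatives agree at two nearby intermediate points; continuity carries this to
  \<open>x\<close> as the parallelogram shrinks.\<close>

lemma second_derivative_symmetric_real:
  fixes f :: "'a::real_normed_vector \<Rightarrow> real"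
  assumes "open S" "x \<in> S" "smooth_on S f"
  shows "frechet_derivative (\<lambda>y. frechet_derivative f (at y) v) (at x) w =
    frechet_derivative (\<lambda>y. frechet_derivative f (at y) w) (at x) v"
proof -
  define D where "D v w y = frechet_derivative (\<lambda>y. frechet_derivative f (at y) v) (at y) w" for v w y
  have cont: "isCont (D v w) x" for v w
    unfolding D_def using assms
    by (metis continuous_on_eq_continuous_at smooth_on_continuous smooth_on_frechet)
  obtain e where e: "e > 0" "ball x e \<subseteq> S"
    using assms openE by blast
  have "dist (D v w x) (D w v x) \<le> \<epsilon>" if "\<epsilon> > 0" for \<epsilon>
  proof -
    from cont[of v w] that obtain d1 where d1: "d1 > 0" "\<And>y. dist y x < d1 \<Longrightarrow> dist (D v w y) (D v w x) < \<epsilon>/2"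
      unfolding continuous_at_eps_delta by (meson half_gt_zero)
    from cont[of w v] that obtain d2 where d2: "d2 > 0" "\<And>y. dist y x < d2 \<Longrightarrow> dist (D w v y) (D w v x) < \<epsilon>/2"
      unfolding continuous_at_eps_delta by (meson half_gt_zero)
    define K where "K = norm v + norm w + 1"
    have K: "K > 0" unfolding K_def by (simp add: add_nonneg_pos)
    \<comment> \<open>With this side length every point of the parallelogram is closer to
      \<open>x\<close> than \<open>2 * (h * K) = min e (min d1 d2)\<close>, so the points lie in
      \<open>S\<close> and both continuity estimates apply.\<close>
    define h where "h = min e (min d1 d2) / (2 * K)"
    have h: "h > 0" using e d1 d2 K by (simp add: h_def)
    have near: "dist (x + s *\<^sub>R v + t *\<^sub>R w) x < min e (min d1 d2)"
      if "0 \<le> s" "s \<le> h" "0 \<le> t" "t \<le> h" for s t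
    proof -
      have "dist (x + s *\<^sub>R v + t *\<^sub>R w) x \<le> s * norm v + t * norm w"
        using that norm_triangle_ineq[of "s *\<^sub>R v" "t *\<^sub>R w"] by (simp add: dist_norm add.assoc)
      also have "\<dots> \<le> h * norm v + h * norm w"
        using that by (intro add_mono mult_right_mono) auto
      also have "\<dots> < 2 * (h * K)"
        using h by (simp add: K_def algebra_simps) (smt (verit) mult_nonneg_nonneg norm_ge_zero)
      also have "\<dots> = min e (min d1 d2)" using K by (simp add: h_def)
      finally show ?thesis .
    qed
    have S: "x + s *\<^sub>R v + t *\<^sub>R w \<in> S" if "0 \<le> s" "s \<le> h" "0 \<le> t" "t \<le> h" for s t
      using near[OF that] e(2) by (auto simp: dist_commute)
    then have S': "x + s *\<^sub>R w + t *\<^sub>R v \<in> S" if "0 \<le> s" "s \<le> h" "0 \<le> t" "t \<le> h" for s t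
      using that S[of t s] by (simp add: algebra_simps)
    obtain s t where st: "0 < s" "s < h" "0 < t" "t < h"
      "f (x + h *\<^sub>R v + h *\<^sub>R w) - f (x + h *\<^sub>R v) - f (x + h *\<^sub>R w) + f x = h * h * D v w (x + s *\<^sub>R v + t *\<^sub>R w)"
      using second_difference_mean_value[OF h S assms(3)] unfolding D_def by blast
    obtain s' t' where st': "0 < s'" "s' < h" "0 < t'" "t' < h"
      "f (x + h *\<^sub>R w + h *\<^sub>R v) - f (x + h *\<^sub>R w) - f (x + h *\<^sub>R v) + f x = h * h * D w v (x + s' *\<^sub>R w + t' *\<^sub>R v)"
      using second_difference_mean_value[OF h S' assms(3)] unfolding D_def by blast
    have sw: "x + s' *\<^sub>R w + t' *\<^sub>R v = x + t' *\<^sub>R v + s' *\<^sub>R w" "x + h *\<^sub>R w + h *\<^sub>R v = x + h *\<^sub>R v + h *\<^sub>R w"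
      by simp_all
    have "h * h * D v w (x + s *\<^sub>R v + t *\<^sub>R w) = h * h * D w v (x + t' *\<^sub>R v + s' *\<^sub>R w)"
      using st(5) st'(5) unfolding sw by linarith
    then have "D v w (x + s *\<^sub>R v + t *\<^sub>R w) = D w v (x + t' *\<^sub>R v + s' *\<^sub>R w)"
      using h by simp
    moreover have "dist (D v w (x + s *\<^sub>R v + t *\<^sub>R w)) (D v w x) < \<epsilon>/2"
      using near[of s t] st by (intro d1) auto
    moreover have "dist (D w v (x + t' *\<^sub>R v + s' *\<^sub>R w)) (D w v x) < \<epsilon>/2"
      using near[of t' s'] st' by (intro d2) auto
    ultimately show ?thesis
      unfolding dist_real_def by linarith
  qed
  then have "dist (D v w x) (D w v x) \<le> 0"
    by (rule field_le_epsilon) (simp add: dist_nz)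
  then show ?thesis by (simp add: D_def)
qed

lemma second_derivative_symmetric:
  fixes f :: "'a::real_normed_vector \<Rightarrow> 'b::euclidean_space"
  assumes "open S" "x \<in> S" "smooth_on S f"
  shows "frechet_derivative (\<lambda>y. frechet_derivative f (at y) v) (at x) w =
    frechet_derivative (\<lambda>y. frechet_derivative f (at y) w) (at x) v"
proof (rule euclidean_eqI)
  fix b :: 'b
  have sb: "smooth_on S (\<lambda>y. f y \<bullet> b)"
    by (intro smooth_on_inner assms smooth_on_const)
  have 1: "frechet_derivative (\<lambda>y. f y \<bullet> b) (at y) = (\<lambda>v. frechet_derivative f (at y) v \<bullet> b)" if "y \<in> S" for y
    by (rule frechet_derivative_eq)
       (use smooth_on_has_derivative[OF assms(3) that] in \<open>auto intro!: derivative_eq_intros\<close>)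
  have 2: "frechet_derivative (\<lambda>y. frechet_derivative f (at y) v) (at x) w \<bullet> b =
     frechet_derivative (\<lambda>y. frechet_derivative (\<lambda>y. f y \<bullet> b) (at y) v) (at x) w" for v w
  proof -
    have "((\<lambda>y. frechet_derivative f (at y) v \<bullet> b) has_derivative
        (\<lambda>w. frechet_derivative (\<lambda>y. frechet_derivative f (at y) v) (at x) w \<bullet> b)) (at x)"
      using smooth_on_has_derivative[OF smooth_on_frechet[OF assms(3), of v] assms(2)]
      by (auto intro!: derivative_eq_intros)
    then have "((\<lambda>y. frechet_derivative (\<lambda>y. f y \<bullet> b) (at y) v) has_derivative
        (\<lambda>w. frechet_derivative (\<lambda>y. frechet_derivative f (at y) v) (at x) w \<bullet> b)) (at x)"
      by (rule has_derivative_transform_within_open) (use assms 1 in auto)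
    then show ?thesis by (simp add: frechet_derivative_eq)
  qed
  show "frechet_derivative (\<lambda>y. frechet_derivative f (at y) v) (at x) w \<bullet> b =
    frechet_derivative (\<lambda>y. frechet_derivative f (at y) w) (at x) v \<bullet> b"
    unfolding 2 by (rule second_derivative_symmetric_real[OF assms(1,2) sb])
qed

section \<open>Nondegenerate bilinear forms\<close>

text \<open>Written against the inner product, the form becomes an injective linear endomorphism,
  hence a surjective one by finite dimension. This serves to evaluate the definite descriptions in
  \<open>christoffel\<close> and \<open>sharp\<close> of a local metric.\<close>

lemma nondegenerate_representation:
  fixes b :: "'v::euclidean_space \<Rightarrow> 'v \<Rightarrow> real"
  assumes "bilinear b" "\<And>x. (\<And>w. b x w = 0) \<Longrightarrow> x = 0" "linear l"
  shows "\<exists>!z. \<forall>w. b z w = l w"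
proof -
  define f where "f z = (\<Sum>e\<in>Basis. b z e *\<^sub>R e)" for z
  have f: "f z \<bullet> w = b z w" for z w
  proof -
    have "f z \<bullet> w = (\<Sum>e\<in>Basis. (w \<bullet> e) *\<^sub>R b z e)"
      by (simp add: f_def inner_sum_left inner_commute[of w] mult.commute)
    also have "\<dots> = b z w"
      by (rule linear_Basis_sum[symmetric]) (use assms in \<open>simp add: bilinear_def\<close>)
    finally show ?thesis .
  qed
  have l: "(\<Sum>e\<in>Basis. l e *\<^sub>R e) \<bullet> w = l w" for w
    using linear_Basis_sum[OF assms(3), of w]
    by (simp add: inner_sum_left inner_commute[of w] mult.commute)
  have "linear f"
    unfolding f_def using assms(1)
    by (auto simp: bilinear_ladd bilinear_lmul sum.distrib scaleR_sum_right
        scaleR_add_left intro!: linearI)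
  moreover have "inj f"
    unfolding linear_injective_0[OF \<open>linear f\<close>]
    by (metis assms(2) f inner_zero_left)
  ultimately have "surj f" by (rule linear_inj_imp_surj)
  then obtain z where z: "f z = (\<Sum>e\<in>Basis. l e *\<^sub>R e)"
    by (metis surjD)
  show ?thesis
  proof
    show "\<forall>w. b z w = l w" using f l z by metis
    fix y assume "\<forall>w. b y w = l w"
    then have "f y = f z" by (intro vector_eq_rdot[THEN iffD1]) (metis f l z inner_commute)
    then show "y = z" using \<open>inj f\<close> by (simp add: injD)
  qed
qed

section \<open>Charts and tangent vectors\<close>

definition overlap :: "('a, 'v) chart \<Rightarrow> ('a, 'v) chart \<Rightarrow> 'v set"
  where "overlap c d = snd c ` (fst c \<inter> fst d)"

text \<open>Leaves out separation and countability, so that charts, Jacobians and the topology can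
  be used on the cotangent bundle while those two properties are still being proved there.\<close>

locale atlas =
  fixes A :: "('a, 'v::euclidean_space) chart set"
  assumes inj_chart: "c \<in> A \<Longrightarrow> inj_on (snd c) (fst c)"
    and open_chart_img: "c \<in> A \<Longrightarrow> open (chart_img c)"
    and open_overlap: "c \<in> A \<Longrightarrow> d \<in> A \<Longrightarrow> open (overlap c d)"
    and smooth_transition: "c \<in> A \<Longrightarrow> d \<in> A \<Longrightarrow> smooth_on (overlap c d) (transition c d)"

text \<open>Smoothness of the germ at \<open>p\<close>, tested in one chart of choice; it lets a
  function be examined in whichever chart suits each point.\<close>

definition smooth_at ::
    "('a, 'v::euclidean_space) chart set \<Rightarrow> ('a \<Rightarrow> 'b::real_normed_vector) \<Rightarrow> 'a \<Rightarrow> bool"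
  where "smooth_at A f p \<longleftrightarrow> (\<exists>c\<in>charts_at A p. \<exists>U. open U \<and> snd c p \<in> U \<and> U \<subseteq> chart_img c \<and>
    smooth_on U (\<lambda>u. f (chart_inv c u)))"

lemma charts_at_iff: "c \<in> charts_at A p \<longleftrightarrow> c \<in> A \<and> p \<in> fst c"
  by (simp add: charts_at_def)

context atlas
begin

lemma chart_inv_mem [simp]: "u \<in> chart_img c \<Longrightarrow> chart_inv c u \<in> fst c"
  and snd_chart_inv [simp]: "u \<in> chart_img c \<Longrightarrow> snd c (chart_inv c u) = u"
  by (auto simp: chart_img_def chart_inv_def inv_into_into f_inv_into_f)

lemma chart_inv_snd [simp]: "c \<in> A \<Longrightarrow> p \<in> fst c \<Longrightarrow> chart_inv c (snd c p) = p"
  by (simp add: chart_inv_def inj_chart)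

lemma snd_chart_img [simp]: "p \<in> fst c \<Longrightarrow> snd c p \<in> chart_img c"
  by (simp add: chart_img_def)

lemma charts_at_chart_inv [simp]: "c \<in> A \<Longrightarrow> u \<in> chart_img c \<Longrightarrow> c \<in> charts_at A (chart_inv c u)"
  by (simp add: charts_at_iff)

lemma points_iff: "p \<in> points A \<longleftrightarrow> (\<exists>c. c \<in> charts_at A p)"
  unfolding points_def charts_at_iff by blast

lemma chart_inv_points [simp]: "c \<in> A \<Longrightarrow> u \<in> chart_img c \<Longrightarrow> chart_inv c u \<in> points A"
  using charts_at_chart_inv points_iff by blast

lemma chart_at: "p \<in> points A \<Longrightarrow> chart_at A p \<in> charts_at A p"
  by (auto simp: points_iff chart_at_def intro: someI)

lemma overlap_iff: "c \<in> A \<Longrightarrow> u \<in> overlap c d \<longleftrightarrow> u \<in> chart_img c \<and> chart_inv c u \<in> fst d"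
  by (auto simp: overlap_def chart_img_def chart_inv_def inj_chart)

lemma snd_overlap: "c \<in> charts_at A p \<Longrightarrow> d \<in> charts_at A p \<Longrightarrow> snd c p \<in> overlap c d"
  by (auto simp: overlap_def charts_at_iff)

lemma overlap_subset: "overlap c d \<subseteq> chart_img c"
  by (auto simp: overlap_def chart_img_def)

lemma transition_mem:
  assumes "c \<in> A" "d \<in> A" "u \<in> overlap c d"
  shows "transition c d u \<in> overlap d c" "chart_inv d (transition c d u) = chart_inv c u"
    "transition d c (transition c d u) = u"
  using assms by (auto simp: transition_def overlap_iff)

lemma transition_snd: "c \<in> A \<Longrightarrow> p \<in> fst c \<Longrightarrow> transition c d (snd c p) = snd d p"
  by (simp add: transition_def)

lemma transition_has_derivative:
  assumes "c \<in> charts_at A p" "d \<in> charts_at A p"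
  shows "(transition c d has_derivative jacobian c d p) (at (snd c p))"
  unfolding jacobian_def
  using assms smooth_transition[of c d] snd_overlap[OF assms]
  by (auto simp: charts_at_iff intro: smooth_on_has_derivative)

lemma linear_jacobian:
  "c \<in> charts_at A p \<Longrightarrow> d \<in> charts_at A p \<Longrightarrow> linear (jacobian c d p)"
  using transition_has_derivative has_derivative_linear by blast

lemma jacobian_self [simp]:
  assumes "c \<in> charts_at A p"
  shows "jacobian c c p = (\<lambda>w. w)"
proof -
  have "(transition c c has_derivative (\<lambda>w. w)) (at (snd c p))"
    by (rule has_derivative_transform_within_open[OF has_derivative_ident, of "chart_img c"])
       (use assms open_chart_img in \<open>auto simp: transition_def charts_at_iff\<close>)
  then show ?thesis
    using transition_has_derivative[OF assms assms] has_derivative_unique by blast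
qed

text \<open>Chain rule for the cocycle identity of the transition maps, which holds on an open set
  around the point and hence determines the derivative. It is what makes \<open>of_chart\<close>
  satisfy the transformation law of a tangent vector.\<close>

lemma jacobian_comp:
  assumes c: "c \<in> charts_at A p" and d: "d \<in> charts_at A p" and e: "e \<in> charts_at A p"
  shows "jacobian d e p (jacobian c d p w) = jacobian c e p w"
proof -
  have cA: "c \<in> A" "p \<in> fst c" "d \<in> A" "e \<in> A" using assms by (auto simp: charts_at_iff)
  have "((\<lambda>u. transition d e (transition c d u)) has_derivative (\<lambda>w. jacobian d e p (jacobian c d p w))) (at (snd c p))"
    using transition_has_derivative[OF d e] transition_snd[OF cA(1,2)]
    by (intro has_derivative_compose[OF transition_has_derivative[OF c d]]) simp
  then have "(transition c e has_derivative (\<lambda>w. jacobian d e p (jacobian c d p w))) (at (snd c p))"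
    by (rule has_derivative_transform_within_open[of _ _ _ _ "overlap c d"])
       (use cA open_overlap snd_overlap[OF c d] transition_mem in
         \<open>auto simp: transition_def[of d e] transition_def[of c e]\<close>)
  then show ?thesis
    using transition_has_derivative[OF c e] has_derivative_unique by metis
qed

lemma jacobian_inverse [simp]:
  "c \<in> charts_at A p \<Longrightarrow> d \<in> charts_at A p \<Longrightarrow> jacobian d c p (jacobian c d p w) = w"
  by (simp add: jacobian_comp)

lemma smooth_jacobian:
  assumes "c \<in> A" "d \<in> A"
  shows "smooth_on (overlap c d) (\<lambda>u. jacobian c d (chart_inv c u) w)"
  by (subst smooth_on_cong[OF open_overlap[OF assms], of _ "\<lambda>u. frechet_derivative (transition c d) (at u) w"])
     (use assms smooth_on_frechet[OF smooth_transition] in \<open>auto simp: jacobian_def overlap_iff\<close>)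

lemma of_chart_tangent: "c \<in> charts_at A p \<Longrightarrow> of_chart A c p w \<in> tangent_space A p"
  unfolding tangent_space_def by (simp add: of_chart_def jacobian_comp)

lemma of_chart_apply: "d \<in> charts_at A p \<Longrightarrow> of_chart A c p w d = jacobian c d p w"
  by (simp add: of_chart_def)

lemma of_chart_self [simp]: "c \<in> charts_at A p \<Longrightarrow> of_chart A c p w c = w"
  by (simp add: of_chart_def)

lemma tangent_apply:
  "v \<in> tangent_space A p \<Longrightarrow> c \<in> charts_at A p \<Longrightarrow> d \<in> charts_at A p \<Longrightarrow> v d = jacobian c d p (v c)"
  unfolding tangent_space_def by blast

lemma tangentI:
  "(\<And>c. c \<notin> charts_at A p \<Longrightarrow> v c = 0) \<Longrightarrow>
   (\<And>c d. c \<in> charts_at A p \<Longrightarrow> d \<in> charts_at A p \<Longrightarrow> v d = jacobian c d p (v c)) \<Longrightarrow>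
   v \<in> tangent_space A p"
  unfolding tangent_space_def by blast

lemma tangent_off: "v \<in> tangent_space A p \<Longrightarrow> c \<notin> charts_at A p \<Longrightarrow> v c = 0"
  unfolding tangent_space_def by blast

lemma of_chart_eq [simp]:
  assumes "v \<in> tangent_space A p" "c \<in> charts_at A p"
  shows "of_chart A c p (v c) = v"
proof
  fix d
  show "of_chart A c p (v c) d = v d"
    using tangent_apply[OF assms, of d] tangent_off[OF assms(1), of d] by (simp add: of_chart_def)
qed

lemma tangent_eqI:
  "v \<in> tangent_space A p \<Longrightarrow> w \<in> tangent_space A p \<Longrightarrow> c \<in> charts_at A p \<Longrightarrow> v c = w c \<Longrightarrow> v = w"
  by (metis of_chart_eq)

lemma of_chart_change:
  assumes "c \<in> charts_at A p" "d \<in> charts_at A p"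
  shows "of_chart A d p (jacobian c d p w) = of_chart A c p w"
  using of_chart_eq[OF of_chart_tangent[OF assms(1)] assms(2), of w] assms
  by (simp add: of_chart_apply)

lemma linear_of_chart: "c \<in> charts_at A p \<Longrightarrow> linear (of_chart A c p)"
  by (rule linearI) (auto simp: of_chart_def fun_eq_iff scaleR_fun_def linear_add[OF linear_jacobian]
      linear_scale[OF linear_jacobian])

lemma subspace_tangent: "subspace (tangent_space A p)"
proof (rule subspaceI)
  show "0 \<in> tangent_space A p"
    by (rule tangentI) (simp_all add: linear_0[OF linear_jacobian])
  fix v w r assume v: "v \<in> tangent_space A p" and w: "w \<in> tangent_space A p"
  show "v + w \<in> tangent_space A p"
  proof (rule tangentI)
    fix c d assume "c \<in> charts_at A p" "d \<in> charts_at A p"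
    then show "(v + w) d = jacobian c d p ((v + w) c)"
      using tangent_apply[OF v, of c d] tangent_apply[OF w, of c d] by (simp add: linear_add[OF linear_jacobian])
  qed (simp add: tangent_off[OF v] tangent_off[OF w])
  show "r *\<^sub>R v \<in> tangent_space A p"
  proof (rule tangentI)
    fix c d assume "c \<in> charts_at A p" "d \<in> charts_at A p"
    then show "(r *\<^sub>R v) d = jacobian c d p ((r *\<^sub>R v) c)"
      using tangent_apply[OF v, of c d] by (simp add: scaleR_fun_def linear_scale[OF linear_jacobian])
  qed (simp add: scaleR_fun_def tangent_off[OF v])
qed

lemma tangent_add: "v \<in> tangent_space A p \<Longrightarrow> w \<in> tangent_space A p \<Longrightarrow> v + w \<in> tangent_space A p"
  and tangent_scale: "v \<in> tangent_space A p \<Longrightarrow> r *\<^sub>R v \<in> tangent_space A p"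
  and tangent_zero: "0 \<in> tangent_space A p"
  using subspace_tangent[of p] by (auto intro: subspace_add subspace_scale subspace_0)

section \<open>Topology of an atlas\<close>

text \<open>Injectivity of the charts makes images commute with intersections. Stated for an
  \<open>atlas\<close> so that it can be applied to the cotangent bundle in the proof that this is a
  manifold.\<close>

lemma openin_atlas:
  "openin (manifold_topology A) S \<longleftrightarrow> S \<subseteq> points A \<and> (\<forall>c\<in>A. open (snd c ` (S \<inter> fst c)))"
proof -
  have "istopology (\<lambda>S. S \<subseteq> points A \<and> (\<forall>c\<in>A. open (snd c ` (S \<inter> fst c))))"
    unfolding istopology_def
  proof (intro conjI allI impI ballI; (elim conjE)?)
    fix S T c
    assume S: "\<forall>c\<in>A. open (snd c ` (S \<inter> fst c))" and T: "\<forall>c\<in>A. open (snd c ` (T \<inter> fst c))"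
      and c: "c \<in> A"
    have "snd c ` (S \<inter> T \<inter> fst c) = snd c ` (S \<inter> fst c) \<inter> snd c ` (T \<inter> fst c)"
      using inj_chart[OF c] by (auto simp: inj_on_def)
    then show "open (snd c ` (S \<inter> T \<inter> fst c))"
      using S T c by auto
  next
    fix \<K> c
    assume \<K>: "\<forall>K\<in>\<K>. K \<subseteq> points A \<and> (\<forall>c\<in>A. open (snd c ` (K \<inter> fst c)))" and c: "c \<in> A"
    have "snd c ` (\<Union>\<K> \<inter> fst c) = (\<Union>K\<in>\<K>. snd c ` (K \<inter> fst c))"
      by auto
    then show "open (snd c ` (\<Union>\<K> \<inter> fst c))"
      using \<K> c by auto
  qed auto
  then show ?thesis
    unfolding manifold_topology_def by (simp add: topology_inverse')
qed

lemma topspace_atlas [simp]: "topspace (manifold_topology A) = points A"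
proof (rule antisym)
  show "topspace (manifold_topology A) \<subseteq> points A"
    using openin_atlas openin_topspace by blast
  have "openin (manifold_topology A) (points A)"
    unfolding openin_atlas
  proof (intro conjI ballI subset_refl)
    fix c assume "c \<in> A"
    moreover from this have "points A \<inter> fst c = fst c" by (auto simp: points_def)
    ultimately show "open (snd c ` (points A \<inter> fst c))" using open_chart_img by (simp add: chart_img_def)
  qed
  then show "points A \<subseteq> topspace (manifold_topology A)"
    by (rule openin_subset)
qed

lemma open_transition_vimage:
  assumes "c \<in> A" "d \<in> A" "open U"
  shows "open (overlap c d \<inter> transition c d -` U)"
  using smooth_on_continuous[OF smooth_transition[OF assms(1,2)]] open_overlap[OF assms(1,2)] assms(3)
  by (simp add: continuous_on_open_vimage Int_commute)

text \<open>Read in another chart \<open>d\<close>, the image of \<open>U\<close> is its preimage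
  under the continuous transition from \<open>d\<close> to \<open>c\<close>.\<close>

lemma openin_chart:
  assumes "c \<in> A" "open U" "U \<subseteq> chart_img c"
  shows "openin (manifold_topology A) (chart_inv c ` U)"
  unfolding openin_atlas
proof (intro conjI ballI)
  show "chart_inv c ` U \<subseteq> points A" using assms by auto
  fix d assume d: "d \<in> A"
  have "snd d ` (chart_inv c ` U \<inter> fst d) = overlap d c \<inter> transition d c -` U"
  proof (rule set_eqI)
    fix w
    show "w \<in> snd d ` (chart_inv c ` U \<inter> fst d) \<longleftrightarrow> w \<in> overlap d c \<inter> transition d c -` U" (is "?l \<longleftrightarrow> ?r")
    proof
      assume ?l
      then obtain u where "u \<in> U" "chart_inv c u \<in> fst d" "w = snd d (chart_inv c u)" by auto
      then show ?r using assms d by (auto simp: overlap_iff transition_def)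
    next
      assume ?r
      then have *: "w \<in> overlap d c" "transition d c w \<in> U" by auto
      then have "chart_inv c (transition d c w) = chart_inv d w" "w \<in> chart_img d"
        using transition_mem[OF d assms(1)] overlap_subset[of d c] by auto
      then show ?l
        using * d by (metis IntI chart_inv_mem image_eqI snd_chart_inv)
    qed
  qed
  then show "open (snd d ` (chart_inv c ` U \<inter> fst d))"
    using open_transition_vimage[OF d assms(1,2)] by simp
qed

lemma openin_chart_domain: "c \<in> A \<Longrightarrow> openin (manifold_topology A) (fst c)"
  using openin_chart[of c "chart_img c"] open_chart_img
  by (auto simp: chart_img_def image_image)

lemma open_in_chart:
  assumes "openin (manifold_topology A) W" "c \<in> A"
  shows "open {u \<in> chart_img c. chart_inv c u \<in> W}"
proof -
  have "{u \<in> chart_img c. chart_inv c u \<in> W} = snd c ` (W \<inter> fst c)"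
    using assms(2) by (force simp: chart_img_def)
  then show ?thesis using assms by (simp add: openin_atlas)
qed

section \<open>Smoothness at a point\<close>

lemma smooth_atI:
  "c \<in> charts_at A p \<Longrightarrow> open U \<Longrightarrow> snd c p \<in> U \<Longrightarrow> U \<subseteq> chart_img c \<Longrightarrow>
    smooth_on U (\<lambda>u. f (chart_inv c u)) \<Longrightarrow> smooth_at A f p"
  unfolding smooth_at_def by blast

lemma smooth_at_of_chart:
  assumes "c \<in> charts_at A p" "smooth_on (chart_img c) (\<lambda>u. f (chart_inv c u))"
  shows "smooth_at A f p"
  using assms open_chart_img by (intro smooth_atI[of c p "chart_img c"]) (auto simp: charts_at_iff)

text \<open>Composing with the smooth transition map transports smoothness from the chart that
  witnesses it to any other chart, on the preimage of the given neighbourhood.\<close>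

lemma smooth_at_chart:
  assumes "smooth_at A f p" "d \<in> charts_at A p"
  obtains U where "open U" "snd d p \<in> U" "U \<subseteq> chart_img d" "smooth_on U (\<lambda>u. f (chart_inv d u))"
proof -
  from assms(1) obtain c U where c: "c \<in> charts_at A p" and U: "open U" "snd c p \<in> U" "U \<subseteq> chart_img c"
    "smooth_on U (\<lambda>u. f (chart_inv c u))"
    unfolding smooth_at_def by blast
  have A: "c \<in> A" "d \<in> A" "p \<in> fst c" "p \<in> fst d" using c assms(2) by (auto simp: charts_at_iff)
  let ?T = "overlap d c \<inter> transition d c -` U"
  have T: "open ?T" using open_transition_vimage A U by blast
  have "smooth_on ?T (\<lambda>u. f (chart_inv c (transition d c u)))"
    by (rule smooth_on_compose[OF T U(1) _ U(4) smooth_on_subset[OF smooth_transition[OF A(2,1)]]]) auto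
  then have "smooth_on ?T (\<lambda>u. f (chart_inv d u))"
    by (subst smooth_on_cong[OF T, of _ "\<lambda>u. f (chart_inv c (transition d c u))"])
       (use A transition_mem in auto)
  moreover have "snd d p \<in> ?T"
    using A U snd_overlap[OF assms(2) c] transition_snd by auto
  ultimately show ?thesis using T overlap_subset[of d c] by (intro that[of ?T]) auto
qed

lemma smooth_on_chart_iff:
  assumes "d \<in> A"
  shows "smooth_on (chart_img d) (\<lambda>u. f (chart_inv d u)) \<longleftrightarrow> (\<forall>p\<in>fst d. smooth_at A f p)"
proof
  assume "smooth_on (chart_img d) (\<lambda>u. f (chart_inv d u))"
  then show "\<forall>p\<in>fst d. smooth_at A f p"
    using smooth_at_of_chart[of d _ f] assms by (simp add: charts_at_iff)
next
  assume *: "\<forall>p\<in>fst d. smooth_at A f p"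
  show "smooth_on (chart_img d) (\<lambda>u. f (chart_inv d u))"
  proof (rule smooth_on_local)
    fix u assume u: "u \<in> chart_img d"
    then have "smooth_at A f (chart_inv d u)" "d \<in> charts_at A (chart_inv d u)"
      using * assms by auto
    then obtain U where "open U" "snd d (chart_inv d u) \<in> U" "smooth_on U (\<lambda>u. f (chart_inv d u))"
      by (rule smooth_at_chart)
    then show "\<exists>T. open T \<and> u \<in> T \<and> smooth_on T (\<lambda>u. f (chart_inv d u))"
      using u by auto
  qed
qed

lemma smooth_at_cong:
  assumes "openin (manifold_topology A) W" "p \<in> W" "\<And>q. q \<in> W \<Longrightarrow> f q = g q" "smooth_at A g p"
  shows "smooth_at A f p"
proof -
  have "p \<in> points A" using assms openin_atlas by blast
  then obtain c where c: "c \<in> charts_at A p" using points_iff by blast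
  obtain U where U: "open U" "snd c p \<in> U" "U \<subseteq> chart_img c" "smooth_on U (\<lambda>u. g (chart_inv c u))"
    by (rule smooth_at_chart[OF assms(4) c])
  let ?T = "U \<inter> {u \<in> chart_img c. chart_inv c u \<in> W}"
  have T: "open ?T" using open_Int[OF U(1) open_in_chart[OF assms(1)]] c by (simp add: charts_at_iff)
  have "smooth_on ?T (\<lambda>u. f (chart_inv c u))"
    by (subst smooth_on_cong[OF T, of _ "\<lambda>u. g (chart_inv c u)"])
       (use assms(3) smooth_on_subset[OF U(4)] in auto)
  then show ?thesis
    unfolding smooth_at_def using c U T assms(2)
    by (intro bexI[of _ c] exI[of _ ?T]) (auto simp: charts_at_iff)
qed

lemma smooth_at_const: "p \<in> points A \<Longrightarrow> smooth_at A (\<lambda>q. k) p"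
  using smooth_at_of_chart[OF _ smooth_on_const] points_iff by metis

lemma smooth_at_binary:
  assumes "smooth_at A f p" "smooth_at A g p"
    and "\<And>c S. c \<in> charts_at A p \<Longrightarrow> open S \<Longrightarrow> S \<subseteq> chart_img c \<Longrightarrow> smooth_on S (\<lambda>u. f (chart_inv c u)) \<Longrightarrow> smooth_on S (\<lambda>u. g (chart_inv c u)) \<Longrightarrow>
      smooth_on S (\<lambda>u. h (chart_inv c u))"
  shows "smooth_at A h p"
proof -
  obtain c where c: "c \<in> charts_at A p" using assms(1) unfolding smooth_at_def by blast
  obtain U where U: "open U" "snd c p \<in> U" "U \<subseteq> chart_img c" "smooth_on U (\<lambda>u. f (chart_inv c u))"
    by (rule smooth_at_chart[OF assms(1) c])
  obtain V where V: "open V" "snd c p \<in> V" "V \<subseteq> chart_img c" "smooth_on V (\<lambda>u. g (chart_inv c u))"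
    by (rule smooth_at_chart[OF assms(2) c])
  have "smooth_on (U \<inter> V) (\<lambda>u. h (chart_inv c u))"
    using U V by (intro assms(3) c) (auto intro: smooth_on_subset)
  then show ?thesis
    unfolding smooth_at_def using c U V by (intro bexI[of _ c] exI[of _ "U \<inter> V"]) auto
qed

lemma smooth_at_add: "smooth_at A f p \<Longrightarrow> smooth_at A g p \<Longrightarrow> smooth_at A (\<lambda>q. f q + g q) p"
  by (erule (1) smooth_at_binary) (auto intro: smooth_on_add)

lemma smooth_at_diff: "smooth_at A f p \<Longrightarrow> smooth_at A g p \<Longrightarrow> smooth_at A (\<lambda>q. f q - g q) p"
  by (erule (1) smooth_at_binary) (auto intro: smooth_on_diff)

lemma smooth_at_scaleR: "smooth_at A f p \<Longrightarrow> smooth_at A g p \<Longrightarrow> smooth_at A (\<lambda>q. f q *\<^sub>R g q) p"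
  by (erule (1) smooth_at_binary) (auto intro: smooth_on_scaleR)

lemma smooth_at_inner: "smooth_at A f p \<Longrightarrow> smooth_at A g p \<Longrightarrow> smooth_at A (\<lambda>q. f q \<bullet> g q) p"
  by (erule (1) smooth_at_binary) (auto intro: smooth_on_inner)

lemma smooth_at_sum:
  "p \<in> points A \<Longrightarrow> (\<And>i. i \<in> I \<Longrightarrow> smooth_at A (f i) p) \<Longrightarrow> smooth_at A (\<lambda>q. \<Sum>i\<in>I. f i q) p"
  by (induction I rule: infinite_finite_induct) (auto intro: smooth_at_const smooth_at_add)

lemma smooth_at_jacobian:
  assumes "c \<in> charts_at A p" "d \<in> charts_at A p"
  shows "smooth_at A (\<lambda>q. jacobian c d q w) p"
proof -
  have cd: "c \<in> A" "d \<in> A" using assms by (auto simp: charts_at_iff)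
  show ?thesis
  unfolding smooth_at_def
  by (intro bexI[of _ c] exI[of _ "overlap c d"] conjI open_overlap snd_overlap overlap_subset smooth_jacobian assms cd)
qed

lemma openin_Int_charts:
  "c \<in> A \<Longrightarrow> d \<in> A \<Longrightarrow> openin (manifold_topology A) (fst c \<inter> fst d)"
  using openin_chart_domain openin_Int by blast

lemma smooth_at_apply_jacobian:
  fixes f :: "'a \<Rightarrow> 'v"
  assumes "c \<in> charts_at A p" "d \<in> charts_at A p" "smooth_at A f p"
  shows "smooth_at A (\<lambda>q. jacobian c d q (f q)) p"
proof (rule smooth_at_cong)
  show "openin (manifold_topology A) (fst c \<inter> fst d)"
    using openin_Int_charts assms by (simp add: charts_at_iff)
  show "p \<in> fst c \<inter> fst d" using assms by (simp add: charts_at_iff)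
  show "jacobian c d q (f q) = (\<Sum>b\<in>Basis. (f q \<bullet> b) *\<^sub>R jacobian c d q b)" if "q \<in> fst c \<inter> fst d" for q
    using that assms by (intro linear_Basis_sum linear_jacobian) (auto simp: charts_at_iff)
  have "p \<in> points A" using assms points_iff by blast
  then show "smooth_at A (\<lambda>q. \<Sum>b\<in>Basis. (f q \<bullet> b) *\<^sub>R jacobian c d q b) p"
    by (intro smooth_at_sum smooth_at_scaleR smooth_at_inner smooth_at_jacobian smooth_at_const assms)
qed

lemma smooth_fun_iff: "smooth_fun A f \<longleftrightarrow> (\<forall>p\<in>points A. smooth_at A f p)"
  unfolding smooth_fun_def comp_def using smooth_on_chart_iff by (auto simp: points_def)

section \<open>Vector fields and directional derivatives\<close>

text \<open>Components in any other chart are obtained by applying a Jacobian that depends smoothly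
  on the point, so one chart around each point decides.\<close>

lemma vector_fieldI:
  assumes "\<And>p. p \<in> points A \<Longrightarrow> X p \<in> tangent_space A p"
    "\<And>p. p \<in> points A \<Longrightarrow> \<exists>c\<in>charts_at A p. smooth_at A (\<lambda>q. X q c) p"
  shows "vector_field A X"
  unfolding vector_field_def
proof (intro conjI ballI)
  fix d assume d: "d \<in> A"
  have "smooth_at A (\<lambda>q. X q d) p" if p: "p \<in> fst d" for p
  proof -
    have "p \<in> points A" using d p by (auto simp: points_def)
    then obtain c where c: "c \<in> charts_at A p" "smooth_at A (\<lambda>q. X q c) p"
      using assms(2) by blast
    have dp: "d \<in> charts_at A p" using d p by (simp add: charts_at_iff)
    show ?thesis
    proof (rule smooth_at_cong)
      show "openin (manifold_topology A) (fst c \<inter> fst d)"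
        using openin_Int_charts c d by (simp add: charts_at_iff)
      show "p \<in> fst c \<inter> fst d" using c p by (simp add: charts_at_iff)
      show "X q d = jacobian c d q (X q c)" if "q \<in> fst c \<inter> fst d" for q
      proof (intro tangent_apply assms(1))
        show "c \<in> charts_at A q" "d \<in> charts_at A q" using that c d by (auto simp: charts_at_iff)
        then show "q \<in> points A" using points_iff by blast
      qed
      show "smooth_at A (\<lambda>q. jacobian c d q (X q c)) p"
        by (intro smooth_at_apply_jacobian c dp)
    qed
  qed
  then show "smooth_on (chart_img d) (\<lambda>u. X (chart_inv d u) d)"
    using smooth_on_chart_iff[OF d, of "\<lambda>q. X q d"] by simp
qed (rule assms(1))

lemma vector_field_tangent: "vector_field A X \<Longrightarrow> p \<in> points A \<Longrightarrow> X p \<in> tangent_space A p"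
  by (simp add: vector_field_def)

lemma vector_field_smooth: "vector_field A X \<Longrightarrow> c \<in> A \<Longrightarrow> smooth_on (chart_img c) (\<lambda>u. X (chart_inv c u) c)"
  by (simp add: vector_field_def)

lemma vector_field_smooth_at: "vector_field A X \<Longrightarrow> c \<in> charts_at A p \<Longrightarrow> smooth_at A (\<lambda>q. X q c) p"
  using vector_field_smooth smooth_on_chart_iff[of c "\<lambda>q. X q c"] by (auto simp: charts_at_iff)

lemma vector_field_add:
  assumes "vector_field A X" "vector_field A Y"
  shows "vector_field A (\<lambda>p. X p + Y p)"
proof (rule vector_fieldI)
  fix p assume p: "p \<in> points A"
  show "X p + Y p \<in> tangent_space A p" using assms p by (simp add: vector_field_tangent tangent_add)
  obtain c where "c \<in> charts_at A p" using p points_iff by blast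
  then show "\<exists>c\<in>charts_at A p. smooth_at A (\<lambda>q. (X q + Y q) c) p"
    using assms by (auto intro!: smooth_at_add vector_field_smooth_at)
qed

lemma vector_field_scale:
  assumes "smooth_fun A f" "vector_field A Y"
  shows "vector_field A (\<lambda>p. f p *\<^sub>R Y p)"
proof (rule vector_fieldI)
  fix p assume p: "p \<in> points A"
  show "f p *\<^sub>R Y p \<in> tangent_space A p" using assms p by (simp add: vector_field_tangent tangent_scale)
  obtain c where "c \<in> charts_at A p" using p points_iff by blast
  then show "\<exists>c\<in>charts_at A p. smooth_at A (\<lambda>q. (f q *\<^sub>R Y q) c) p"
    using assms p by (auto simp: smooth_fun_iff scaleR_fun_def intro!: smooth_at_scaleR vector_field_smooth_at)
qed

lemma vector_field_zero: "vector_field A (\<lambda>p. 0)"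
  by (auto simp: vector_field_def tangent_zero)

lemma vector_field_sum:
  "(\<And>i. i \<in> I \<Longrightarrow> vector_field A (X i)) \<Longrightarrow> vector_field A (\<lambda>p. \<Sum>i\<in>I. X i p)"
  by (induction I rule: infinite_finite_induct) (auto intro: vector_field_zero vector_field_add)

text \<open>\<open>dir_deriv\<close> is evaluated in a selected chart; the chain rule and the
  transformation law of \<open>v\<close> make it the same in every chart.\<close>

lemma dir_deriv_chart:
  assumes c: "c \<in> charts_at A p" and v: "v \<in> tangent_space A p" and f: "smooth_at A f p"
  shows "dir_deriv A p v f = frechet_derivative (\<lambda>u. f (chart_inv c u)) (at (snd c p)) (v c)"
proof -
  let ?d = "chart_at A p"
  have d: "?d \<in> charts_at A p" using c points_iff chart_at by blast
  obtain U where U: "open U" "snd c p \<in> U" "U \<subseteq> chart_img c" "smooth_on U (\<lambda>u. f (chart_inv c u))"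
    by (rule smooth_at_chart[OF f c])
  have A: "c \<in> A" "?d \<in> A" "p \<in> fst c" "p \<in> fst ?d" using c d by (auto simp: charts_at_iff)
  have "((\<lambda>u. f (chart_inv c (transition ?d c u))) has_derivative
     (\<lambda>w. frechet_derivative (\<lambda>u. f (chart_inv c u)) (at (snd c p)) (jacobian ?d c p w))) (at (snd ?d p))"
    using smooth_on_has_derivative[OF U(4,2)] transition_snd[OF A(2,4)]
    by (intro has_derivative_compose[OF transition_has_derivative[OF d c], of "\<lambda>u. f (chart_inv c u)"]) simp
  then have "((\<lambda>u. f (chart_inv ?d u)) has_derivative
     (\<lambda>w. frechet_derivative (\<lambda>u. f (chart_inv c u)) (at (snd c p)) (jacobian ?d c p w))) (at (snd ?d p))"
    by (rule has_derivative_transform_within_open[of _ _ _ _ "overlap ?d c"])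
       (use A open_overlap snd_overlap[OF d c] transition_mem in auto)
  then show ?thesis
    using tangent_apply[OF v d c] by (simp add: dir_deriv_def Let_def comp_def frechet_derivative_eq)
qed

end

section \<open>Cutoff functions and locality of connections\<close>

lemma scaleR_fun_apply: "(r *\<^sub>R f) x = r *\<^sub>R f x"
  by (simp add: scaleR_fun_def)

text \<open>The condition off the manifold is needed because the values of vector fields there are arbitrary,
  while a connection receives the whole function.\<close>

definition cutoff_on :: "('a, 'v::euclidean_space) chart set \<Rightarrow> 'a set \<Rightarrow> ('a \<Rightarrow> real) \<Rightarrow> bool"
  where "cutoff_on A W \<beta> \<longleftrightarrow> smooth_fun A \<beta> \<and> (\<forall>q. q \<notin> points A \<longrightarrow> \<beta> q = 0) \<and>
    (\<exists>V. openin (manifold_topology A) V \<and> points A \<subseteq> V \<union> W \<and> (\<forall>q\<in>V. \<beta> q = 0))"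

locale manifold =
  fixes A :: "('a, 'v::euclidean_space) chart set"
  assumes smooth_manifold: "smooth_manifold A"

sublocale manifold \<subseteq> atlas A
  using smooth_manifold by unfold_locales (auto simp: smooth_manifold_def overlap_def)

context manifold
begin

lemma continuous_map_chart_inv:
  assumes "c \<in> A"
  shows "continuous_map (top_of_set (chart_img c)) (manifold_topology A) (chart_inv c)"
  unfolding continuous_map_def
proof (intro conjI allI impI)
  show "chart_inv c \<in> topspace (top_of_set (chart_img c)) \<rightarrow> topspace (manifold_topology A)"
    using assms by auto
  fix U assume "openin (manifold_topology A) U"
  then have "open {u \<in> chart_img c. chart_inv c u \<in> U}"
    using open_in_chart assms by blast
  then show "openin (top_of_set (chart_img c)) {x \<in> topspace (top_of_set (chart_img c)). chart_inv c x \<in> U}"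
    by (auto simp: openin_open)
qed

text \<open>A bump in the chart is extended by zero. It vanishes off the image \<open>K\<close> of a
  closed ball; \<open>K\<close> is compact, hence closed by the Hausdorff property, so the extension
  vanishes on an open set that together with the chart domain covers the manifold.\<close>

lemma cutoff_exists:
  assumes c: "c \<in> charts_at A p" and W: "openin (manifold_topology A) W" "p \<in> W"
  obtains \<beta> W' where "cutoff_on A (W \<inter> fst c) \<beta>" "openin (manifold_topology A) W'" "p \<in> W'"
    "W' \<subseteq> W \<inter> fst c" "\<And>q. q \<in> W' \<Longrightarrow> \<beta> q = 1"
proof -
  have A: "c \<in> A" "p \<in> fst c" using c by (auto simp: charts_at_iff)
  define U where "U = {u \<in> chart_img c. chart_inv c u \<in> W}"
  have U: "open U" "snd c p \<in> U"
    unfolding U_def using open_in_chart[OF W(1) A(1)] A W(2) by auto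
  then obtain R where R: "R > 0" "cball (snd c p) R \<subseteq> U"
    using open_contains_cball by metis
  obtain b :: "'v \<Rightarrow> real" where b: "smooth_on UNIV b" "\<And>x. dist (snd c p) x \<le> R / 2 \<Longrightarrow> b x = 1"
    "\<And>x. dist (snd c p) x \<ge> R \<Longrightarrow> b x = 0"
    using smooth_bump[of "R / 2" R "snd c p"] R(1) by auto
  define \<beta> where "\<beta> q = (if q \<in> fst c then b (snd c q) else 0)" for q
  define K where "K = chart_inv c ` cball (snd c p) R"
  define V where "V = points A - K"
  have "compactin (top_of_set (chart_img c)) (cball (snd c p) R)"
    using R U_def by (auto simp: compactin_subtopology)
  then have "compactin (manifold_topology A) K"
    unfolding K_def by (rule image_compactin[OF _ continuous_map_chart_inv[OF A(1)]])
  then have "closedin (manifold_topology A) K"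
    using smooth_manifold by (auto simp: smooth_manifold_def intro: compactin_imp_closedin)
  then have V: "openin (manifold_topology A) V"
    unfolding V_def using openin_diff[OF openin_topspace] by (metis topspace_atlas)
  have \<beta>V: "\<beta> q = 0" if "q \<in> V" for q
  proof (cases "q \<in> fst c")
    case True
    then have "snd c q \<notin> cball (snd c p) R"
      using that A(1) unfolding V_def K_def by (metis DiffD2 chart_inv_snd image_eqI)
    then show ?thesis using b(3) by (simp add: \<beta>_def)
  qed (simp add: \<beta>_def)
  have KW: "K \<subseteq> W \<inter> fst c"
    using R(2) by (auto simp: K_def U_def)
  have cover: "points A \<subseteq> V \<union> (W \<inter> fst c)" using KW by (auto simp: V_def)
  have "smooth_at A \<beta> q" if q: "q \<in> points A" for q
  proof (cases "q \<in> fst c")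
    case True
    have "smooth_on (chart_img c) (\<lambda>u. \<beta> (chart_inv c u))"
      by (subst smooth_on_cong[OF open_chart_img[OF A(1)], of _ b])
         (auto simp: \<beta>_def intro: smooth_on_subset[OF b(1)])
    then show ?thesis using True A by (intro smooth_at_of_chart) (auto simp: charts_at_iff)
  next
    case False
    then have "q \<in> V" using q cover by auto
    then show ?thesis by (rule smooth_at_cong[OF V _ \<beta>V smooth_at_const[OF q]])
  qed
  then have "smooth_fun A \<beta>" by (simp add: smooth_fun_iff)
  moreover have "\<beta> q = 0" if "q \<notin> points A" for q
    using that A(1) by (auto simp: \<beta>_def points_def)
  ultimately have "cutoff_on A (W \<inter> fst c) \<beta>"
    unfolding cutoff_on_def using V \<beta>V cover by blast
  moreover have sub: "ball (snd c p) (R / 2) \<subseteq> U" using R by fastforce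
  then have "openin (manifold_topology A) (chart_inv c ` ball (snd c p) (R / 2))"
    by (intro openin_chart A) (auto simp: U_def)
  moreover have "p \<in> chart_inv c ` ball (snd c p) (R / 2)"
    using R A by (intro image_eqI[of _ _ "snd c p"]) auto
  moreover have "chart_inv c ` ball (snd c p) (R / 2) \<subseteq> W \<inter> fst c"
    using sub by (auto simp: U_def)
  moreover have "\<beta> q = 1" if "q \<in> chart_inv c ` ball (snd c p) (R / 2)" for q
    using that sub b(2) by (auto simp: \<beta>_def U_def)
  ultimately show ?thesis by (rule that)
qed

text \<open>Outside \<open>W\<close> the product vanishes on a neighbourhood, so \<open>F\<close>
  has to be smooth inside \<open>W\<close> only.\<close>

lemma smooth_at_cutoff:
  assumes "cutoff_on A W \<beta>" "p \<in> points A" "p \<in> W \<Longrightarrow> smooth_at A F p"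
  shows "smooth_at A (\<lambda>q. \<beta> q *\<^sub>R F q) p"
proof (cases "p \<in> W")
  case True
  then show ?thesis
    using assms by (auto simp: cutoff_on_def smooth_fun_iff intro: smooth_at_scaleR)
next
  case False
  obtain V where "openin (manifold_topology A) V" "points A \<subseteq> V \<union> W" "\<forall>q\<in>V. \<beta> q = 0"
    using assms(1) unfolding cutoff_on_def by blast
  then show ?thesis
    using False assms(2) by (intro smooth_at_cong[OF _ _ _ smooth_at_const[OF assms(2), of 0], of V]) auto
qed

lemma cutoff_zero:
  assumes "cutoff_on A W \<beta>" "q \<notin> W"
  shows "\<beta> q = 0"
  using assms unfolding cutoff_on_def by blast

lemma cutoff_smooth_fun: "cutoff_on A W \<beta> \<Longrightarrow> smooth_fun A \<beta>"
  by (simp add: cutoff_on_def)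

lemma vector_field_cutoff:
  assumes "cutoff_on A W \<beta>" "W \<subseteq> fst c" "c \<in> A"
  shows "vector_field A (\<lambda>q. \<beta> q *\<^sub>R of_chart A c q y)"
proof (rule vector_fieldI)
  fix p assume p: "p \<in> points A"
  show "\<beta> p *\<^sub>R of_chart A c p y \<in> tangent_space A p"
  proof (cases "p \<in> W")
    case True
    then show ?thesis using assms(2,3) by (auto simp: charts_at_iff intro!: tangent_scale of_chart_tangent)
  qed (simp add: cutoff_zero[OF assms(1)] tangent_zero)
  obtain d where d: "d \<in> charts_at A p" using p points_iff by blast
  have "smooth_at A (\<lambda>q. \<beta> q *\<^sub>R of_chart A c q y d) p"
  proof (rule smooth_at_cutoff[OF assms(1) p])
    assume "p \<in> W"
    then have c: "c \<in> charts_at A p" using assms by (auto simp: charts_at_iff)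
    show "smooth_at A (\<lambda>q. of_chart A c q y d) p"
    proof (rule smooth_at_cong[OF _ _ _ smooth_at_jacobian[OF c d]])
      show "openin (manifold_topology A) (fst c \<inter> fst d)"
        using openin_Int_charts c d by (simp add: charts_at_iff)
      show "p \<in> fst c \<inter> fst d" using c d by (simp add: charts_at_iff)
      show "of_chart A c q y d = jacobian c d q y" if "q \<in> fst c \<inter> fst d" for q
        using that c d by (simp add: charts_at_iff of_chart_apply)
    qed
  qed
  then show "\<exists>c'\<in>charts_at A p. smooth_at A (\<lambda>q. (\<beta> q *\<^sub>R of_chart A c q y) c') p"
    using d by (auto simp: scaleR_fun_apply)
qed

lemma charts_at_points: "c \<in> charts_at A p \<Longrightarrow> p \<in> points A"
  using points_iff by blast

lemma linear_on_of_chart: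
  assumes "linear_on (tangent_space A p) f" "c \<in> charts_at A p"
  shows "linear (\<lambda>x. f (of_chart A c p x))"
proof (rule linearI)
  fix x y :: 'v and r :: real
  have *: "f (r *\<^sub>R v + s *\<^sub>R w) = r *\<^sub>R f v + s *\<^sub>R f w" if "v \<in> tangent_space A p" "w \<in> tangent_space A p" for v w r s
    using assms(1) that by (simp add: linear_on_def)
  show "f (of_chart A c p (x + y)) = f (of_chart A c p x) + f (of_chart A c p y)"
    using *[OF of_chart_tangent of_chart_tangent, of c c 1 x 1 y] assms(2)
    by (simp add: linear_add[OF linear_of_chart])
  show "f (of_chart A c p (r *\<^sub>R x)) = r *\<^sub>R f (of_chart A c p x)"
    using *[OF of_chart_tangent of_chart_tangent, of c c r x 0 x] assms(2)
    by (simp add: linear_scale[OF linear_of_chart])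
qed

text \<open>The choice depends on \<open>c\<close> and \<open>p\<close> only. Hence all coordinate
  fields at \<open>p\<close> share one cutoff, and \<open>coord_field\<close> is linear in its
  component vector as a function, also at points far from \<open>p\<close>.\<close>

definition bump_at :: "('a, 'v) chart \<Rightarrow> 'a \<Rightarrow> 'a \<Rightarrow> real"
  where "bump_at c p = (SOME \<beta>. cutoff_on A (fst c) \<beta> \<and>
    (\<exists>W. openin (manifold_topology A) W \<and> p \<in> W \<and> W \<subseteq> fst c \<and> (\<forall>q\<in>W. \<beta> q = 1)))"

lemma bump_at:
  assumes "c \<in> charts_at A p"
  obtains W where "cutoff_on A (fst c) (bump_at c p)" "openin (manifold_topology A) W" "p \<in> W" "W \<subseteq> fst c"
    "\<And>q. q \<in> W \<Longrightarrow> bump_at c p q = 1"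
proof -
  have "openin (manifold_topology A) (points A)" "p \<in> points A"
    using topspace_atlas openin_topspace assms points_iff by metis+
  then obtain \<beta> W' where "cutoff_on A (points A \<inter> fst c) \<beta>" "openin (manifold_topology A) W'" "p \<in> W'"
    "W' \<subseteq> points A \<inter> fst c" "\<And>q. q \<in> W' \<Longrightarrow> \<beta> q = 1"
    using cutoff_exists[OF assms] by blast
  moreover have "points A \<inter> fst c = fst c" using assms by (auto simp: charts_at_iff points_def)
  ultimately have "\<exists>\<beta>. cutoff_on A (fst c) \<beta> \<and>
    (\<exists>W. openin (manifold_topology A) W \<and> p \<in> W \<and> W \<subseteq> fst c \<and> (\<forall>q\<in>W. \<beta> q = 1))"
    by auto
  from someI_ex[OF this] show ?thesis
    unfolding bump_at_def[symmetric] using that by blast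
qed

definition coord_field :: "('a, 'v) chart \<Rightarrow> 'a \<Rightarrow> 'v \<Rightarrow> ('a, 'v) vfield"
  where "coord_field c p y = (\<lambda>q. bump_at c p q *\<^sub>R of_chart A c q y)"

lemma vector_field_coord: "c \<in> charts_at A p \<Longrightarrow> vector_field A (coord_field c p y)"
  unfolding coord_field_def
  by (rule bump_at[of c p]) (auto intro!: vector_field_cutoff simp: charts_at_iff)

lemma coord_field_near:
  assumes "c \<in> charts_at A p"
  obtains W where "openin (manifold_topology A) W" "p \<in> W" "W \<subseteq> fst c"
    "\<And>q y. q \<in> W \<Longrightarrow> coord_field c p y q = of_chart A c q y"
proof -
  obtain W where "openin (manifold_topology A) W" "p \<in> W" "W \<subseteq> fst c" "\<And>q. q \<in> W \<Longrightarrow> bump_at c p q = 1"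
    by (rule bump_at[OF assms]) blast
  then show ?thesis by (intro that[of W]) (simp_all add: coord_field_def)
qed

lemma coord_field_at: "c \<in> charts_at A p \<Longrightarrow> coord_field c p y p = of_chart A c p y"
  by (rule coord_field_near[of c p]) simp_all

lemma coord_field_chart_near:
  assumes "c \<in> charts_at A p"
  obtains U where "open U" "snd c p \<in> U" "U \<subseteq> chart_img c"
    "\<And>u y. u \<in> U \<Longrightarrow> coord_field c p y (chart_inv c u) c = y"
proof -
  obtain W where W: "openin (manifold_topology A) W" "p \<in> W" "W \<subseteq> fst c"
    "\<And>q y. q \<in> W \<Longrightarrow> coord_field c p y q = of_chart A c q y"
    by (rule coord_field_near[OF assms]) blast
  have c: "c \<in> A" "p \<in> fst c" using assms by (auto simp: charts_at_iff)
  show ?thesis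
    using open_in_chart[OF W(1) c(1)] W c
    by (intro that[of "{u \<in> chart_img c. chart_inv c u \<in> W}"]) auto
qed

text \<open>Because of this vanishing, coordinate fields commute at \<open>p\<close>, and their
  complete lifts have no fibre component there in the chart induced by \<open>c\<close>.\<close>

lemma coord_field_derivative:
  assumes "c \<in> charts_at A p"
  shows "((\<lambda>u. coord_field c p y (chart_inv c u) c) has_derivative (\<lambda>v. 0)) (at (snd c p))"
proof -
  obtain U where "open U" "snd c p \<in> U" "U \<subseteq> chart_img c"
    "\<And>u y. u \<in> U \<Longrightarrow> coord_field c p y (chart_inv c u) c = y"
    by (rule coord_field_chart_near[OF assms]) blast
  then show ?thesis
    by (intro has_derivative_transform_within_open[OF has_derivative_const, of U]) auto
qed

end

locale connection = manifold A for A :: "('a, 'v::euclidean_space) chart set" +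
  fixes D :: "('a, 'v) connection"
  assumes linear_connection: "linear_connection A D"
begin

lemma connection_field: "vector_field A X \<Longrightarrow> vector_field A Z \<Longrightarrow> vector_field A (\<lambda>p. D p (Z p) X)"
  and connection_linear: "p \<in> points A \<Longrightarrow> vector_field A X \<Longrightarrow> linear_on (tangent_space A p) (\<lambda>v. D p v X)"
  and connection_tangent: "p \<in> points A \<Longrightarrow> vector_field A X \<Longrightarrow> v \<in> tangent_space A p \<Longrightarrow> D p v X \<in> tangent_space A p"
  and connection_add: "p \<in> points A \<Longrightarrow> v \<in> tangent_space A p \<Longrightarrow> vector_field A X \<Longrightarrow> vector_field A Y \<Longrightarrow>
         D p v (\<lambda>q. X q + Y q) = D p v X + D p v Y"
  and connection_scale: "p \<in> points A \<Longrightarrow> v \<in> tangent_space A p \<Longrightarrow> smooth_fun A f \<Longrightarrow> vector_field A X \<Longrightarrow>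
         D p v (\<lambda>q. f q *\<^sub>R X q) = dir_deriv A p v f *\<^sub>R X p + f p *\<^sub>R D p v X"
  using linear_connection unfolding linear_connection_def by blast+

lemma smooth_fun_const: "smooth_fun A (\<lambda>q. k)"
  by (simp add: smooth_fun_iff smooth_at_const)

lemma dir_deriv_const [simp]: "dir_deriv A p v (\<lambda>q. k) = 0"
  by (simp add: dir_deriv_def Let_def comp_def)

lemma connection_const_scale:
  "p \<in> points A \<Longrightarrow> v \<in> tangent_space A p \<Longrightarrow> vector_field A X \<Longrightarrow>
    D p v (\<lambda>q. r *\<^sub>R X q) = r *\<^sub>R D p v X"
  by (simp add: connection_scale[OF _ _ smooth_fun_const])

lemma connection_sum:
  assumes "p \<in> points A" "v \<in> tangent_space A p" "\<And>i. i \<in> I \<Longrightarrow> vector_field A (X i)"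
  shows "D p v (\<lambda>q. \<Sum>i\<in>I. X i q) = (\<Sum>i\<in>I. D p v (X i))"
  using assms(3)
proof (induction I rule: infinite_finite_induct)
  case (insert i I)
  then show ?case
    by (simp only: sum.insert[OF insert(1,2)])
       (subst connection_add[OF assms(1,2)], auto intro: vector_field_sum)
qed (use connection_const_scale[OF assms(1,2) vector_field_zero, of 0] in simp_all)

text \<open>The difference \<open>Z\<close> of the two fields satisfies \<open>f Z = Z\<close> for some \<open>f\<close> with \<open>f p = 0\<close>, so the Leibniz
  rule gives \<open>D\<^sub>v Z = 0\<close>.\<close>

lemma connection_local:
  assumes p: "p \<in> points A" and v: "v \<in> tangent_space A p" and X: "vector_field A X" and Y: "vector_field A Y"
    and W: "openin (manifold_topology A) W" "p \<in> W" and eq: "\<And>q. q \<in> W \<Longrightarrow> X q = Y q"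
  shows "D p v X = D p v Y"
proof -
  define Z where "Z = (\<lambda>q. X q + (-1) *\<^sub>R Y q)"
  have mY: "vector_field A (\<lambda>q. (-1) *\<^sub>R Y q)"
    by (rule vector_field_scale[OF smooth_fun_const Y])
  then have Z: "vector_field A Z" unfolding Z_def by (rule vector_field_add[OF X])
  have DZ: "D p v Z = D p v X - D p v Y"
    unfolding Z_def using connection_add[OF p v X mY] connection_const_scale[OF p v Y, of "-1"] by simp
  obtain c where c: "c \<in> charts_at A p" using p points_iff by blast
  obtain \<beta> W' where \<beta>: "cutoff_on A (W \<inter> fst c) \<beta>" "p \<in> W'" "\<And>q. q \<in> W' \<Longrightarrow> \<beta> q = 1"
    by (rule cutoff_exists[OF c W]) blast
  have f: "smooth_fun A (\<lambda>q. 1 - \<beta> q)"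
    using cutoff_smooth_fun[OF \<beta>(1)] by (auto simp: smooth_fun_iff intro: smooth_at_diff smooth_at_const)
  \<comment> \<open>Required for every \<open>q\<close>, including points off the manifold, because
    \<open>D\<close> takes the whole function as its argument.\<close>
  have "(1 - \<beta> q) *\<^sub>R Z q = Z q" for q
  proof (cases "q \<in> W")
    case False
    then show ?thesis using cutoff_zero[OF \<beta>(1), of q] by simp
  qed (simp add: Z_def eq)
  then have "(\<lambda>q. (1 - \<beta> q) *\<^sub>R Z q) = Z" by blast
  then have "D p v Z = dir_deriv A p v (\<lambda>q. 1 - \<beta> q) *\<^sub>R Z p + (1 - \<beta> p) *\<^sub>R D p v Z"
    using connection_scale[OF p v f Z] by (simp only:)
  moreover have "Z p = 0" using eq W by (simp add: Z_def)
  ultimately have "D p v Z = 0" using \<beta>(3)[OF \<beta>(2)] by simp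
  then show ?thesis using DZ by simp
qed

text \<open>Christoffel symbols. The coordinate field is centred at the point where it is
  differentiated, so the definition makes sense on the whole chart, although its cutoff changes with
  \<open>u\<close>.\<close>

definition Gam :: "('a, 'v) chart \<Rightarrow> 'v \<Rightarrow> 'v \<Rightarrow> 'v \<Rightarrow> 'v"
  where "Gam c u x y = D (chart_inv c u) (of_chart A c (chart_inv c u) x) (coord_field c (chart_inv c u) y) c"

text \<open>Coordinate fields with different centres agree near any point where both cutoffs are
  locally 1, so by locality the moving centre can be replaced by \<open>p\<close>. With fixed
  fields, smoothness of the symbols becomes visible.\<close>

lemma Gam_near:
  assumes c: "c \<in> charts_at A p"
  obtains U where "open U" "snd c p \<in> U" "U \<subseteq> chart_img c"
    "\<And>u x y. u \<in> U \<Longrightarrow> Gam c u x y =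
      D (chart_inv c u) (coord_field c p x (chart_inv c u)) (coord_field c p y) c"
proof -
  obtain W where W: "openin (manifold_topology A) W" "p \<in> W" "W \<subseteq> fst c"
    "\<And>q y. q \<in> W \<Longrightarrow> coord_field c p y q = of_chart A c q y"
    by (rule coord_field_near[OF c]) blast
  have cA: "c \<in> A" "p \<in> fst c" using c by (auto simp: charts_at_iff)
  define U where "U = {u \<in> chart_img c. chart_inv c u \<in> W}"
  have "Gam c u x y = D (chart_inv c u) (coord_field c p x (chart_inv c u)) (coord_field c p y) c" if u: "u \<in> U" for u x y
  proof -
    let ?q = "chart_inv c u"
    have q: "?q \<in> W" "c \<in> charts_at A ?q" "?q \<in> points A" using u cA by (auto simp: U_def)
    obtain W' where W': "openin (manifold_topology A) W'" "?q \<in> W'"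
      "\<And>q' y. q' \<in> W' \<Longrightarrow> coord_field c ?q y q' = of_chart A c q' y"
      by (rule coord_field_near[OF q(2)]) blast
    have "D ?q (of_chart A c ?q x) (coord_field c ?q y) = D ?q (of_chart A c ?q x) (coord_field c p y)"
      by (rule connection_local[of _ _ _ _ "W \<inter> W'"])
         (use q c W W' in \<open>auto intro: of_chart_tangent vector_field_coord openin_Int\<close>)
    then show ?thesis by (simp add: Gam_def W(4) q)
  qed
  moreover have "open U" unfolding U_def using open_in_chart W cA by blast
  ultimately show ?thesis using W cA by (intro that[of U]) (auto simp: U_def)
qed

lemma smooth_Gam:
  assumes "c \<in> A"
  shows "smooth_on (chart_img c) (\<lambda>u. Gam c u x y)"
proof (rule smooth_on_local)
  fix u assume u: "u \<in> chart_img c"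
  let ?p = "chart_inv c u"
  have p: "c \<in> charts_at A ?p" using u assms by simp
  obtain U where U: "open U" "snd c ?p \<in> U" "U \<subseteq> chart_img c"
    "\<And>u' x y. u' \<in> U \<Longrightarrow> Gam c u' x y =
      D (chart_inv c u') (coord_field c ?p x (chart_inv c u')) (coord_field c ?p y) c"
    by (rule Gam_near[OF p]) blast
  have "vector_field A (\<lambda>q. D q (coord_field c ?p x q) (coord_field c ?p y))"
    using p by (intro connection_field vector_field_coord)
  then have "smooth_on U (\<lambda>u'. D (chart_inv c u') (coord_field c ?p x (chart_inv c u')) (coord_field c ?p y) c)"
    using smooth_on_subset[OF vector_field_smooth U(3)] assms by blast
  then have "smooth_on U (\<lambda>u. Gam c u x y)"
    by (subst smooth_on_cong[OF U(1)]) (auto simp: U(4))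
  then show "\<exists>T. open T \<and> u \<in> T \<and> smooth_on T (\<lambda>u. Gam c u x y)"
    using U u by auto
qed

lemma bilinear_Gam:
  assumes "c \<in> A" "u \<in> chart_img c"
  shows "bilinear (Gam c u)"
proof -
  let ?p = "chart_inv c u"
  have c: "c \<in> charts_at A ?p" and p: "?p \<in> points A" using assms by auto
  have add: "coord_field c ?p (y + z) = (\<lambda>q. coord_field c ?p y q + coord_field c ?p z q)"
    and scale: "coord_field c ?p (r *\<^sub>R y) = (\<lambda>q. r *\<^sub>R coord_field c ?p y q)" for y z r
  proof -
    have *: "bump_at c ?p q *\<^sub>R of_chart A c q (y + z) = bump_at c ?p q *\<^sub>R of_chart A c q y + bump_at c ?p q *\<^sub>R of_chart A c q z"
      "bump_at c ?p q *\<^sub>R of_chart A c q (r *\<^sub>R y) = r *\<^sub>R bump_at c ?p q *\<^sub>R of_chart A c q y" for q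
    proof -
      have "cutoff_on A (fst c) (bump_at c ?p)" by (rule bump_at[OF c])
      \<comment> \<open>Outside the chart domain \<open>of_chart\<close> is not known to be linear
        in the vector; there the cutoff vanishes.\<close>
      then have "bump_at c ?p q = 0 \<or> c \<in> charts_at A q"
        using cutoff_zero[of "fst c" "bump_at c ?p" q] assms(1) by (auto simp: charts_at_iff)
      then show "bump_at c ?p q *\<^sub>R of_chart A c q (y + z) = bump_at c ?p q *\<^sub>R of_chart A c q y + bump_at c ?p q *\<^sub>R of_chart A c q z"
        "bump_at c ?p q *\<^sub>R of_chart A c q (r *\<^sub>R y) = r *\<^sub>R bump_at c ?p q *\<^sub>R of_chart A c q y"
        by (auto simp: linear_add[OF linear_of_chart] linear_scale[OF linear_of_chart] scaleR_right_distrib)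
    qed
    show "coord_field c ?p (y + z) = (\<lambda>q. coord_field c ?p y q + coord_field c ?p z q)"
      "coord_field c ?p (r *\<^sub>R y) = (\<lambda>q. r *\<^sub>R coord_field c ?p y q)"
      by (simp_all add: coord_field_def * fun_eq_iff)
  qed
  have "linear (\<lambda>y. Gam c u x y)" for x
    by (rule linearI) (simp_all add: Gam_def add scale connection_add connection_const_scale p
        of_chart_tangent[OF c] vector_field_coord[OF c] scaleR_fun_apply)
  moreover have "linear (\<lambda>x. Gam c u x y)" for y
  proof -
    have *: "linear (\<lambda>x. D ?p (of_chart A c ?p x) (coord_field c ?p y))"
      by (rule linear_on_of_chart[OF connection_linear c]) (simp_all add: p vector_field_coord c)
    show ?thesis
      by (rule linearI) (simp_all add: Gam_def linear_add[OF *] linear_scale[OF *] scaleR_fun_apply)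
  qed
  ultimately show ?thesis by (simp add: bilinear_def)
qed

text \<open>Near \<open>p\<close> the field is a combination of coordinate fields with coefficient
  functions, and the Leibniz rule splits each term into a derivative of a coefficient and a
  Christoffel term.\<close>

lemma connection_chart:
  assumes c: "c \<in> charts_at A p" and X: "vector_field A X" and v: "v \<in> tangent_space A p"
  shows "D p v X c = frechet_derivative (\<lambda>u. X (chart_inv c u) c) (at (snd c p)) (v c) + Gam c (snd c p) (v c) (X p c)"
proof -
  have cA: "c \<in> A" "p \<in> fst c" using c by (auto simp: charts_at_iff)
  have p: "p \<in> points A" using c points_iff by blast
  obtain W where W: "openin (manifold_topology A) W" "p \<in> W" "W \<subseteq> fst c"
    "\<And>q y. q \<in> W \<Longrightarrow> coord_field c p y q = of_chart A c q y"
    by (rule coord_field_near[OF c]) blast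
  obtain \<beta> W' where \<beta>: "cutoff_on A (W \<inter> fst c) \<beta>" "openin (manifold_topology A) W'" "p \<in> W'"
    "W' \<subseteq> W \<inter> fst c" "\<And>q. q \<in> W' \<Longrightarrow> \<beta> q = 1"
    by (rule cutoff_exists[OF c W(1,2)]) blast
  \<comment> \<open>The components of \<open>X\<close> in the chart \<open>c\<close> are smooth on
    its domain only; the cutoff turns them into global functions, as the Leibniz rule of a
    connection demands.\<close>
  define f where "f b q = \<beta> q * (X q c \<bullet> b)" for b q
  have f: "smooth_fun A (f b)" for b
    unfolding smooth_fun_iff f_def
  proof
    fix q assume q: "q \<in> points A"
    have "smooth_at A (\<lambda>q. \<beta> q *\<^sub>R (X q c \<bullet> b)) q"
      using cA by (intro smooth_at_cutoff[OF \<beta>(1) q] smooth_at_inner smooth_at_const q vector_field_smooth_at[OF X])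
         (auto simp: charts_at_iff)
    then show "smooth_at A (\<lambda>q. \<beta> q * (X q c \<bullet> b)) q" by simp
  qed
  define Y where "Y q = (\<Sum>b\<in>Basis. f b q *\<^sub>R coord_field c p b q)" for q
  have fE: "vector_field A (\<lambda>q. f b q *\<^sub>R coord_field c p b q)" for b
    by (intro vector_field_scale f vector_field_coord c)
  have Y: "vector_field A Y"
    unfolding Y_def by (intro vector_field_sum fE)
  have XY: "X q = Y q" if "q \<in> W'" for q
  proof -
    have q: "c \<in> charts_at A q" "q \<in> W" "q \<in> points A"
      using that \<beta>(4) cA by (auto simp: charts_at_iff points_def)
    have "X q = of_chart A c q (X q c)"
      using vector_field_tangent[OF X q(3)] q(1) by simp
    also have "\<dots> = (\<Sum>b\<in>Basis. (X q c \<bullet> b) *\<^sub>R of_chart A c q b)"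
      by (rule linear_Basis_sum[OF linear_of_chart[OF q(1)]])
    finally show ?thesis using \<beta>(5)[OF that] W(4)[OF q(2)] by (simp add: Y_def f_def)
  qed
  have fp: "f b p = X p c \<bullet> b" for b using \<beta> by (simp add: f_def)
  have Xs: "smooth_on (chart_img c) (\<lambda>u. X (chart_inv c u) c)"
    using vector_field_smooth[OF X cA(1)] .
  have df: "dir_deriv A p v (f b) = frechet_derivative (\<lambda>u. X (chart_inv c u) c) (at (snd c p)) (v c) \<bullet> b" for b
  proof -
    have "((\<lambda>u. X (chart_inv c u) c \<bullet> b) has_derivative
        (\<lambda>w. frechet_derivative (\<lambda>u. X (chart_inv c u) c) (at (snd c p)) w \<bullet> b)) (at (snd c p))"
      using smooth_on_has_derivative[OF Xs] cA by (auto intro!: derivative_eq_intros)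
    then have "((\<lambda>u. f b (chart_inv c u)) has_derivative
        (\<lambda>w. frechet_derivative (\<lambda>u. X (chart_inv c u) c) (at (snd c p)) w \<bullet> b)) (at (snd c p))"
      by (rule has_derivative_transform_within_open[OF _ open_in_chart[OF \<beta>(2) cA(1)]])
         (use \<beta> cA in \<open>auto simp: f_def\<close>)
    then show ?thesis
      using f[of b] p dir_deriv_chart[OF c v, of "f b"] by (simp add: smooth_fun_iff frechet_derivative_eq)
  qed
  have "D p v X = D p v Y"
    by (rule connection_local[OF p v X Y \<beta>(2,3) XY])
  also have "\<dots> = (\<Sum>b\<in>Basis. D p v (\<lambda>q. f b q *\<^sub>R coord_field c p b q))"
    unfolding Y_def by (rule connection_sum[OF p v fE])
  also have "\<dots> = (\<Sum>b\<in>Basis. dir_deriv A p v (f b) *\<^sub>R coord_field c p b p + f b p *\<^sub>R D p v (coord_field c p b))"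
    by (intro sum.cong refl connection_scale p v f vector_field_coord c)
  finally have eq: "D p v X = \<dots>" .
  have sum_c: "(\<Sum>b\<in>I. F b) c = (\<Sum>b\<in>I. F b c)" for F :: "'v \<Rightarrow> ('a, 'v) tvec" and I
    by (induction I rule: infinite_finite_induct) auto
  have G: "D p v (coord_field c p b) c = Gam c (snd c p) (v c) b" for b
    using cA v c by (simp add: Gam_def)
  have lin: "linear (Gam c (snd c p) (v c))"
    using bilinear_Gam[of c "snd c p"] cA by (simp add: bilinear_def)
  show ?thesis
    unfolding eq sum_c using linear_Basis_sum[OF lin, of "X p c"]
    by (simp add: scaleR_fun_apply df fp G coord_field_at[OF c] of_chart_self[OF c] sum.distrib euclidean_representation)
qed

text \<open>The coordinate fields have vanishing bracket at the point.\<close>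

lemma Gam_symmetric:
  assumes "torsion_free A D" "c \<in> A" "u \<in> chart_img c"
  shows "Gam c u x y = Gam c u y x"
proof -
  let ?p = "chart_inv c u"
  have c: "c \<in> charts_at A ?p" and p: "?p \<in> points A" using assms by auto
  let ?E = "coord_field c ?p"
  have "D ?p (?E x ?p) (?E y) - D ?p (?E y ?p) (?E x) = lie_bracket A (?E x) (?E y) ?p"
    using assms(1) p vector_field_coord[OF c] unfolding torsion_free_def by blast
  then have "(D ?p (?E x ?p) (?E y) - D ?p (?E y ?p) (?E x)) c = lie_bracket A (?E x) (?E y) ?p c"
    by simp
  then show ?thesis
    using c frechet_derivative_eq[OF coord_field_derivative[OF c]]
    by (simp add: lie_bracket_def Gam_def coord_field_at)
qed

end

section \<open>Metrics in coordinates\<close>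

text \<open>The right-hand side of the Koszul formula for coordinate fields, whose brackets vanish;
  it is twice the lowered Christoffel symbol.\<close>

definition koszul :: "('v \<Rightarrow> 'v \<Rightarrow> 'v \<Rightarrow> real) \<Rightarrow> 'v::euclidean_space \<Rightarrow> 'v \<Rightarrow> 'v \<Rightarrow> 'v \<Rightarrow> real"
  where "koszul G u x y w =
      frechet_derivative (\<lambda>u'. G u' y w) (at u) x
    + frechet_derivative (\<lambda>u'. G u' x w) (at u) y
    - frechet_derivative (\<lambda>u'. G u' x y) (at u) w"

locale local_metric =
  fixes S :: "'v::euclidean_space set" and G :: "'v \<Rightarrow> 'v \<Rightarrow> 'v \<Rightarrow> real"
  assumes open_S: "open S"
    and bilinear_G: "u \<in> S \<Longrightarrow> bilinear (G u)"
    and G_commute: "u \<in> S \<Longrightarrow> G u x y = G u y x"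
    and nondegenerate: "u \<in> S \<Longrightarrow> (\<And>w. G u x w = 0) \<Longrightarrow> x = 0"
    and smooth_G: "smooth_on S (\<lambda>u. G u x y)"
begin

abbreviation dG :: "'v \<Rightarrow> 'v \<Rightarrow> 'v \<Rightarrow> 'v \<Rightarrow> real"
  where "dG u z x y \<equiv> frechet_derivative (\<lambda>u'. G u' x y) (at u) z"

lemma differentiable_G: "u \<in> S \<Longrightarrow> (\<lambda>u. G u x y) differentiable (at u)"
  using smooth_on_differentiable[OF smooth_G] .

lemma has_derivative_G: "u \<in> S \<Longrightarrow> ((\<lambda>u. G u x y) has_derivative (\<lambda>z. dG u z x y)) (at u)"
  using smooth_on_has_derivative[OF smooth_G] .

lemma linear_dG: "u \<in> S \<Longrightarrow> linear (\<lambda>z. dG u z x y)"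
  using smooth_on_linear_frechet[OF smooth_G] .

lemma bilinear_dG: "u \<in> S \<Longrightarrow> bilinear (dG u z)"
  by (rule bilinear_frechet_param[OF open_S _ bilinear_G differentiable_G])

lemma dG_commute:
  assumes "u \<in> S"
  shows "dG u z x y = dG u z y x"
proof -
  have "((\<lambda>u. G u x y) has_derivative (\<lambda>z. dG u z y x)) (at u)"
    by (rule has_derivative_transform_within_open[OF has_derivative_G open_S])
       (use assms G_commute in auto)
  then show ?thesis by (simp add: frechet_derivative_eq)
qed

lemma linear_koszul: "u \<in> S \<Longrightarrow> linear (koszul G u x y)"
  using bilinear_dG[of u x] bilinear_dG[of u y] linear_dG[of u x y]
  unfolding koszul_def bilinear_def by (auto intro!: linear_compose_sub linear_compose_add)

lemma representation: "u \<in> S \<Longrightarrow> linear l \<Longrightarrow> \<exists>!z. \<forall>w. G u z w = l w"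
  by (rule nondegenerate_representation) (auto intro: bilinear_G nondegenerate)

lemma G_eqI: "u \<in> S \<Longrightarrow> (\<And>w. G u x w = G u y w) \<Longrightarrow> x = y"
  using nondegenerate[of u "x - y"] by (simp add: bilinear_lsub[OF bilinear_G])

text \<open>Nondegeneracy makes the definite description in \<open>christoffel\<close> well
  defined.\<close>

lemma christoffel_koszul:
  assumes "u \<in> S"
  shows "2 * G u (christoffel G u x y) w = koszul G u x y w"
proof -
  have "linear (\<lambda>w. koszul G u x y w / 2)"
    by (rule linearI) (simp_all add: linear_add[OF linear_koszul[OF assms]] linear_scale[OF linear_koszul[OF assms]] add_divide_distrib)
  from representation[OF assms this] have "\<exists>!z. \<forall>w. 2 * G u z w = koszul G u x y w"
    by (simp add: field_simps)
  then have "\<forall>w. 2 * G u (christoffel G u x y) w = koszul G u x y w"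
    unfolding christoffel_def koszul_def[symmetric] by (rule theI')
  then show ?thesis by blast
qed

lemma christoffel_eqI:
  assumes "u \<in> S" "\<And>w. 2 * G u z w = koszul G u x y w"
  shows "christoffel G u x y = z"
proof (rule G_eqI[OF assms(1)])
  fix w show "G u (christoffel G u x y) w = G u z w"
    using christoffel_koszul[OF assms(1), of x y w] assms(2)[of w] by linarith
qed

lemma bilinear_christoffel:
  assumes u: "u \<in> S"
  shows "bilinear (christoffel G u)"
  unfolding bilinear_def
  by (intro conjI allI linearI; rule christoffel_eqI[OF u])
     (simp_all add: algebra_simps bilinear_ladd[OF bilinear_G[OF u]] bilinear_lmul[OF bilinear_G[OF u]]
       christoffel_koszul[OF u] mult.left_commute[of 2],
      simp_all add: koszul_def bilinear_ladd[OF bilinear_dG[OF u]] bilinear_lmul[OF bilinear_dG[OF u]]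
        bilinear_radd[OF bilinear_dG[OF u]] bilinear_rmul[OF bilinear_dG[OF u]]
        linear_add[OF linear_dG[OF u]] linear_scale[OF linear_dG[OF u]] algebra_simps)

lemma christoffel_commute: "u \<in> S \<Longrightarrow> christoffel G u x y = christoffel G u y x"
  by (rule christoffel_eqI) (simp_all add: christoffel_koszul koszul_def dG_commute[where x=y and y=x])

text \<open>Compatibility of the symbols with the metric: in the sum of two Koszul expressions all
  but the derivative in the direction \<open>z\<close> cancel.\<close>

lemma dG_christoffel:
  "u \<in> S \<Longrightarrow> dG u z x y = G u (christoffel G u z x) y + G u x (christoffel G u z y)"
  using christoffel_koszul[of u z x y] christoffel_koszul[of u z y x]
  by (simp add: koszul_def dG_commute[where x=x and y=y] dG_commute[where x=z and y=y] dG_commute[where x=z and y=x] G_commute[of _ x])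

text \<open>The product rule yields the derivative of the metric along \<open>\<phi>\<close> and two
  terms with second derivatives of \<open>\<phi>\<close>. It serves both the transformation law of
  Christoffel symbols and the chart independence of the complete lift metric.\<close>

lemma derivative_pullback:
  fixes \<phi> :: "'w::euclidean_space \<Rightarrow> 'v"
  assumes T: "open T" "u \<in> T" "\<phi> ` T \<subseteq> S" and \<phi>: "smooth_on T \<phi>"
    and H: "\<And>u x y. u \<in> T \<Longrightarrow> H u x y = G (\<phi> u) (frechet_derivative \<phi> (at u) x) (frechet_derivative \<phi> (at u) y)"
  shows "frechet_derivative (\<lambda>u. H u x y) (at u) z =
     dG (\<phi> u) (frechet_derivative \<phi> (at u) z) (frechet_derivative \<phi> (at u) x) (frechet_derivative \<phi> (at u) y)
     + G (\<phi> u) (frechet_derivative (\<lambda>u. frechet_derivative \<phi> (at u) x) (at u) z) (frechet_derivative \<phi> (at u) y)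
     + G (\<phi> u) (frechet_derivative \<phi> (at u) x) (frechet_derivative (\<lambda>u. frechet_derivative \<phi> (at u) y) (at u) z)"
proof -
  have D\<phi>: "(\<phi> has_derivative frechet_derivative \<phi> (at u)) (at u)"
    using smooth_on_has_derivative[OF \<phi> T(2)] .
  have G\<phi>: "((\<lambda>u. G (\<phi> u) x y) has_derivative (\<lambda>z. dG (\<phi> u) (frechet_derivative \<phi> (at u) z) x y)) (at u)" for x y
    using T by (intro has_derivative_compose[OF D\<phi>] has_derivative_G) auto
  have D: "((\<lambda>u. frechet_derivative \<phi> (at u) x) has_derivative frechet_derivative (\<lambda>u. frechet_derivative \<phi> (at u) x) (at u)) (at u)" for x
    using smooth_on_has_derivative[OF smooth_on_frechet[OF \<phi>] T(2)] .
  have "((\<lambda>u. G (\<phi> u) (frechet_derivative \<phi> (at u) x) (frechet_derivative \<phi> (at u) y)) has_derivative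
    (\<lambda>z. frechet_derivative (\<lambda>v. G (\<phi> v) (frechet_derivative \<phi> (at u) x) (frechet_derivative \<phi> (at u) y)) (at u) z
     + G (\<phi> u) (frechet_derivative (\<lambda>u. frechet_derivative \<phi> (at u) x) (at u) z) (frechet_derivative \<phi> (at u) y)
     + G (\<phi> u) (frechet_derivative \<phi> (at u) x) (frechet_derivative (\<lambda>u. frechet_derivative \<phi> (at u) y) (at u) z))) (at u)"
    by (rule has_derivative_apply_bilinear[OF T(1,2) _ _ D D])
       (use T bilinear_G differentiableI[OF G\<phi>] in auto)
  then have "((\<lambda>u. H u x y) has_derivative
    (\<lambda>z. dG (\<phi> u) (frechet_derivative \<phi> (at u) z) (frechet_derivative \<phi> (at u) x) (frechet_derivative \<phi> (at u) y)
     + G (\<phi> u) (frechet_derivative (\<lambda>u. frechet_derivative \<phi> (at u) x) (at u) z) (frechet_derivative \<phi> (at u) y)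
     + G (\<phi> u) (frechet_derivative \<phi> (at u) x) (frechet_derivative (\<lambda>u. frechet_derivative \<phi> (at u) y) (at u) z))) (at u)"
    unfolding frechet_derivative_eq[OF G\<phi>]
    by (rule has_derivative_transform_within_open[OF _ T(1,2)]) (simp add: H)
  then show ?thesis by (simp add: frechet_derivative_eq)
qed

end

text \<open>The inhomogeneous transformation law. Of the six second-derivative terms in the Koszul
  expression four cancel by symmetry and two coincide; surjectivity of the derivative allows testing
  against vectors in its image.\<close>

lemma christoffel_pullback:
  fixes \<phi> :: "'v::euclidean_space \<Rightarrow> 'v"
  assumes "local_metric S G" "local_metric S' H"
    and T: "open T" "u \<in> T" "\<phi> ` T \<subseteq> S" "T \<subseteq> S'" and \<phi>: "smooth_on T \<phi>"
    and H: "\<And>u x y. u \<in> T \<Longrightarrow> H u x y = G (\<phi> u) (frechet_derivative \<phi> (at u) x) (frechet_derivative \<phi> (at u) y)"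
    and surj: "surj (frechet_derivative \<phi> (at u))"
  shows "frechet_derivative \<phi> (at u) (christoffel H u x y) =
    christoffel G (\<phi> u) (frechet_derivative \<phi> (at u) x) (frechet_derivative \<phi> (at u) y)
    + frechet_derivative (\<lambda>u. frechet_derivative \<phi> (at u) y) (at u) x"
proof -
  interpret G: local_metric S G by fact
  interpret H: local_metric S' H by fact
  let ?D = "frechet_derivative \<phi> (at u)"
  let ?D2 = "\<lambda>x y. frechet_derivative (\<lambda>u. frechet_derivative \<phi> (at u) y) (at u) x"
  have \<phi>u: "\<phi> u \<in> S" "u \<in> S'" using T by auto
  note dH = G.derivative_pullback[OF T(1,2,3) \<phi> H, simplified]
  have D2: "?D2 x y = ?D2 y x" for x y
    by (rule second_derivative_symmetric[OF T(1,2) \<phi>])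
  have K: "koszul H u x y w = koszul G (\<phi> u) (?D x) (?D y) (?D w) + 2 * G (\<phi> u) (?D2 x y) (?D w)" for w
    unfolding koszul_def dH
    by (simp add: D2[of y x] D2[of w x] D2[of w y] G.G_commute[OF \<phi>u(1), of "?D x"] G.G_commute[OF \<phi>u(1), of "?D y"])
  show ?thesis
  proof (rule G.G_eqI[OF \<phi>u(1)])
    fix z
    obtain w where w: "z = ?D w" using surj by (metis surjD)
    have "2 * G (\<phi> u) (?D (christoffel H u x y)) z = koszul H u x y w"
      unfolding w using H[OF T(2)] H.christoffel_koszul[OF \<phi>u(2)] by metis
    then show "G (\<phi> u) (?D (christoffel H u x y)) z = G (\<phi> u) (christoffel G (\<phi> u) (?D x) (?D y) + ?D2 x y) z"
      unfolding w K using G.christoffel_koszul[OF \<phi>u(1), of "?D x" "?D y" "?D w"]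
      by (simp add: bilinear_ladd[OF G.bilinear_G[OF \<phi>u(1)]])
  qed
qed

section \<open>Tensor fields in charts and the Levi-Civita connection\<close>

definition endo_chart ::
    "('a, 'v::euclidean_space) chart set \<Rightarrow> ('a, 'v) endo \<Rightarrow> ('a, 'v) chart \<Rightarrow> 'v \<Rightarrow> 'v \<Rightarrow> 'v"
  where "endo_chart A T c u x = T (chart_inv c u) (of_chart A c (chart_inv c u) x) c"

context manifold
begin

text \<open>Differentiating the relation between the components of \<open>X\<close> in the two
  charts gives the Jacobian term and a second derivative of the transition. The latter is symmetric
  in \<open>X p\<close> and \<open>v\<close>: it drops out of the Lie bracket, and it cancels the
  inhomogeneous term of the Christoffel symbols.\<close>

lemma field_change:
  assumes c: "c \<in> charts_at A p" and d: "d \<in> charts_at A p" and X: "vector_field A X" and v: "v \<in> tangent_space A p"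
  shows "frechet_derivative (\<lambda>u. X (chart_inv d u) d) (at (snd d p)) (v d) =
    frechet_derivative (\<lambda>u. frechet_derivative (transition c d) (at u) (X p c)) (at (snd c p)) (v c)
    + jacobian c d p (frechet_derivative (\<lambda>u. X (chart_inv c u) c) (at (snd c p)) (v c))"
proof -
  have A: "c \<in> A" "d \<in> A" "p \<in> fst c" "p \<in> fst d" using c d by (auto simp: charts_at_iff)
  let ?\<phi> = "transition c d" and ?u = "snd c p"
  let ?S = "overlap c d"
  have S: "open ?S" "?u \<in> ?S" using open_overlap[OF A(1,2)] snd_overlap[OF c d] .
  have Xd: "((\<lambda>u. X (chart_inv d u) d) has_derivative frechet_derivative (\<lambda>u. X (chart_inv d u) d) (at (snd d p))) (at (snd d p))"
    using vector_field_smooth[OF X A(2)] A by (intro smooth_on_has_derivative[of "chart_img d"]) auto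
  have Xc: "((\<lambda>u. X (chart_inv c u) c) has_derivative frechet_derivative (\<lambda>u. X (chart_inv c u) c) (at ?u)) (at ?u)"
    using vector_field_smooth[OF X A(1)] A by (intro smooth_on_has_derivative[of "chart_img c"]) auto
  have "((\<lambda>u. X (chart_inv d (?\<phi> u)) d) has_derivative
      (\<lambda>w. frechet_derivative (\<lambda>u. X (chart_inv d u) d) (at (snd d p)) (jacobian c d p w))) (at ?u)"
    using Xd A by (intro has_derivative_compose[OF transition_has_derivative[OF c d], of "\<lambda>u. X (chart_inv d u) d"])
      (simp add: transition_snd)
  moreover have "((\<lambda>u. frechet_derivative ?\<phi> (at u) (X (chart_inv c u) c)) has_derivative
      (\<lambda>w. frechet_derivative (\<lambda>u. frechet_derivative ?\<phi> (at u) (X (chart_inv c ?u) c)) (at ?u) w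
        + frechet_derivative ?\<phi> (at ?u) (frechet_derivative (\<lambda>u. X (chart_inv c u) c) (at ?u) w))) (at ?u)"
    by (rule has_derivative_apply_linear[OF S _ _ Xc])
       (use smooth_transition[OF A(1,2)] S in \<open>auto intro: smooth_on_linear_frechet smooth_on_differentiable smooth_on_frechet\<close>)
  then have "((\<lambda>u. X (chart_inv d (?\<phi> u)) d) has_derivative
      (\<lambda>w. frechet_derivative (\<lambda>u. frechet_derivative ?\<phi> (at u) (X p c)) (at ?u) w
        + jacobian c d p (frechet_derivative (\<lambda>u. X (chart_inv c u) c) (at ?u) w))) (at ?u)"
    unfolding jacobian_def
  proof (rule has_derivative_transform_within_open[OF _ S, THEN has_derivative_eq_rhs])
    fix u assume u: "u \<in> ?S"
    then have q: "c \<in> charts_at A (chart_inv c u)" "d \<in> charts_at A (chart_inv c u)"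
      using A by (auto simp: charts_at_iff overlap_iff)
    show "frechet_derivative ?\<phi> (at u) (X (chart_inv c u) c) = X (chart_inv d (?\<phi> u)) d"
      using transition_mem[OF A(1,2) u] u A tangent_apply[OF vector_field_tangent[OF X charts_at_points[OF q(1)]] q]
      by (simp add: jacobian_def overlap_iff)
  qed (use A in simp)
  ultimately have "(\<lambda>w. frechet_derivative (\<lambda>u. X (chart_inv d u) d) (at (snd d p)) (jacobian c d p w)) =
     (\<lambda>w. frechet_derivative (\<lambda>u. frechet_derivative ?\<phi> (at u) (X p c)) (at ?u) w
        + jacobian c d p (frechet_derivative (\<lambda>u. X (chart_inv c u) c) (at ?u) w))"
    by (rule has_derivative_unique)
  from fun_cong[OF this, of "v c"] show ?thesis
    using tangent_apply[OF v c d] by simp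
qed

lemma vector_field_has_derivative:
  assumes "vector_field A X" "c \<in> charts_at A p"
  shows "((\<lambda>u. X (chart_inv c u) c) has_derivative
    frechet_derivative (\<lambda>u. X (chart_inv c u) c) (at (snd c p))) (at (snd c p))"
  using vector_field_smooth[OF assms(1)] assms(2)
  by (intro smooth_on_has_derivative[of "chart_img c"]) (auto simp: charts_at_iff)

lemma lie_bracket_chart:
  "c \<in> charts_at A p \<Longrightarrow> lie_bracket A X Y p c =
      frechet_derivative (\<lambda>u. Y (chart_inv c u) c) (at (snd c p)) (X p c)
    - frechet_derivative (\<lambda>u. X (chart_inv c u) c) (at (snd c p)) (Y p c)"
  by (simp add: lie_bracket_def)

lemma lie_bracket_tangent:
  assumes X: "vector_field A X" and Y: "vector_field A Y" and p: "p \<in> points A"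
  shows "lie_bracket A X Y p \<in> tangent_space A p"
proof (rule tangentI)
  fix c d assume c: "c \<in> charts_at A p" and d: "d \<in> charts_at A p"
  note XY = vector_field_tangent[OF X p] vector_field_tangent[OF Y p]
  have A: "c \<in> A" "d \<in> A" using c d by (auto simp: charts_at_iff)
  have "frechet_derivative (\<lambda>u. frechet_derivative (transition c d) (at u) (X p c)) (at (snd c p)) (Y p c) =
    frechet_derivative (\<lambda>u. frechet_derivative (transition c d) (at u) (Y p c)) (at (snd c p)) (X p c)"
    by (rule second_derivative_symmetric[OF open_overlap[OF A] snd_overlap[OF c d] smooth_transition[OF A]])
  then show "lie_bracket A X Y p d = jacobian c d p (lie_bracket A X Y p c)"
    using field_change[OF c d X XY(2)] field_change[OF c d Y XY(1)]
    by (simp add: lie_bracket_chart c d linear_diff[OF linear_jacobian[OF c d]])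
qed (simp add: lie_bracket_def)

text \<open>With coefficients that are constant in a chart, the directional derivatives of
  \<open>\<Omega>\<close> only involve derivatives of the fields, and skew symmetry cancels these
  against the brackets.\<close>

lemma closed_2formI:
  assumes B: "\<And>c. c \<in> A \<Longrightarrow> bilinear (B c)" "\<And>c x y. c \<in> A \<Longrightarrow> B c x y = - B c y x"
    and \<Omega>: "\<And>c p v w. c \<in> charts_at A p \<Longrightarrow> v \<in> tangent_space A p \<Longrightarrow> w \<in> tangent_space A p \<Longrightarrow>
      \<Omega> p v w = B c (v c) (w c)"
  shows "closed_2form A \<Omega>"
  unfolding closed_2form_def
proof (intro allI impI ballI)
  fix X Y Z p assume XYZ: "vector_field A X" "vector_field A Y" "vector_field A Z" and p: "p \<in> points A"
  obtain c where c: "c \<in> charts_at A p" using p points_iff by blast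
  have cA: "c \<in> A" "p \<in> fst c" using c by (auto simp: charts_at_iff)
  let ?d = "\<lambda>X Y. frechet_derivative (\<lambda>u. X (chart_inv c u) c) (at (snd c p)) (Y p c)"
  have T: "X q \<in> tangent_space A q" if "vector_field A X" "c \<in> charts_at A q" for X q
    using vector_field_tangent[OF that(1) charts_at_points[OF that(2)]] .
  have D: "dir_deriv A p v (\<lambda>q. \<Omega> q (X q) (Y q)) =
      B c (frechet_derivative (\<lambda>u. X (chart_inv c u) c) (at (snd c p)) (v c)) (Y p c)
      + B c (X p c) (frechet_derivative (\<lambda>u. Y (chart_inv c u) c) (at (snd c p)) (v c))"
    if X: "vector_field A X" and Y: "vector_field A Y" and v: "v \<in> tangent_space A p" for X Y v
  proof -
    have eq: "\<Omega> (chart_inv c u) (X (chart_inv c u)) (Y (chart_inv c u)) = B c (X (chart_inv c u) c) (Y (chart_inv c u) c)"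
      if "u \<in> chart_img c" for u
      using that cA T[OF X] T[OF Y] by (intro \<Omega>) auto
    have "smooth_on (chart_img c) (\<lambda>u. B c (X (chart_inv c u) c) (Y (chart_inv c u) c))"
      by (rule smooth_on_apply_bilinear[of _ "\<lambda>_. B c"]) (simp_all add: open_chart_img cA B(1) vector_field_smooth X Y)
    then have "smooth_on (chart_img c) (\<lambda>u. \<Omega> (chart_inv c u) (X (chart_inv c u)) (Y (chart_inv c u)))"
      by (subst smooth_on_cong[OF open_chart_img[OF cA(1)] eq])
    then have "smooth_at A (\<lambda>q. \<Omega> q (X q) (Y q)) p"
      by (rule smooth_at_of_chart[OF c])
    moreover have "((\<lambda>u. B c (X (chart_inv c u) c) (Y (chart_inv c u) c)) has_derivative
      (\<lambda>w. frechet_derivative (\<lambda>u. B c (X (chart_inv c (snd c p)) c) (Y (chart_inv c (snd c p)) c)) (at (snd c p)) w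
        + B c (frechet_derivative (\<lambda>u. X (chart_inv c u) c) (at (snd c p)) w) (Y (chart_inv c (snd c p)) c)
        + B c (X (chart_inv c (snd c p)) c) (frechet_derivative (\<lambda>u. Y (chart_inv c u) c) (at (snd c p)) w))) (at (snd c p))"
      by (rule has_derivative_apply_bilinear[OF open_chart_img[OF cA(1)] snd_chart_img[OF cA(2)], of "\<lambda>_. B c",
            OF _ _ vector_field_has_derivative[OF X c] vector_field_has_derivative[OF Y c]])
         (simp_all add: cA B(1))
    then have "((\<lambda>u. \<Omega> (chart_inv c u) (X (chart_inv c u)) (Y (chart_inv c u))) has_derivative
      (\<lambda>w. B c (frechet_derivative (\<lambda>u. X (chart_inv c u) c) (at (snd c p)) w) (Y p c)
        + B c (X p c) (frechet_derivative (\<lambda>u. Y (chart_inv c u) c) (at (snd c p)) w))) (at (snd c p))"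
      by (rule has_derivative_transform_within_open[OF _ open_chart_img[OF cA(1)] snd_chart_img[OF cA(2)],
            THEN has_derivative_eq_rhs]) (simp_all add: cA eq)
    ultimately show ?thesis
      by (simp add: dir_deriv_chart[OF c v] frechet_derivative_eq)
  qed
  note t = T[OF XYZ(1) c] T[OF XYZ(2) c] T[OF XYZ(3) c]
  note l = lie_bracket_tangent[OF XYZ(1,2) p] lie_bracket_tangent[OF XYZ(1,3) p] lie_bracket_tangent[OF XYZ(2,3) p]
  show "dir_deriv A p (X p) (\<lambda>q. \<Omega> q (Y q) (Z q)) - dir_deriv A p (Y p) (\<lambda>q. \<Omega> q (X q) (Z q))
        + dir_deriv A p (Z p) (\<lambda>q. \<Omega> q (X q) (Y q)) - \<Omega> p (lie_bracket A X Y p) (Z p)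
        + \<Omega> p (lie_bracket A X Z p) (Y p) - \<Omega> p (lie_bracket A Y Z p) (X p) = 0"
    by (simp add: D XYZ t \<Omega>[OF c] l lie_bracket_chart[OF c] bilinear_lsub[OF B(1)[OF cA(1)]]
        B(2)[OF cA(1), of "X p c"] B(2)[OF cA(1), of "Y p c" "?d Z X"])
qed

end

text \<open>Asks for symmetry and nondegeneracy, so that it is available on the cotangent bundle
  before the index of the metric is computed.\<close>

locale metric_manifold = manifold A for A :: "('a, 'v::euclidean_space) chart set" +
  fixes g :: "('a, 'v) bilin"
  assumes metric: "symmetric_tensor02 A g"
    and nondegenerate: "p \<in> points A \<Longrightarrow> v \<in> tangent_space A p \<Longrightarrow>
      (\<And>w. w \<in> tangent_space A p \<Longrightarrow> g p v w = 0) \<Longrightarrow> v = 0"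
begin

abbreviation G :: "('a, 'v) chart \<Rightarrow> 'v \<Rightarrow> 'v \<Rightarrow> 'v \<Rightarrow> real"
  where "G c \<equiv> in_chart A g c"

lemma g_chart:
  assumes "c \<in> charts_at A p" "v \<in> tangent_space A p" "w \<in> tangent_space A p"
  shows "g p v w = G c (snd c p) (v c) (w c)"
  using assms by (auto simp: in_chart_def charts_at_iff[of c])

lemma local_metric_chart:
  assumes c: "c \<in> A"
  shows "local_metric (chart_img c) (G c)"
proof
  show "open (chart_img c)" using open_chart_img[OF c] .
  fix u x y assume u: "u \<in> chart_img c"
  let ?p = "chart_inv c u"
  have p: "?p \<in> points A" "c \<in> charts_at A ?p" using u c by auto
  have t: "of_chart A c ?p x \<in> tangent_space A ?p" for x using of_chart_tangent[OF p(2)] .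
  have lin: "linear_on (tangent_space A ?p) (g ?p v)" "linear_on (tangent_space A ?p) (\<lambda>w. g ?p w v)"
    if "v \<in> tangent_space A ?p" for v
    using metric p that unfolding symmetric_tensor02_def tensor02_def by blast+
  show "bilinear (G c u)"
    unfolding bilinear_def in_chart_def
    using linear_on_of_chart[OF lin(1)[OF t] p(2)] linear_on_of_chart[OF lin(2)[OF t] p(2)] by blast
  show "G c u x y = G c u y x"
    using metric p t unfolding symmetric_tensor02_def in_chart_def by blast
  show "x = 0" if *: "\<And>w. G c u x w = 0"
  proof -
    have "of_chart A c ?p x = 0"
    proof (rule nondegenerate[OF p(1) t])
      fix w assume "w \<in> tangent_space A ?p"
      then show "g ?p (of_chart A c ?p x) w = 0"
        using *[of "w c"] p by (simp add: in_chart_def)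
    qed
    then show ?thesis using of_chart_self[OF p(2), of x] by (metis zero_fun_apply)
  qed
next
  show "smooth_on (chart_img c) (\<lambda>u. G c u x y)" for x y
    using metric c unfolding symmetric_tensor02_def tensor02_def by blast
qed

lemma G_change:
  assumes "c \<in> A" "d \<in> A" "u \<in> overlap c d"
  shows "G c u x y = G d (transition c d u) (frechet_derivative (transition c d) (at u) x)
    (frechet_derivative (transition c d) (at u) y)"
proof -
  let ?p = "chart_inv c u"
  have p: "c \<in> charts_at A ?p" "d \<in> charts_at A ?p" "snd c ?p = u"
    using assms by (auto simp: charts_at_iff overlap_iff)
  show ?thesis
    using transition_mem[OF assms] of_chart_change[OF p(1,2)]
    by (simp add: in_chart_def jacobian_def p)
qed

text \<open>The coordinate formula is used in all charts around \<open>p\<close> simultaneously, in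
  line with the encoding of tangent vectors; that the values belong to one tangent vector is then a
  theorem.\<close>

definition LC :: "('a, 'v) connection"
  where "LC p v X = (\<lambda>c. if c \<in> charts_at A p then
    frechet_derivative (\<lambda>u. X (chart_inv c u) c) (at (snd c p)) (v c)
    + christoffel (G c) (snd c p) (v c) (X p c) else 0)"

lemma LC_chart:
  "c \<in> charts_at A p \<Longrightarrow> LC p v X c = frechet_derivative (\<lambda>u. X (chart_inv c u) c) (at (snd c p)) (v c)
    + christoffel (G c) (snd c p) (v c) (X p c)"
  by (simp add: LC_def)

text \<open>Second derivatives of the transition appear with opposite signs in the change of the
  derivative of \<open>X\<close> and in the change of the Christoffel symbols.\<close>

lemma LC_tangent:
  assumes p: "p \<in> points A" and X: "vector_field A X" and v: "v \<in> tangent_space A p"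
  shows "LC p v X \<in> tangent_space A p"
proof (rule tangentI)
  fix c d assume c: "c \<in> charts_at A p" and d: "d \<in> charts_at A p"
  have A: "c \<in> A" "d \<in> A" "p \<in> fst c" using c d by (auto simp: charts_at_iff)
  have im: "transition c d ` overlap c d \<subseteq> chart_img d"
    using transition_mem(1)[OF A(1,2)] overlap_subset[of d c] by blast
  have surj: "surj (jacobian c d p)"
    by (rule surjI[of _ "jacobian d c p"]) (simp add: c d)
  have "jacobian c d p (christoffel (G c) (snd c p) (v c) (X p c)) =
     christoffel (G d) (snd d p) (jacobian c d p (v c)) (jacobian c d p (X p c))
     + frechet_derivative (\<lambda>u. frechet_derivative (transition c d) (at u) (X p c)) (at (snd c p)) (v c)"
    using christoffel_pullback[OF local_metric_chart[OF A(2)] local_metric_chart[OF A(1)]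
        open_overlap[OF A(1,2)] snd_overlap[OF c d] im overlap_subset smooth_transition[OF A(1,2)], of "v c" "X p c"]
      surj G_change[OF A(1,2)] transition_snd[OF A(1,3), of d]
    by (auto simp: jacobian_def)
  then show "LC p v X d = jacobian c d p (LC p v X c)"
    using tangent_apply[OF v c d] tangent_apply[OF vector_field_tangent[OF X p] c d] field_change[OF c d X v]
    by (simp add: LC_chart c d linear_add[OF linear_jacobian[OF c d]])
qed (simp add: LC_def)

text \<open>Linearity and the Leibniz rule hold in each chart, torsion vanishes by symmetry of the
  symbols, and metric compatibility is \<open>dG_christoffel\<close>. Smoothness of the symbols
  enters as a hypothesis, to be met by an explicit formula for the metric at hand.\<close>

theorem levi_civita_LC:
  assumes smooth: "\<And>c x y. c \<in> A \<Longrightarrow> smooth_on (chart_img c) (\<lambda>u. christoffel (G c) u x y)"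
  shows "levi_civita A g LC"
proof -
  have bil: "bilinear (christoffel (G c) (snd c p))" if "c \<in> charts_at A p" for c p
    using local_metric.bilinear_christoffel[OF local_metric_chart] that by (simp add: charts_at_iff)
  have X_der: "((\<lambda>u. X (chart_inv c u) c) has_derivative frechet_derivative (\<lambda>u. X (chart_inv c u) c) (at (snd c p))) (at (snd c p))"
    if "c \<in> charts_at A p" "vector_field A X" for X c p
    using vector_field_has_derivative that by blast
  have lin: "linear (frechet_derivative (\<lambda>u. X (chart_inv c u) c) (at (snd c p)))"
    if "c \<in> charts_at A p" "vector_field A X" for X c p
    using has_derivative_linear[OF X_der[OF that]] .
  have LC_off: "LC p v X c = 0" if "c \<notin> charts_at A p" for p v X c using that by (simp add: LC_def)
  have "linear_connection A LC"
    unfolding linear_connection_def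
  proof (intro conjI allI impI ballI)
    fix X Z assume X: "vector_field A X" and Z: "vector_field A Z"
    show "vector_field A (\<lambda>p. LC p (Z p) X)"
      unfolding vector_field_def
    proof (intro conjI ballI)
      fix c assume c: "c \<in> A"
      let ?Z = "\<lambda>u. Z (chart_inv c u) c" and ?X = "\<lambda>u. X (chart_inv c u) c"
      have "smooth_on (chart_img c) (\<lambda>u. frechet_derivative ?X (at u) (?Z u) + christoffel (G c) u (?Z u) (?X u))"
      proof (rule smooth_on_add[OF open_chart_img[OF c]])
        show "smooth_on (chart_img c) (\<lambda>u. frechet_derivative ?X (at u) (?Z u))"
          by (rule smooth_on_frechet_apply) (simp_all add: open_chart_img c vector_field_smooth X Z)
        show "smooth_on (chart_img c) (\<lambda>u. christoffel (G c) u (?Z u) (?X u))"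
          by (rule smooth_on_apply_bilinear[of _ "christoffel (G c)"])
             (simp_all add: open_chart_img c vector_field_smooth X Z smooth
               local_metric.bilinear_christoffel[OF local_metric_chart])
      qed
      then show "smooth_on (chart_img c) (\<lambda>u. LC (chart_inv c u) (Z (chart_inv c u)) X c)"
        by (subst smooth_on_cong[OF open_chart_img[OF c]]) (auto simp: LC_chart c)
    qed (intro LC_tangent vector_field_tangent X Z)
  next
    fix p X assume p: "p \<in> points A" and X: "vector_field A X"
    show "linear_on (tangent_space A p) (\<lambda>v. LC p v X)"
      unfolding linear_on_def
    proof (intro ballI allI ext)
      fix v w r s c assume "v \<in> tangent_space A p" "w \<in> tangent_space A p"
      show "LC p (r *\<^sub>R v + s *\<^sub>R w) X c = (r *\<^sub>R LC p v X + s *\<^sub>R LC p w X) c"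
      proof (cases "c \<in> charts_at A p")
        case True
        then show ?thesis
          by (simp add: LC_chart scaleR_fun_apply linear_add[OF lin[OF True X]] linear_scale[OF lin[OF True X]]
              bilinear_ladd[OF bil] bilinear_lmul[OF bil] scaleR_add_right)
      qed (simp add: LC_off scaleR_fun_apply)
    qed
    show "LC p v X \<in> tangent_space A p" if "v \<in> tangent_space A p" for v
      using LC_tangent[OF p X that] .
  next
    fix p v X Y assume "p \<in> points A" "v \<in> tangent_space A p" and X: "vector_field A X" and Y: "vector_field A Y"
    show "LC p v (\<lambda>q. X q + Y q) = LC p v X + LC p v Y"
    proof
      fix c show "LC p v (\<lambda>q. X q + Y q) c = (LC p v X + LC p v Y) c"
      proof (cases "c \<in> charts_at A p")
        case True
        then show ?thesis
          using frechet_derivative_eq[OF has_derivative_add[OF X_der[OF True X] X_der[OF True Y]]]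
          by (simp add: LC_chart bilinear_radd[OF bil])
      qed (simp add: LC_off)
    qed
  next
    fix p v f X assume p: "p \<in> points A" and v: "v \<in> tangent_space A p" and f: "smooth_fun A f" and X: "vector_field A X"
    show "LC p v (\<lambda>q. f q *\<^sub>R X q) = dir_deriv A p v f *\<^sub>R X p + f p *\<^sub>R LC p v X"
    proof
      fix c show "LC p v (\<lambda>q. f q *\<^sub>R X q) c = (dir_deriv A p v f *\<^sub>R X p + f p *\<^sub>R LC p v X) c"
      proof (cases "c \<in> charts_at A p")
        case True
        then have c: "c \<in> A" "p \<in> fst c" by (auto simp: charts_at_iff)
        have fp: "smooth_at A f p" using f p by (simp add: smooth_fun_iff)
        have "smooth_on (chart_img c) (\<lambda>u. f (chart_inv c u))"
          using f c unfolding smooth_fun_def comp_def by blast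
        then have "((\<lambda>u. f (chart_inv c u)) has_derivative frechet_derivative (\<lambda>u. f (chart_inv c u)) (at (snd c p))) (at (snd c p))"
          using c by (intro smooth_on_has_derivative[of "chart_img c"]) auto
        note D = frechet_derivative_eq[OF has_derivative_scaleR[OF this X_der[OF True X]]]
        show ?thesis
          using True c D by (simp add: LC_chart scaleR_fun_apply dir_deriv_chart[OF True v fp] bilinear_rmul[OF bil] scaleR_add_right)
      next
        case False
        then show ?thesis
          using tangent_off[OF vector_field_tangent[OF X p]] by (simp add: LC_off scaleR_fun_apply)
      qed
    qed
  qed
  moreover have "torsion_free A LC"
    unfolding torsion_free_def
  proof (intro allI impI ballI ext)
    fix X Y p c assume "vector_field A X" "vector_field A Y" "p \<in> points A"
    show "(LC p (X p) Y - LC p (Y p) X) c = lie_bracket A X Y p c"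
    proof (cases "c \<in> charts_at A p")
      case True
      then show ?thesis
        using local_metric.christoffel_commute[OF local_metric_chart, of c "snd c p" "X p c" "Y p c"]
        by (simp add: LC_chart lie_bracket_chart charts_at_iff)
    qed (simp add: LC_off lie_bracket_def)
  qed
  moreover have "dir_deriv A p v (\<lambda>q. g q (X q) (Y q)) = g p (LC p v X) (Y p) + g p (X p) (LC p v Y)"
    if X: "vector_field A X" and Y: "vector_field A Y" and p: "p \<in> points A" and v: "v \<in> tangent_space A p" for X Y p v
  proof -
    obtain c where c: "c \<in> charts_at A p" using p points_iff by blast
    have cA: "c \<in> A" "p \<in> fst c" using c by (auto simp: charts_at_iff)
    interpret L: local_metric "chart_img c" "G c" by (rule local_metric_chart[OF cA(1)])
    let ?X = "\<lambda>u. X (chart_inv c u) c" and ?Y = "\<lambda>u. Y (chart_inv c u) c" and ?u = "snd c p"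
    have u: "?u \<in> chart_img c" using cA by simp
    have eq: "g (chart_inv c u) (X (chart_inv c u)) (Y (chart_inv c u)) = G c u (?X u) (?Y u)" if "u \<in> chart_img c" for u
      using that cA X Y by (subst g_chart[of c]) (auto intro: vector_field_tangent)
    have "smooth_on (chart_img c) (\<lambda>u. G c u (?X u) (?Y u))"
      by (rule smooth_on_apply_bilinear[of _ "G c"])
         (simp_all add: L.open_S L.bilinear_G L.smooth_G vector_field_smooth X Y cA)
    then have "smooth_on (chart_img c) (\<lambda>u. g (chart_inv c u) (X (chart_inv c u)) (Y (chart_inv c u)))"
      by (subst smooth_on_cong[OF L.open_S eq])
    then have "smooth_at A (\<lambda>q. g q (X q) (Y q)) p"
      by (rule smooth_at_of_chart[OF c])
    moreover have "((\<lambda>u. G c u (?X u) (?Y u)) has_derivative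
      (\<lambda>w. L.dG ?u w (?X ?u) (?Y ?u) + G c ?u (frechet_derivative ?X (at ?u) w) (?Y ?u)
        + G c ?u (?X ?u) (frechet_derivative ?Y (at ?u) w))) (at ?u)"
      by (rule has_derivative_apply_bilinear[OF L.open_S u L.bilinear_G L.differentiable_G[OF u] X_der[OF c X] X_der[OF c Y]])
    then have "((\<lambda>u. g (chart_inv c u) (X (chart_inv c u)) (Y (chart_inv c u))) has_derivative
      (\<lambda>w. L.dG ?u w (?X ?u) (?Y ?u) + G c ?u (frechet_derivative ?X (at ?u) w) (?Y ?u)
        + G c ?u (?X ?u) (frechet_derivative ?Y (at ?u) w))) (at ?u)"
      by (rule has_derivative_transform_within_open[OF _ L.open_S u]) (simp add: eq)
    ultimately show ?thesis
      using cA by (simp add: dir_deriv_chart[OF c v] frechet_derivative_eq g_chart[OF c] LC_tangent p X Y v vector_field_tangent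
          LC_chart[OF c] L.dG_christoffel[OF u] bilinear_ladd[OF L.bilinear_G[OF u]] bilinear_radd[OF L.bilinear_G[OF u]])
  qed
  ultimately show ?thesis unfolding levi_civita_def by blast
qed

end

context manifold
begin

lemma endo_chart_linear:
  assumes T: "tensor11 A T" and c: "c \<in> A" "u \<in> chart_img c"
  shows "linear (endo_chart A T c u)"
proof -
  have p: "chart_inv c u \<in> points A" "c \<in> charts_at A (chart_inv c u)" using c by auto
  have "linear_on (tangent_space A (chart_inv c u)) (T (chart_inv c u))"
    using T p unfolding tensor11_def by blast
  note * = linear_on_of_chart[OF this p(2)]
  show ?thesis
    by (rule linearI) (simp_all add: endo_chart_def linear_add[OF *] linear_scale[OF *] scaleR_fun_apply)
qed

lemma endo_chart_smooth: "tensor11 A T \<Longrightarrow> c \<in> A \<Longrightarrow> smooth_on (chart_img c) (\<lambda>u. endo_chart A T c u x)"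
  unfolding tensor11_def endo_chart_def by blast

lemma endo_chart:
  "c \<in> charts_at A p \<Longrightarrow> v \<in> tangent_space A p \<Longrightarrow> T p v c = endo_chart A T c (snd c p) (v c)"
  by (simp add: endo_chart_def charts_at_iff[of c])

lemma tensor11_tangent: "tensor11 A T \<Longrightarrow> p \<in> points A \<Longrightarrow> v \<in> tangent_space A p \<Longrightarrow> T p v \<in> tangent_space A p"
  unfolding tensor11_def by blast

end

text \<open>The hypothesis is the vanishing of the coordinate expression of the covariant derivative
  of \<open>T\<close>. The terms with derivatives of \<open>X\<close> appear both in the derivative
  of \<open>T X\<close> and in \<open>T\<close> applied to the derivative of \<open>X\<close>, and
  cancel.\<close>

lemma (in metric_manifold) parallel_LC:
  assumes T: "tensor11 A T"
    and flat: "\<And>c u z x. c \<in> A \<Longrightarrow> u \<in> chart_img c \<Longrightarrow>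
      frechet_derivative (\<lambda>u. endo_chart A T c u x) (at u) z + christoffel (G c) u z (endo_chart A T c u x)
        = endo_chart A T c u (christoffel (G c) u z x)"
  shows "parallel11 A LC T"
  unfolding parallel11_def
proof (intro allI impI ballI)
  fix X p v assume X: "vector_field A X" and p: "p \<in> points A" and v: "v \<in> tangent_space A p"
  have X_at: "X q \<in> tangent_space A q" if "c \<in> charts_at A q" for c q
    using vector_field_tangent[OF X charts_at_points[OF that]] .
  show "LC p v (\<lambda>q. T q (X q)) - T p (LC p v X) = 0"
  proof (rule ext)
    fix c show "(LC p v (\<lambda>q. T q (X q)) - T p (LC p v X)) c = 0 c"
    proof (cases "c \<in> charts_at A p")
      case True
      then have cA: "c \<in> A" "p \<in> fst c" by (auto simp: charts_at_iff)
      let ?T = "endo_chart A T c" and ?X = "\<lambda>u. X (chart_inv c u) c" and ?u = "snd c p"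
      have u: "?u \<in> chart_img c" using cA by simp
      have "((\<lambda>u. ?T u (?X u)) has_derivative (\<lambda>w. frechet_derivative (\<lambda>u. ?T u (?X ?u)) (at ?u) w
        + ?T ?u (frechet_derivative ?X (at ?u) w))) (at ?u)"
        by (rule has_derivative_apply_linear[OF open_chart_img[OF cA(1)] u endo_chart_linear[OF T cA(1)]
              smooth_on_differentiable[OF endo_chart_smooth[OF T cA(1)] u] vector_field_has_derivative[OF X True]])
      then have "((\<lambda>u. T (chart_inv c u) (X (chart_inv c u)) c) has_derivative (\<lambda>w. frechet_derivative (\<lambda>u. ?T u (?X ?u)) (at ?u) w
        + ?T ?u (frechet_derivative ?X (at ?u) w))) (at ?u)"
        by (rule has_derivative_transform_within_open[OF _ open_chart_img[OF cA(1)] u])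
           (simp_all add: cA endo_chart[of c _ _ T] X_at[of c])
      then show ?thesis
        using flat[OF cA(1) u, of "X p c" "v c"] cA
        by (simp add: LC_chart[OF True] frechet_derivative_eq endo_chart[OF True LC_tangent[OF p X v]]
            endo_chart[OF True X_at[OF True]] linear_add[OF endo_chart_linear[OF T cA(1) u]])
    next
      case False
      then show ?thesis
        using tangent_off[OF tensor11_tangent[OF T p LC_tangent[OF p X v]]] by (simp add: LC_def)
    qed
  qed
qed

section \<open>Harmonic endomorphism fields\<close>

lemma has_derivative_fst_compose:
  assumes "(f has_derivative f') (at u)"
  shows "((\<lambda>q. f (fst q)) has_derivative (\<lambda>Z. f' (fst Z))) (at (u, y))"
proof -
  have "(fst has_derivative fst) (at (u, y))" by (auto intro!: derivative_eq_intros)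
  then show ?thesis by (rule has_derivative_compose) (simp add: assms)
qed

text \<open>Points \<open>(u, y)\<close> are induced coordinates of the tangent bundle;
  \<open>H\<close> is the complete lift of \<open>G\<close>, and \<open>F\<close> is the
  endomorphism field as a map of the bundle, both constrained over \<open>S\<close> only.\<close>

locale local_endo = local_metric S G for S :: "'v::euclidean_space set" and G +
  fixes T :: "'v \<Rightarrow> 'v \<Rightarrow> 'v"
    and H :: "'v \<times> 'v \<Rightarrow> 'v \<times> 'v \<Rightarrow> 'v \<times> 'v \<Rightarrow> real" and F :: "'v \<times> 'v \<Rightarrow> 'v \<times> 'v"
  assumes linear_T: "u \<in> S \<Longrightarrow> linear (T u)"
    and smooth_T: "smooth_on S (\<lambda>u. T u x)"
    and H: "u \<in> S \<Longrightarrow> H (u, y) X Y =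
      frechet_derivative (\<lambda>u'. G u' (fst X) (fst Y)) (at u) y + G u (fst X) (snd Y) + G u (fst Y) (snd X)"
    and F: "u \<in> S \<Longrightarrow> F (u, y) = (u, T u y)"
begin

abbreviation \<Gamma> :: "'v \<Rightarrow> 'v \<Rightarrow> 'v \<Rightarrow> 'v" where "\<Gamma> \<equiv> christoffel G"

definition dT :: "'v \<Rightarrow> 'v \<Rightarrow> 'v \<Rightarrow> 'v"
  where "dT u z x = frechet_derivative (\<lambda>u. T u x) (at u) z"

text \<open>Coordinate form of the covariant derivative of \<open>T\<close> in the direction
  \<open>z\<close>, applied to \<open>x\<close>.\<close>

definition nab :: "'v \<Rightarrow> 'v \<Rightarrow> 'v \<Rightarrow> 'v"
  where "nab u z x = dT u z x + \<Gamma> u z (T u x) - T u (\<Gamma> u z x)"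

lemma open_SU: "open (S \<times> UNIV)"
  by (simp add: open_Times open_S)

lemma has_derivative_T: "u \<in> S \<Longrightarrow> ((\<lambda>u. T u x) has_derivative (\<lambda>z. dT u z x)) (at u)"
  unfolding dT_def using smooth_on_has_derivative[OF smooth_T] .

lemma has_derivative_Tfst:
  "u \<in> S \<Longrightarrow> ((\<lambda>q. T (fst q) x) has_derivative (\<lambda>Z. dT u (fst Z) x)) (at (u, y))"
  by (rule has_derivative_fst_compose[OF has_derivative_T])

lemma has_derivative_T2:
  assumes u: "u \<in> S"
  shows "((\<lambda>q. T (fst q) (snd q)) has_derivative (\<lambda>Z. dT u (fst Z) y + T u (snd Z))) (at (u, y))"
proof -
  have "((\<lambda>q. T (fst q) (snd q)) has_derivative (\<lambda>Z. frechet_derivative (\<lambda>q. T (fst q) (snd (u, y))) (at (u, y)) Z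
      + T (fst (u, y)) (snd Z))) (at (u, y))"
    by (rule has_derivative_apply_linear[OF open_SU, of _ "\<lambda>q. T (fst q)"])
       (use u linear_T in \<open>auto intro!: derivative_eq_intros differentiableI[OF has_derivative_Tfst]\<close>)
  then show ?thesis by (simp add: frechet_derivative_eq[OF has_derivative_Tfst[OF u]])
qed

lemma bilinear_dT:
  assumes u: "u \<in> S"
  shows "bilinear (dT u)"
  using has_derivative_linear[OF has_derivative_T[OF u]]
    linear_frechet_param[OF open_S u linear_T smooth_on_differentiable[OF smooth_T u]]
  by (simp add: bilinear_def dT_def)

lemma bilinear_nab:
  assumes u: "u \<in> S"
  shows "bilinear (nab u)"
  unfolding bilinear_def nab_def
  by (intro conjI allI linearI)
     (simp_all add: bilinear_ladd[OF bilinear_dT[OF u]] bilinear_lmul[OF bilinear_dT[OF u]]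
       bilinear_radd[OF bilinear_dT[OF u]] bilinear_rmul[OF bilinear_dT[OF u]]
       bilinear_ladd[OF bilinear_christoffel[OF u]] bilinear_lmul[OF bilinear_christoffel[OF u]]
       bilinear_radd[OF bilinear_christoffel[OF u]] bilinear_rmul[OF bilinear_christoffel[OF u]]
       linear_add[OF linear_T[OF u]] linear_scale[OF linear_T[OF u]] scaleR_diff_right scaleR_add_right)

lemma sharp_G: "u \<in> S \<Longrightarrow> G u (sharp (G u) x) w = x \<bullet> w"
proof -
  assume u: "u \<in> S"
  have "\<exists>!z. \<forall>w. G u z w = x \<bullet> w"
    by (rule representation[OF u]) (simp add: bounded_linear.linear bounded_linear_inner_right)
  from theI'[OF this] show "G u (sharp (G u) x) w = x \<bullet> w" by (simp add: sharp_def)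
qed

text \<open>The matrix of \<open>sharp\<close> on the basis is the inverse of a symmetric matrix, so
  either index of the trace may be the one that is raised.\<close>

lemma sum_nab_swap:
  assumes u: "u \<in> S"
  shows "(\<Sum>b\<in>Basis. nab u (sharp (G u) b) b) = (\<Sum>b\<in>Basis. nab u b (sharp (G u) b))"
proof -
  let ?s = "sharp (G u)"
  have sym: "?s b \<bullet> e = ?s e \<bullet> b" for b e
    using sharp_G[OF u, of e "?s b"] sharp_G[OF u, of b "?s e"] G_commute[OF u, of "?s b" "?s e"]
    by (simp add: inner_commute)
  have lin: "linear (\<lambda>z. nab u z x)" "linear (nab u x)" for x
    using bilinear_nab[OF u] by (simp_all add: bilinear_def)
  have "(\<Sum>b\<in>Basis. nab u (?s b) b) = (\<Sum>b\<in>Basis. \<Sum>e\<in>Basis. (?s b \<bullet> e) *\<^sub>R nab u e b)"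
    by (intro sum.cong refl linear_Basis_sum[OF lin(1)])
  also have "\<dots> = (\<Sum>e\<in>Basis. \<Sum>b\<in>Basis. (?s e \<bullet> b) *\<^sub>R nab u e b)"
    by (subst sum.swap) (simp add: sym[of _ "_ :: 'v"])
  also have "\<dots> = (\<Sum>e\<in>Basis. nab u e (?s e))"
    by (intro sum.cong refl linear_Basis_sum[OF lin(2), symmetric])
  finally show ?thesis .
qed

lemma has_derivative_H:
  assumes u: "u \<in> S"
  shows "((\<lambda>q. H q X Y) has_derivative (\<lambda>Z.
    frechet_derivative (\<lambda>u. dG u y (fst X) (fst Y)) (at u) (fst Z) + dG u (snd Z) (fst X) (fst Y)
    + dG u (fst Z) (fst X) (snd Y) + dG u (fst Z) (fst Y) (snd X))) (at (u, y))"
proof -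
  have 1: "((\<lambda>q. dG (fst q) w x x') has_derivative (\<lambda>Z. frechet_derivative (\<lambda>u. dG u w x x') (at u) (fst Z))) (at (u, y))" for w x x'
    by (rule has_derivative_fst_compose[OF smooth_on_has_derivative[OF smooth_on_frechet[OF smooth_G] u]])
  have "((\<lambda>q. dG (fst q) (snd q) (fst X) (fst Y)) has_derivative (\<lambda>Z.
     frechet_derivative (\<lambda>q. dG (fst q) (snd (u, y)) (fst X) (fst Y)) (at (u, y)) Z
      + dG (fst (u, y)) (snd Z) (fst X) (fst Y))) (at (u, y))"
    by (rule has_derivative_apply_linear[OF open_SU, of _ "\<lambda>q z. dG (fst q) z (fst X) (fst Y)"])
       (use u linear_dG in \<open>auto intro!: derivative_eq_intros differentiableI[OF 1]\<close>)
  then have 2: "((\<lambda>q. dG (fst q) (snd q) (fst X) (fst Y)) has_derivative (\<lambda>Z.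
      frechet_derivative (\<lambda>u. dG u y (fst X) (fst Y)) (at u) (fst Z) + dG u (snd Z) (fst X) (fst Y))) (at (u, y))"
    by (simp add: frechet_derivative_eq[OF 1])
  have "((\<lambda>q. dG (fst q) (snd q) (fst X) (fst Y) + G (fst q) (fst X) (snd Y) + G (fst q) (fst Y) (snd X)) has_derivative (\<lambda>Z.
    frechet_derivative (\<lambda>u. dG u y (fst X) (fst Y)) (at u) (fst Z) + dG u (snd Z) (fst X) (fst Y)
    + dG u (fst Z) (fst X) (snd Y) + dG u (fst Z) (fst Y) (snd X))) (at (u, y))"
    by (intro has_derivative_add 2 has_derivative_fst_compose has_derivative_G u)
  then show ?thesis
  proof (rule has_derivative_transform_within_open[OF _ open_SU])
    fix q assume "q \<in> S \<times> (UNIV :: 'v set)"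
    then show "dG (fst q) (snd q) (fst X) (fst Y) + G (fst q) (fst X) (snd Y) + G (fst q) (fst Y) (snd X) = H q X Y"
      using H[of "fst q" "snd q" X Y] by (simp add: mem_Times_iff)
  qed (use u in simp)
qed

text \<open>Nondegeneracy of the complete lift: vertical test vectors detect the horizontal part,
  after which horizontal test vectors detect the vertical part.\<close>

lemma H_eqI:
  assumes u: "u \<in> S" and eq: "\<And>W. H (u, y) X W = H (u, y) Y W"
  shows "X = Y"
proof -
  have 1: "fst X = fst Y"
    by (rule G_eqI[OF u]) (use eq[of "(0, _)"] u in \<open>simp add: H bilinear_rzero[OF bilinear_dG] bilinear_lzero[OF bilinear_G]\<close>)
  have "snd X = snd Y"
  proof (rule G_eqI[OF u])
    fix w show "G u (snd X) w = G u (snd Y) w"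
      using eq[of "(w, 0)"] u 1 by (simp add: H G_commute[OF u, of w] bilinear_rzero[OF bilinear_G])
  qed
  with 1 show ?thesis by (simp add: prod_eq_iff)
qed

lemma christoffel_H_eqI:
  assumes u: "u \<in> S" and eq: "\<And>W. 2 * H (u, y) Z W = koszul H (u, y) X Y W"
  shows "christoffel H (u, y) X Y = Z"
  unfolding christoffel_def koszul_def[symmetric]
proof (rule the_equality)
  show "\<forall>W. 2 * H (u, y) Z W = koszul H (u, y) X Y W" using eq by simp
  fix Z' assume "\<forall>W. 2 * H (u, y) Z' W = koszul H (u, y) X Y W"
  then have "H (u, y) Z' W = H (u, y) Z W" for W
    using eq[of W] by (metis mult_cancel_left zero_neq_numeral)
  then show "Z' = Z" by (rule H_eqI[OF u])
qed

lemma sharp_H_eqI: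
  assumes u: "u \<in> S" and eq: "\<And>W. H (u, y) Z W = X \<bullet> W"
  shows "sharp (H (u, y)) X = Z"
  unfolding sharp_def
proof (rule the_equality)
  fix Z' assume "\<forall>W. H (u, y) Z' W = X \<bullet> W"
  then have "H (u, y) Z' W = H (u, y) Z W" for W using eq[of W] by metis
  then show "Z' = Z" by (rule H_eqI[OF u])
qed (use eq in simp)

lemma ddG_zero:
  assumes u: "u \<in> S"
  shows "frechet_derivative (\<lambda>u. dG u y 0 x) (at u) z = 0" "frechet_derivative (\<lambda>u. dG u y x 0) (at u) z = 0"
    "frechet_derivative (\<lambda>u. dG u y x x') (at u) 0 = 0"
proof -
  have "((\<lambda>u. dG u y 0 x) has_derivative (\<lambda>_. 0)) (at u)" "((\<lambda>u. dG u y x 0) has_derivative (\<lambda>_. 0)) (at u)"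
    by (rule has_derivative_transform_within_open[OF has_derivative_const open_S u],
        simp add: bilinear_lzero[OF bilinear_dG] bilinear_rzero[OF bilinear_dG])+
  then show "frechet_derivative (\<lambda>u. dG u y 0 x) (at u) z = 0" "frechet_derivative (\<lambda>u. dG u y x 0) (at u) z = 0"
    by (simp_all add: frechet_derivative_eq)
  show "frechet_derivative (\<lambda>u. dG u y x x') (at u) 0 = 0"
    by (rule linear_0[OF smooth_on_linear_frechet[OF smooth_on_frechet[OF smooth_G] u]])
qed

text \<open>In the tension field one argument of each Christoffel symbol of the complete lift is vertical, so
  the components involving derivatives of \<open>\<Gamma>\<close> never enter.\<close>

lemma christoffel_H_vertical:
  assumes u: "u \<in> S"
  shows "christoffel H (u, y) (0, x) Y = (0, \<Gamma> u x (fst Y))"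
    "christoffel H (u, y) Y (0, x) = (0, \<Gamma> u x (fst Y))"
proof -
  note D = frechet_derivative_eq[OF has_derivative_H[OF u]]
  note z = bilinear_lzero[OF bilinear_dG[OF u]] bilinear_rzero[OF bilinear_dG[OF u]]
    bilinear_lzero[OF bilinear_G[OF u]] bilinear_rzero[OF bilinear_G[OF u]] linear_0[OF linear_dG[OF u]] ddG_zero[OF u]
  have K: "2 * G u w (\<Gamma> u x x') = dG u x x' w + dG u x' x w - dG u w x x'" for w x'
    using christoffel_koszul[OF u, of x x' w] G_commute[OF u, of w] by (simp add: koszul_def)
  show "christoffel H (u, y) (0, x) Y = (0, \<Gamma> u x (fst Y))"
    by (rule christoffel_H_eqI[OF u])
       (simp add: koszul_def D H[OF u] z K dG_commute[OF u, where x="fst _" and y=x])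
  show "christoffel H (u, y) Y (0, x) = (0, \<Gamma> u x (fst Y))"
    by (rule christoffel_H_eqI[OF u])
       (simp add: koszul_def D H[OF u] z K dG_commute[OF u, where x="fst _" and y=x])
qed

text \<open>In block form the complete lift pairs horizontal with vertical directions, so the dual
  of a horizontal basis vector is vertical and that of a vertical one has horizontal part
  \<open>sharp (G u) b\<close>. The vertical part \<open>m\<close> of the latter stays unspecified,
  since the tension field is insensitive to it.\<close>

lemma sharp_H:
  assumes u: "u \<in> S"
  shows "sharp (H (u, y)) (b, 0) = (0, sharp (G u) b)"
    and "\<exists>m. sharp (H (u, y)) (0, b) = (sharp (G u) b, m)"
proof -
  note z = bilinear_lzero[OF bilinear_dG[OF u]] bilinear_lzero[OF bilinear_G[OF u]]
  show "sharp (H (u, y)) (b, 0) = (0, sharp (G u) b)"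
    by (rule sharp_H_eqI[OF u]) (simp add: H[OF u] z G_commute[OF u, of "fst _"] sharp_G[OF u] inner_prod_def)
  let ?b = "sharp (G u) b"
  have "linear (\<lambda>w. - dG u y ?b w)"
    using bilinear_dG[OF u, of y] by (intro linear_compose_neg) (simp add: bilinear_def)
  then obtain m where m: "\<And>w. G u m w = - dG u y ?b w"
    using representation[OF u] by blast
  have "sharp (H (u, y)) (0, b) = (?b, m)"
    by (rule sharp_H_eqI[OF u]) (simp add: H[OF u] sharp_G[OF u] G_commute[OF u, of "fst _" m] m inner_prod_def)
  then show "\<exists>m. sharp (H (u, y)) (0, b) = (?b, m)" by blast
qed

lemma derivative_F:
  assumes u: "u \<in> S"
  shows "frechet_derivative F (at (u, y)) Z = (fst Z, dT u (fst Z) y + T u (snd Z))"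
proof -
  have "((\<lambda>q. (fst q, T (fst q) (snd q))) has_derivative (\<lambda>Z. (fst Z, dT u (fst Z) y + T u (snd Z)))) (at (u, y))"
    by (intro has_derivative_Pair has_derivative_T2[OF u] derivative_intros)
  then have "(F has_derivative (\<lambda>Z. (fst Z, dT u (fst Z) y + T u (snd Z)))) (at (u, y))"
    by (rule has_derivative_transform_within_open[OF _ open_SU]) (use u F in auto)
  then show ?thesis by (simp add: frechet_derivative_eq)
qed

text \<open>The derivative of \<open>F\<close> is affine in the fibre coordinate, so in a vertical
  direction it contributes \<open>dT u x z\<close> and the vertical part \<open>m\<close> drops
  out.\<close>

lemma second_derivative_F:
  assumes u: "u \<in> S"
  shows "frechet_derivative (\<lambda>q. frechet_derivative F (at q) (0, x)) (at (u, y)) (z, 0) = (0, dT u z x)"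
    and "frechet_derivative (\<lambda>q. frechet_derivative F (at q) (x, m)) (at (u, y)) (0, z) = (0, dT u x z)"
proof -
  have "((\<lambda>q. (0::'v, T (fst q) x)) has_derivative (\<lambda>Z. (0, dT u (fst Z) x))) (at (u, y))"
    by (intro has_derivative_Pair has_derivative_Tfst[OF u] has_derivative_const)
  then have "((\<lambda>q. frechet_derivative F (at q) (0, x)) has_derivative (\<lambda>Z. (0, dT u (fst Z) x))) (at (u, y))"
    by (rule has_derivative_transform_within_open[OF _ open_SU])
       (use u in \<open>auto simp: derivative_F bilinear_lzero[OF bilinear_dT]\<close>)
  then show "frechet_derivative (\<lambda>q. frechet_derivative F (at q) (0, x)) (at (u, y)) (z, 0) = (0, dT u z x)"
    by (simp add: frechet_derivative_eq)
  have fst': "((\<lambda>q. dT (fst q) x w) has_derivative (\<lambda>Z. frechet_derivative (\<lambda>u. dT u x w) (at u) (fst Z))) (at (u, y))" for w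
    by (rule has_derivative_fst_compose[OF smooth_on_has_derivative[OF smooth_on_frechet[OF smooth_T, folded dT_def] u]])
  have "((\<lambda>q. dT (fst q) x (snd q)) has_derivative (\<lambda>Z. frechet_derivative (\<lambda>q. dT (fst q) x (snd (u, y))) (at (u, y)) Z
      + dT (fst (u, y)) x (snd Z))) (at (u, y))"
    by (rule has_derivative_apply_linear[OF open_SU, of _ "\<lambda>q. dT (fst q) x"])
       (use u bilinear_dT in \<open>auto simp: bilinear_def intro!: derivative_eq_intros differentiableI[OF fst']\<close>)
  then have "((\<lambda>q. dT (fst q) x (snd q)) has_derivative (\<lambda>Z. frechet_derivative (\<lambda>u. dT u x y) (at u) (fst Z)
      + dT u x (snd Z))) (at (u, y))"
    by (simp add: frechet_derivative_eq[OF fst'])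
  then have "((\<lambda>q. (x, dT (fst q) x (snd q) + T (fst q) m)) has_derivative
      (\<lambda>Z. (0, frechet_derivative (\<lambda>u. dT u x y) (at u) (fst Z) + dT u x (snd Z) + dT u (fst Z) m))) (at (u, y))"
    by (intro has_derivative_Pair has_derivative_add has_derivative_Tfst[OF u] has_derivative_const)
  then have "((\<lambda>q. frechet_derivative F (at q) (x, m)) has_derivative
      (\<lambda>Z. (0, frechet_derivative (\<lambda>u. dT u x y) (at u) (fst Z) + dT u x (snd Z) + dT u (fst Z) m))) (at (u, y))"
    by (rule has_derivative_transform_within_open[OF _ open_SU])
       (use u in \<open>auto simp: derivative_F\<close>)
  moreover have "frechet_derivative (\<lambda>u. dT u x y) (at u) 0 = 0"
    using smooth_on_linear_frechet[OF smooth_on_frechet[OF smooth_T, folded dT_def] u] by (rule linear_0)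
  ultimately show "frechet_derivative (\<lambda>q. frechet_derivative F (at q) (x, m)) (at (u, y)) (0, z) = (0, dT u x z)"
    using bilinear_lzero[OF bilinear_dT[OF u]] by (simp add: frechet_derivative_eq)
qed

text \<open>Horizontal and vertical basis vectors each contribute one copy of \<open>\<delta>T\<close>.\<close>

lemma tension_endo:
  assumes u: "u \<in> S"
  shows "tension H H F (u, y) = (0, 2 *\<^sub>R (\<Sum>b\<in>Basis. nab u b (sharp (G u) b)))"
proof -
  let ?s = "sharp (G u)"
  define t where "t B = (let b' = sharp (H (u, y)) B; DF = (\<lambda>q. frechet_derivative F (at q)) in
        frechet_derivative (\<lambda>q. DF q b') (at (u, y)) B
      - DF (u, y) (christoffel H (u, y) B b')
      + christoffel H (F (u, y)) (DF (u, y) B) (DF (u, y) b'))" for B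
  note simps = t_def Let_def derivative_F[OF u] second_derivative_F[OF u] christoffel_H_vertical[OF u] F[OF u]
     bilinear_lzero[OF bilinear_dT[OF u]] linear_0[OF linear_T[OF u]] nab_def
  have 1: "t (b, 0) = (0, nab u b (?s b))" for b
    by (simp add: simps sharp_H[OF u] christoffel_commute[OF u, of "?s b" b] christoffel_commute[OF u, of "T u (?s b)" b])
  have 2: "t (0, b) = (0, nab u (?s b) b)" for b
  proof -
    obtain m where "sharp (H (u, y)) (0, b) = (?s b, m)" using sharp_H(2)[OF u] by blast
    then show ?thesis
      by (simp add: simps christoffel_commute[OF u, of b "?s b"] christoffel_commute[OF u, of "T u b" "?s b"])
  qed
  have "tension H H F (u, y) = (\<Sum>B\<in>Basis. t B)"
    by (simp add: tension_def t_def)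
  also have "\<dots> = (\<Sum>b\<in>Basis. (0, nab u b (?s b))) + (\<Sum>b\<in>Basis. (0, nab u (?s b) b))"
    by (simp add: sum_Basis_prod_eq 1 2)
  also have "\<dots> = (0, 2 *\<^sub>R (\<Sum>b\<in>Basis. nab u b (?s b)))"
    by (simp add: prod_eq_iff fst_sum snd_sum sum_nab_swap[OF u] scaleR_2)
  finally show ?thesis .
qed

end

section \<open>Induced charts of the tangent bundle\<close>

context manifold
begin

lemma chart_inv_eqI: "inj_on (snd c) (fst c) \<Longrightarrow> q \<in> fst c \<Longrightarrow> snd c q = u \<Longrightarrow> chart_inv c u = q"
  by (auto simp: chart_inv_def)

lemma fst_tan_chart: "(p, v) \<in> fst (tan_chart A c) \<longleftrightarrow> p \<in> fst c \<and> v \<in> tangent_space A p"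
  by (simp add: tan_chart_def)

lemma snd_tan_chart: "snd (tan_chart A c) (p, v) = (snd c p, v c)"
  by (simp add: tan_chart_def)

lemma chart_inv_tan:
  assumes "c \<in> A" "u \<in> chart_img c"
  shows "chart_inv (tan_chart A c) (u, y) = (chart_inv c u, of_chart A c (chart_inv c u) y)"
proof (rule chart_inv_eqI)
  show "inj_on (snd (tan_chart A c)) (fst (tan_chart A c))"
  proof (rule inj_onI; clarify)
    fix p v p' v' assume *: "(p, v) \<in> fst (tan_chart A c)" "(p', v') \<in> fst (tan_chart A c)"
      "snd (tan_chart A c) (p, v) = snd (tan_chart A c) (p', v')"
    then have "p = p'" using inj_chart[OF assms(1)] by (auto simp: fst_tan_chart snd_tan_chart inj_on_def)
    moreover from this have "v = v'"
      using * assms(1) by (intro tangent_eqI[of v p v' c]) (auto simp: fst_tan_chart snd_tan_chart charts_at_iff)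
    ultimately show "p = p' \<and> v = v'" by simp
  qed
  show "(chart_inv c u, of_chart A c (chart_inv c u) y) \<in> fst (tan_chart A c)"
    "snd (tan_chart A c) (chart_inv c u, of_chart A c (chart_inv c u) y) = (u, y)"
    using assms by (auto simp: fst_tan_chart snd_tan_chart intro: of_chart_tangent)
qed

lemma chart_img_tan:
  assumes "c \<in> A"
  shows "chart_img (tan_chart A c) = chart_img c \<times> UNIV"
proof (rule set_eqI)
  fix q :: "'v \<times> 'v"
  obtain u y where q: "q = (u, y)" by (cases q)
  show "q \<in> chart_img (tan_chart A c) \<longleftrightarrow> q \<in> chart_img c \<times> UNIV"
  proof
    assume "q \<in> chart_img (tan_chart A c)"
    then show "q \<in> chart_img c \<times> UNIV"
      by (auto simp: chart_img_def tan_chart_def)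
  next
    assume "q \<in> chart_img c \<times> UNIV"
    then have u: "u \<in> chart_img c" using q by simp
    show "q \<in> chart_img (tan_chart A c)"
      unfolding chart_img_def[of "tan_chart A c"]
      by (rule image_eqI[of _ _ "(chart_inv c u, of_chart A c (chart_inv c u) y)"])
         (use u assms in \<open>auto simp: q fst_tan_chart snd_tan_chart intro: of_chart_tangent\<close>)
  qed
qed

text \<open>The induced transition acts on the fibre by the Jacobian; differentiating that in the
  base direction produces the second derivative of the original transition.\<close>

lemma jacobian_tan:
  assumes c: "c \<in> charts_at A p" and d: "d \<in> charts_at A p" and v: "v \<in> tangent_space A p"
  shows "jacobian (tan_chart A c) (tan_chart A d) (p, v) X =
    (jacobian c d p (fst X), frechet_derivative (\<lambda>u. frechet_derivative (transition c d) (at u) (v c)) (at (snd c p)) (fst X)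
      + jacobian c d p (snd X))"
proof -
  have A: "c \<in> A" "d \<in> A" "p \<in> fst c" using c d by (auto simp: charts_at_iff)
  let ?\<phi> = "transition c d" and ?u = "snd c p"
  note S = open_overlap[OF A(1,2)] and sm = smooth_transition[OF A(1,2)] and u = snd_overlap[OF c d]
  have SU: "open (overlap c d \<times> (UNIV :: 'v set))" by (simp add: open_Times S)
  have 1: "((\<lambda>q. frechet_derivative ?\<phi> (at (fst q)) w) has_derivative
      (\<lambda>Z. frechet_derivative (\<lambda>u. frechet_derivative ?\<phi> (at u) w) (at ?u) (fst Z))) (at (?u, v c))" for w
    by (rule has_derivative_fst_compose[OF smooth_on_has_derivative[OF smooth_on_frechet[OF sm] u]])
  have "((\<lambda>q. frechet_derivative ?\<phi> (at (fst q)) (snd q)) has_derivative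
      (\<lambda>Z. frechet_derivative (\<lambda>q. frechet_derivative ?\<phi> (at (fst q)) (snd (?u, v c))) (at (?u, v c)) Z
        + frechet_derivative ?\<phi> (at (fst (?u, v c))) (snd Z))) (at (?u, v c))"
    by (rule has_derivative_apply_linear[OF SU, of _ "\<lambda>q. frechet_derivative ?\<phi> (at (fst q))"])
       (use u in \<open>auto intro!: derivative_eq_intros differentiableI[OF 1] smooth_on_linear_frechet[OF sm]\<close>)
  then have 2: "((\<lambda>q. frechet_derivative ?\<phi> (at (fst q)) (snd q)) has_derivative
      (\<lambda>Z. frechet_derivative (\<lambda>u. frechet_derivative ?\<phi> (at u) (v c)) (at ?u) (fst Z)
        + jacobian c d p (snd Z))) (at (?u, v c))"
    by (simp add: frechet_derivative_eq[OF 1] jacobian_def)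
  have "((\<lambda>q. (?\<phi> (fst q), frechet_derivative ?\<phi> (at (fst q)) (snd q))) has_derivative
      (\<lambda>Z. (jacobian c d p (fst Z), frechet_derivative (\<lambda>u. frechet_derivative ?\<phi> (at u) (v c)) (at ?u) (fst Z)
        + jacobian c d p (snd Z)))) (at (?u, v c))"
    by (intro has_derivative_Pair 2 has_derivative_fst_compose transition_has_derivative c d)
  then have "(transition (tan_chart A c) (tan_chart A d) has_derivative
      (\<lambda>Z. (jacobian c d p (fst Z), frechet_derivative (\<lambda>u. frechet_derivative ?\<phi> (at u) (v c)) (at ?u) (fst Z)
        + jacobian c d p (snd Z)))) (at (?u, v c))"
  proof (rule has_derivative_transform_within_open[OF _ SU])
    fix q assume "q \<in> overlap c d \<times> (UNIV :: 'v set)"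
    then obtain u y where q: "q = (u, y)" "u \<in> chart_img c" "chart_inv c u \<in> fst d"
      using A by (cases q) (auto simp: overlap_iff)
    then have cd: "c \<in> charts_at A (chart_inv c u)" "d \<in> charts_at A (chart_inv c u)"
      using A by (auto simp: charts_at_iff)
    show "(?\<phi> (fst q), frechet_derivative ?\<phi> (at (fst q)) (snd q)) = transition (tan_chart A c) (tan_chart A d) q"
      using q A cd by (simp add: transition_def[of "tan_chart A c"] chart_inv_tan snd_tan_chart of_chart_apply jacobian_def)
         (simp add: transition_def)
  qed (use u in simp)
  then show ?thesis
    by (simp add: jacobian_def[of "tan_chart A c"] snd_tan_chart frechet_derivative_eq)
qed

end

context metric_manifold
begin

text \<open>The definition evaluates the lift in a selected chart \<open>d\<close>. Pulled back to
  \<open>c\<close>, the second-derivative part of the induced Jacobian is exactly what the product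
  rule for the transformed metric coefficients requires, by symmetry of second derivatives.\<close>

lemma complete_lift_metric_chart:
  assumes c: "c \<in> A" and u: "u \<in> chart_img c"
  shows "in_chart (tangent_bundle A) (complete_lift_metric A g) (tan_chart A c) (u, y) X Y =
    frechet_derivative (\<lambda>u. G c u (fst X) (fst Y)) (at u) y + G c u (fst X) (snd Y) + G c u (fst Y) (snd X)"
proof -
  define p where "p = chart_inv c u"
  define v where "v = of_chart A c p y"
  define d where "d = chart_at A p"
  have cp: "c \<in> charts_at A p" "snd c p = u" using c u by (auto simp: p_def)
  have dp: "d \<in> charts_at A p" using chart_at[OF charts_at_points[OF cp(1)]] by (simp add: d_def)
  have dA: "d \<in> A" using dp by (simp add: charts_at_iff)
  have v: "v \<in> tangent_space A p" "v c = y" using of_chart_tangent cp by (auto simp: v_def)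
  let ?\<phi> = "transition c d"
  let ?D = "frechet_derivative ?\<phi> (at u)"
  let ?D2 = "\<lambda>x. frechet_derivative (\<lambda>u. frechet_derivative ?\<phi> (at u) y) (at u) x"
  interpret L: local_metric "chart_img d" "G d" by (rule local_metric_chart[OF dA])
  have du: "snd d p \<in> chart_img d" using dp by (simp add: charts_at_iff)
  have \<phi>u: "?\<phi> u = snd d p" using cp transition_snd[of c p d] by (auto simp: charts_at_iff)
  note S = open_overlap[OF c dA] and sm = smooth_transition[OF c dA] and uS = snd_overlap[OF cp(1) dp, unfolded cp(2)]
  have im: "?\<phi> ` overlap c d \<subseteq> chart_img d"
    using transition_mem(1)[OF c dA] overlap_subset[of d c] by blast
  have "(p, v) \<in> fst (tan_chart A d)" using dp v by (simp add: fst_tan_chart charts_at_iff)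
  then have mem: "tan_chart A d \<in> charts_at (tangent_bundle A) (p, v)"
    using dA by (simp add: charts_at_iff tangent_bundle_def)
  have of: "of_chart (tangent_bundle A) (tan_chart A c) (p, v) X (tan_chart A d) = (?D (fst X), ?D2 (fst X) + ?D (snd X))" for X
    using mem jacobian_tan[OF cp(1) dp v(1), of X] by (simp add: of_chart_def v(2) cp(2) jacobian_def)
  have vd: "v d = ?D y" using tangent_apply[OF v(1) cp(1) dp] by (simp add: v(2) jacobian_def cp(2))
  have sym: "frechet_derivative (\<lambda>u. frechet_derivative ?\<phi> (at u) x) (at u) y = ?D2 x" for x
    by (rule second_derivative_symmetric[OF S uS sm])
  have "in_chart (tangent_bundle A) (complete_lift_metric A g) (tan_chart A c) (u, y) X Y =
      complete_lift_metric A g (p, v) (of_chart (tangent_bundle A) (tan_chart A c) (p, v) X)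
        (of_chart (tangent_bundle A) (tan_chart A c) (p, v) Y)"
    by (simp add: in_chart_def chart_inv_tan[OF c u] p_def v_def)
  also have "\<dots> = L.dG (snd d p) (?D y) (?D (fst X)) (?D (fst Y)) + G d (snd d p) (?D (fst X)) (?D2 (fst Y) + ?D (snd Y))
      + G d (snd d p) (?D (fst Y)) (?D2 (fst X) + ?D (snd X))"
    by (simp add: complete_lift_metric_def Let_def d_def[symmetric] of vd)
  also have "\<dots> = frechet_derivative (\<lambda>u. G c u (fst X) (fst Y)) (at u) y + G c u (fst X) (snd Y) + G c u (fst Y) (snd X)"
    using L.derivative_pullback[OF S uS im sm G_change[OF c dA], of "fst X" "fst Y" y] G_change[OF c dA uS]
    by (simp add: sym \<phi>u bilinear_radd[OF L.bilinear_G[OF du]] L.G_commute[OF du, of "?D2 (fst X)"])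
  finally show ?thesis .
qed

text \<open>The hypothesis is the vanishing of the trace of the covariant derivative of
  \<open>T\<close>, and \<open>tension_endo\<close> expresses the tension field by that trace. Since
  \<open>T\<close> preserves fibres, the chart induced by \<open>c\<close> can be used in both
  source and target.\<close>

theorem harmonic_endoI:
  assumes T: "tensor11 A T"
    and trace: "\<And>c u. c \<in> A \<Longrightarrow> u \<in> chart_img c \<Longrightarrow>
      (\<Sum>b\<in>Basis. let b' = sharp (G c u) b in
         frechet_derivative (\<lambda>u. endo_chart A T c u b') (at u) b
         + christoffel (G c) u b (endo_chart A T c u b') - endo_chart A T c u (christoffel (G c) u b b')) = 0"
  shows "harmonic_endo A g T"
  unfolding harmonic_endo_def harmonic_map_def
proof
  fix q assume "q \<in> points (tangent_bundle A)"
  then obtain c where c: "c \<in> A" "q \<in> fst (tan_chart A c)"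
    by (auto simp: points_def tangent_bundle_def)
  obtain p v where q: "q = (p, v)" by (cases q)
  let ?c = "tan_chart A c" and ?f = "\<lambda>(p, v). (p, T p v)"
  let ?F = "snd ?c \<circ> ?f \<circ> chart_inv ?c"
  have im: "?f ` fst ?c \<subseteq> fst ?c"
  proof clarify
    fix p v assume "(p, v) \<in> fst ?c"
    then show "(p, T p v) \<in> fst ?c"
      using c(1) tensor11_tangent[OF T charts_at_points, of c p v] by (simp add: fst_tan_chart charts_at_iff)
  qed
  have F: "?F (u, y) = (u, endo_chart A T c u y)" if "u \<in> chart_img c" for u y
    using that c(1) by (simp add: chart_inv_tan snd_tan_chart endo_chart_def)
  interpret L: local_endo "chart_img c" "G c" "endo_chart A T c"
    "in_chart (tangent_bundle A) (complete_lift_metric A g) ?c" ?F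
    by (intro local_endo.intro local_metric_chart local_endo_axioms.intro c endo_chart_linear endo_chart_smooth T
        complete_lift_metric_chart F)
  have img: "chart_img ?c = chart_img c \<times> UNIV" by (rule chart_img_tan[OF c(1)])
  have "smooth_on (chart_img ?c) (\<lambda>q. (fst q, endo_chart A T c (fst q) (snd q)))"
    unfolding img
  proof (intro smooth_on_Pair L.open_SU smooth_on_fst smooth_on_ident)
    show "smooth_on (chart_img c \<times> UNIV) (\<lambda>q. endo_chart A T c (fst q) (snd q))"
    proof (rule smooth_on_apply_linear[of _ "\<lambda>q. endo_chart A T c (fst q)"])
      show "smooth_on (chart_img c \<times> UNIV) (\<lambda>q. endo_chart A T c (fst q) w)" for w
        by (rule smooth_on_compose[OF L.open_SU L.open_S _ L.smooth_T])
           (auto intro: smooth_on_fst smooth_on_ident L.open_SU)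
    qed (auto simp: L.open_SU L.linear_T intro: smooth_on_snd smooth_on_ident L.open_SU)
  qed
  then have smooth: "smooth_on (chart_img ?c) ?F"
    by (subst smooth_on_cong[of _ _ "\<lambda>q. (fst q, endo_chart A T c (fst q) (snd q))"])
       (use F in \<open>auto simp: img L.open_SU simp del: o_apply\<close>)
  have tens: "tension (in_chart (tangent_bundle A) (complete_lift_metric A g) ?c)
      (in_chart (tangent_bundle A) (complete_lift_metric A g) ?c) ?F w = 0" if w': "w \<in> chart_img ?c" for w
  proof -
    obtain u y where w: "w = (u, y)" "u \<in> chart_img c" using w' unfolding img by (cases w) auto
    have "(\<Sum>b\<in>Basis. L.nab u b (sharp (G c u) b)) = 0"
      using trace[OF c(1) w(2)] by (simp add: Let_def L.nab_def L.dT_def)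
    then show ?thesis using L.tension_endo[OF w(2), of y] by (simp add: w(1) zero_prod_def)
  qed
  have mem: "?c \<in> charts_at (tangent_bundle A) q" "?c \<in> charts_at (tangent_bundle A) (?f q)"
    using c im by (auto simp: charts_at_iff tangent_bundle_def)
  show "\<exists>c\<in>charts_at (tangent_bundle A) q. \<exists>d\<in>charts_at (tangent_bundle A) (?f q).
       ?f ` fst c \<subseteq> fst d \<and> smooth_on (chart_img c) (snd d \<circ> ?f \<circ> chart_inv c) \<and>
       (\<forall>u\<in>chart_img c. tension (in_chart (tangent_bundle A) (complete_lift_metric A g) c)
          (in_chart (tangent_bundle A) (complete_lift_metric A g) d) (snd d \<circ> ?f \<circ> chart_inv c) u = 0)"
    using mem im smooth tens by blast
qed

end

section \<open>The cotangent bundle\<close>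

text \<open>The adjoint of a linear map, written as a sum in order to be differentiated termwise.\<close>

definition transp :: "('v::euclidean_space \<Rightarrow> 'v) \<Rightarrow> 'v \<Rightarrow> 'v"
  where "transp f y = (\<Sum>b\<in>Basis. (y \<bullet> f b) *\<^sub>R b)"

lemma transp_inner: "linear f \<Longrightarrow> transp f y \<bullet> w = y \<bullet> f w"
proof -
  assume f: "linear f"
  have "y \<bullet> f w = (\<Sum>b\<in>Basis. (w \<bullet> b) *\<^sub>R (y \<bullet> f b))"
    using linear_Basis_sum[of "\<lambda>w. y \<bullet> f w" w] linear_compose[OF f bounded_linear.linear[OF bounded_linear_inner_right]]
    by (simp add: comp_def)
  then show ?thesis
    by (simp add: transp_def inner_sum_left inner_commute[of w] mult.commute)
qed

text \<open>Inverse of \<open>covec_comp\<close>; the zero value off the tangent space is forced by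
  the convention for covectors.\<close>

definition covec :: "('a, 'v::euclidean_space) chart set \<Rightarrow> ('a, 'v) chart \<Rightarrow> 'a \<Rightarrow> 'v \<Rightarrow> ('a, 'v) covec"
  where "covec A c p \<eta> = (\<lambda>v. if v \<in> tangent_space A p then \<eta> \<bullet> v c else 0)"

context manifold
begin

abbreviation N :: "('a \<times> ('a, 'v) covec, 'v \<times> 'v) chart set"
  where "N \<equiv> cotangent_bundle A"

lemma fst_cot_chart: "(p, \<omega>) \<in> fst (cot_chart A c) \<longleftrightarrow> p \<in> fst c \<and> \<omega> \<in> cotangent_space A p"
  by (simp add: cot_chart_def)

lemma snd_cot_chart: "snd (cot_chart A c) (p, \<omega>) = (snd c p, covec_comp A c p \<omega>)"
  by (simp add: cot_chart_def)

lemma covec_cotangent: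
  "c \<in> charts_at A p \<Longrightarrow> covec A c p \<eta> \<in> cotangent_space A p"
  by (simp add: covec_def cotangent_space_def linear_on_def tangent_add tangent_scale inner_add_right scaleR_fun_apply)

lemma covec_comp_inner:
  assumes "c \<in> charts_at A p" "linear_on (tangent_space A p) \<omega>" "v \<in> tangent_space A p"
  shows "\<omega> v = covec_comp A c p \<omega> \<bullet> v c"
proof -
  have "\<omega> v = \<omega> (of_chart A c p (v c))" using assms by simp
  also have "\<dots> = (\<Sum>b\<in>Basis. (v c \<bullet> b) *\<^sub>R \<omega> (of_chart A c p b))"
    by (rule linear_Basis_sum[OF linear_on_of_chart[OF assms(2,1)]])
  finally show ?thesis by (simp add: covec_comp_def inner_sum_left inner_commute[of "v c"] mult.commute)
qed

lemma cotangent_linear_on: "\<omega> \<in> cotangent_space A p \<Longrightarrow> linear_on (tangent_space A p) \<omega>"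
  by (simp add: cotangent_space_def)

lemma covec_comp_covec [simp]:
  assumes "c \<in> charts_at A p"
  shows "covec_comp A c p (covec A c p \<eta>) = \<eta>"
  using assms by (simp add: covec_comp_def covec_def of_chart_tangent euclidean_representation)

lemma covec_covec_comp:
  assumes "c \<in> charts_at A p" "\<omega> \<in> cotangent_space A p"
  shows "covec A c p (covec_comp A c p \<omega>) = \<omega>"
proof
  fix v show "covec A c p (covec_comp A c p \<omega>) v = \<omega> v"
    using assms(2) covec_comp_inner[OF assms(1) cotangent_linear_on[OF assms(2)], of v]
    by (simp add: covec_def cotangent_space_def)
qed

lemma covec_comp_change:
  assumes c: "c \<in> charts_at A p" and d: "d \<in> charts_at A p" and \<omega>: "linear_on (tangent_space A p) \<omega>"
  shows "covec_comp A d p \<omega> = transp (jacobian d c p) (covec_comp A c p \<omega>)"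
  unfolding covec_comp_def[of A d] transp_def
  by (simp add: covec_comp_inner[OF c \<omega>] of_chart_tangent[OF d] of_chart_apply[OF c])

lemma points_cot: "(p, \<omega>) \<in> points N \<longleftrightarrow> p \<in> points A \<and> \<omega> \<in> cotangent_space A p"
  by (auto simp: points_def cotangent_bundle_def fst_cot_chart)

lemma inj_cot_chart:
  assumes "c \<in> A"
  shows "inj_on (snd (cot_chart A c)) (fst (cot_chart A c))"
proof (rule inj_onI; clarify)
  fix p \<omega> p' \<omega>' assume *: "(p, \<omega>) \<in> fst (cot_chart A c)" "(p', \<omega>') \<in> fst (cot_chart A c)"
    "snd (cot_chart A c) (p, \<omega>) = snd (cot_chart A c) (p', \<omega>')"
  then have p: "p = p'" using inj_chart[OF assms] by (auto simp: fst_cot_chart snd_cot_chart inj_on_def)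
  have c: "c \<in> charts_at A p" using * assms by (simp add: charts_at_iff fst_cot_chart)
  have "covec_comp A c p \<omega> = covec_comp A c p \<omega>'" "\<omega> \<in> cotangent_space A p" "\<omega>' \<in> cotangent_space A p"
    using * p by (simp_all add: fst_cot_chart snd_cot_chart)
  then have "\<omega> = \<omega>'"
    using covec_covec_comp[OF c] by metis
  with p show "p = p' \<and> \<omega> = \<omega>'" by simp
qed

lemma chart_inv_cot:
  assumes "c \<in> A" "u \<in> chart_img c"
  shows "chart_inv (cot_chart A c) (u, \<eta>) = (chart_inv c u, covec A c (chart_inv c u) \<eta>)"
  by (rule chart_inv_eqI[OF inj_cot_chart[OF assms(1)]])
     (use assms in \<open>auto simp: fst_cot_chart snd_cot_chart intro: covec_cotangent\<close>)

lemma chart_img_cot: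
  assumes "c \<in> A"
  shows "chart_img (cot_chart A c) = chart_img c \<times> UNIV"
proof (rule set_eqI)
  fix q :: "'v \<times> 'v"
  obtain u \<eta> where q: "q = (u, \<eta>)" by (cases q)
  show "q \<in> chart_img (cot_chart A c) \<longleftrightarrow> q \<in> chart_img c \<times> UNIV"
  proof
    assume "q \<in> chart_img (cot_chart A c)"
    then show "q \<in> chart_img c \<times> UNIV"
      by (auto simp: chart_img_def cot_chart_def)
  next
    assume "q \<in> chart_img c \<times> UNIV"
    then have u: "u \<in> chart_img c" using q by simp
    show "q \<in> chart_img (cot_chart A c)"
      unfolding chart_img_def[of "cot_chart A c"]
      by (rule image_eqI[of _ _ "(chart_inv c u, covec A c (chart_inv c u) \<eta>)"])
         (use u assms in \<open>auto simp: q fst_cot_chart snd_cot_chart intro: covec_cotangent\<close>)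
  qed
qed

lemma overlap_cot:
  assumes "c \<in> A" "d \<in> A"
  shows "overlap (cot_chart A c) (cot_chart A d) = overlap c d \<times> UNIV"
proof (rule set_eqI)
  fix q :: "'v \<times> 'v"
  obtain u \<eta> where q: "q = (u, \<eta>)" by (cases q)
  show "q \<in> overlap (cot_chart A c) (cot_chart A d) \<longleftrightarrow> q \<in> overlap c d \<times> UNIV"
  proof
    assume "q \<in> overlap (cot_chart A c) (cot_chart A d)"
    then show "q \<in> overlap c d \<times> UNIV"
      by (auto simp: overlap_def cot_chart_def)
  next
    assume "q \<in> overlap c d \<times> UNIV"
    then have u: "u \<in> chart_img c" "chart_inv c u \<in> fst d" using q assms by (auto simp: overlap_iff)
    show "q \<in> overlap (cot_chart A c) (cot_chart A d)"
      unfolding overlap_def[of "cot_chart A c"]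
      by (rule image_eqI[of _ _ "(chart_inv c u, covec A c (chart_inv c u) \<eta>)"])
         (use u assms in \<open>auto simp: q fst_cot_chart snd_cot_chart intro: covec_cotangent\<close>)
  qed
qed

text \<open>Components of covectors change by the adjoint of the inverse Jacobian, and that inverse
  is the Jacobian of the reverse transition at the image point.\<close>

lemma transition_cot:
  assumes "c \<in> A" "d \<in> A" "u \<in> overlap c d"
  shows "transition (cot_chart A c) (cot_chart A d) (u, \<eta>) =
    (transition c d u, transp (frechet_derivative (transition d c) (at (transition c d u))) \<eta>)"
proof -
  let ?p = "chart_inv c u"
  have u: "u \<in> chart_img c" "?p \<in> fst d" using assms by (auto simp: overlap_iff)
  have cd: "c \<in> charts_at A ?p" "d \<in> charts_at A ?p" using u assms by (auto simp: charts_at_iff)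
  have "covec_comp A d ?p (covec A c ?p \<eta>) = transp (jacobian d c ?p) \<eta>"
    using covec_comp_change[OF cd cotangent_linear_on[OF covec_cotangent[OF cd(1)]]] cd by simp
  then show ?thesis
    by (simp add: transition_def[of "cot_chart A c"] chart_inv_cot[OF assms(1) u(1)] snd_cot_chart jacobian_def)
       (simp add: transition_def[of c d])
qed

lemma smooth_transition_cot:
  assumes "c \<in> A" "d \<in> A"
  shows "smooth_on (overlap c d \<times> UNIV) (transition (cot_chart A c) (cot_chart A d))"
proof -
  let ?S = "overlap c d \<times> (UNIV :: 'v set)"
  have S: "open ?S" by (simp add: open_Times open_overlap assms)
  have im: "transition c d ` overlap c d \<subseteq> overlap d c" using transition_mem[OF assms] by blast
  have 1: "smooth_on ?S (\<lambda>q. f (fst q))" if "smooth_on (overlap c d) f" for f :: "'v \<Rightarrow> 'v"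
    by (rule smooth_on_compose[OF S open_overlap[OF assms] _ that]) (auto intro: smooth_on_fst smooth_on_ident S)
  have "smooth_on (overlap c d) (\<lambda>u. frechet_derivative (transition d c) (at (transition c d u)) b)" for b
    by (rule smooth_on_compose[OF open_overlap[OF assms] open_overlap[OF assms(2,1)] im _ smooth_transition[OF assms]])
       (rule smooth_on_frechet[OF smooth_transition[OF assms(2,1)]])
  note 2 = 1[OF this]
  have "smooth_on ?S (\<lambda>q. (transition c d (fst q), transp (frechet_derivative (transition d c) (at (transition c d (fst q)))) (snd q)))"
    unfolding transp_def
    by (intro smooth_on_Pair smooth_on_sum smooth_on_scaleR smooth_on_inner smooth_on_snd smooth_on_ident smooth_on_const S 1[OF smooth_transition[OF assms]] 2)
  then show ?thesis
    by (subst smooth_on_cong[OF S]) (auto simp: transition_cot[OF assms])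
qed

lemma atlas_cot: "atlas N"
proof
  fix c' d' assume c': "c' \<in> N" and d': "d' \<in> N"
  then obtain c d where cd: "c \<in> A" "d \<in> A" and eq: "c' = cot_chart A c" "d' = cot_chart A d"
    by (auto simp: cotangent_bundle_def)
  show "open (overlap c' d')" unfolding eq overlap_cot[OF cd] by (simp add: open_Times open_overlap cd)
  show "smooth_on (overlap c' d') (transition c' d')"
    unfolding eq overlap_cot[OF cd] by (rule smooth_transition_cot[OF cd])
next
  fix c' assume "c' \<in> N"
  then obtain c where c: "c \<in> A" and eq: "c' = cot_chart A c"
    by (auto simp: cotangent_bundle_def)
  show "inj_on (snd c') (fst c')" unfolding eq by (rule inj_cot_chart[OF c])
  show "open (chart_img c')" unfolding eq chart_img_cot[OF c] by (simp add: open_Times open_chart_img c)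
qed

lemma cot_chart_mem: "c \<in> charts_at A p \<Longrightarrow> \<omega> \<in> cotangent_space A p \<Longrightarrow> cot_chart A c \<in> charts_at N (p, \<omega>)"
  by (auto simp: charts_at_iff cotangent_bundle_def fst_cot_chart)

end

sublocale manifold \<subseteq> cot: atlas "cotangent_bundle A"
  by (rule atlas_cot)

section \<open>The cotangent bundle as a manifold\<close>

context manifold
begin

text \<open>Continuity of the bundle projection, in the form that separates points over different
  base points.\<close>

lemma openin_cot_vimage:
  assumes "openin (manifold_topology A) U"
  shows "openin (manifold_topology N) {q \<in> points N. fst q \<in> U}"
  unfolding cot.openin_atlas
proof (intro conjI ballI)
  fix c' assume "c' \<in> N"
  then obtain c where c: "c \<in> A" and eq: "c' = cot_chart A c"
    by (auto simp: cotangent_bundle_def)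
  have "snd c' ` ({q \<in> points N. fst q \<in> U} \<inter> fst c') = {u \<in> chart_img c. chart_inv c u \<in> U} \<times> UNIV"
    (is "?l = ?r")
  proof (rule set_eqI)
    fix q :: "'v \<times> 'v"
    obtain u \<eta> where q: "q = (u, \<eta>)" by (cases q)
    show "q \<in> ?l \<longleftrightarrow> q \<in> ?r"
    proof
      assume "q \<in> ?l"
      then show "q \<in> ?r" using c by (auto simp: eq fst_cot_chart snd_cot_chart)
    next
      assume "q \<in> ?r"
      then have u: "u \<in> chart_img c" "chart_inv c u \<in> U" using q by auto
      show "q \<in> ?l"
        by (rule image_eqI[of _ _ "(chart_inv c u, covec A c (chart_inv c u) \<eta>)"])
           (use u c in \<open>auto simp: q eq fst_cot_chart snd_cot_chart points_cot intro: covec_cotangent\<close>)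
    qed
  qed
  then show "open (snd c' ` ({q \<in> points N. fst q \<in> U} \<inter> fst c'))"
    using open_in_chart[OF assms c] by (simp add: open_Times)
qed auto

text \<open>Points over different base points are separated by preimages of base neighbourhoods; two
  points of one fibre lie in a common chart and are separated there.\<close>

lemma Hausdorff_cot: "Hausdorff_space (manifold_topology N)"
  unfolding Hausdorff_space_def
proof (intro allI impI; elim conjE)
  fix q q' assume q: "q \<in> topspace (manifold_topology N)" "q' \<in> topspace (manifold_topology N)" and neq: "q \<noteq> q'"
  then obtain p \<omega> p' \<omega>' where qq: "q = (p, \<omega>)" "q' = (p', \<omega>')" and
    p: "p \<in> points A" "p' \<in> points A" and \<omega>: "\<omega> \<in> cotangent_space A p" "\<omega>' \<in> cotangent_space A p'"
    by (cases q, cases q') (auto simp: points_cot)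
  show "\<exists>U V. openin (manifold_topology N) U \<and> openin (manifold_topology N) V \<and> q \<in> U \<and> q' \<in> V \<and> disjnt U V"
  proof (cases "p = p'")
    case False
    have "Hausdorff_space (manifold_topology A)" using smooth_manifold by (simp add: smooth_manifold_def)
    then obtain U V where UV: "openin (manifold_topology A) U" "openin (manifold_topology A) V" "p \<in> U" "p' \<in> V" "disjnt U V"
      using p False unfolding Hausdorff_space_def topspace_atlas by blast
    then show ?thesis
      using q by (intro exI[of _ "{q \<in> points N. fst q \<in> U}"] exI[of _ "{q \<in> points N. fst q \<in> V}"])
        (auto simp: openin_cot_vimage qq disjnt_iff)
  next
    case True
    obtain c where c: "c \<in> charts_at A p" using p points_iff by blast
    have C: "cot_chart A c \<in> charts_at N q" "cot_chart A c \<in> charts_at N q'"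
      using cot_chart_mem[OF c] \<omega> qq True by auto
    then have CN: "cot_chart A c \<in> N" "q \<in> fst (cot_chart A c)" "q' \<in> fst (cot_chart A c)" by (auto simp: charts_at_iff)
    let ?s = "snd (cot_chart A c)"
    have "?s q \<noteq> ?s q'" using neq CN cot.chart_inv_snd by metis
    then obtain U V where UV: "open U" "open V" "?s q \<in> U" "?s q' \<in> V" "U \<inter> V = {}"
      using hausdorff by metis
    let ?I = "chart_img (cot_chart A c)" and ?i = "chart_inv (cot_chart A c)"
    have "openin (manifold_topology N) (?i ` (U \<inter> ?I))" "openin (manifold_topology N) (?i ` (V \<inter> ?I))"
      using UV cot.open_chart_img[OF CN(1)] by (auto intro!: cot.openin_chart CN(1))
    moreover have "q \<in> ?i ` (U \<inter> ?I)" "q' \<in> ?i ` (V \<inter> ?I)"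
      using UV CN image_eqI[of q ?i "?s q" "U \<inter> ?I"] image_eqI[of q' ?i "?s q'" "V \<inter> ?I"] by auto
    moreover have "disjnt (?i ` (U \<inter> ?I)) (?i ` (V \<inter> ?I))"
    proof (unfold disjnt_iff, intro allI notI, elim conjE imageE)
      fix x w w' assume "x = ?i w" "w \<in> U \<inter> ?I" "x = ?i w'" "w' \<in> V \<inter> ?I"
      then have "w = ?s x" "w' = ?s x" "w \<in> U" "w' \<in> V"
        using cot.snd_chart_inv[of w "cot_chart A c"] cot.snd_chart_inv[of w' "cot_chart A c"] by simp_all
      then show False using UV(5) by blast
    qed
    ultimately show ?thesis by blast
  qed
qed

text \<open>The atlas may be uncountable. The Lindelof property extracts countably many chart
  domains covering the manifold, and each contributes the images of a countable base of the model
  space.\<close>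

lemma second_countable_cot: "second_countable (manifold_topology N)"
proof -
  have sc: "second_countable (manifold_topology A)" using smooth_manifold by (simp add: smooth_manifold_def)
  have "\<exists>\<V>. countable \<V> \<and> \<V> \<subseteq> fst ` A \<and> \<Union>\<V> = topspace (manifold_topology A)"
  proof (rule Lindelof_spaceD[OF second_countable_imp_Lindelof_space[OF sc]])
    show "openin (manifold_topology A) U" if "U \<in> fst ` A" for U
      using that openin_chart_domain by blast
    show "\<Union>(fst ` A) = topspace (manifold_topology A)"
      by (simp only: topspace_atlas points_def)
  qed
  then obtain C where C: "C \<subseteq> A" "countable C" "\<Union>(fst ` C) = points A"
    using countable_subset_image[of _ fst A] by (metis topspace_atlas)
  obtain \<B> :: "('v \<times> 'v) set set" where \<B>: "countable \<B>" "\<And>B. B \<in> \<B> \<Longrightarrow> open B"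
    "\<And>S. open S \<Longrightarrow> \<exists>U. U \<subseteq> \<B> \<and> S = \<Union>U"
    by (rule univ_second_countable) blast
  define F where "F = (\<lambda>(c, B). chart_inv (cot_chart A c) ` (B \<inter> chart_img (cot_chart A c)))"
  have inN: "cot_chart A c \<in> N" if "c \<in> C" for c using that C by (auto simp: cotangent_bundle_def)
  show ?thesis
    unfolding second_countable_def
  proof (intro exI[of _ "F ` (C \<times> \<B>)"] conjI ballI allI impI; (elim conjE)?)
    show "countable (F ` (C \<times> \<B>))" using C \<B> by auto
    fix V assume "V \<in> F ` (C \<times> \<B>)"
    then obtain c B where "c \<in> C" "B \<in> \<B>" "V = chart_inv (cot_chart A c) ` (B \<inter> chart_img (cot_chart A c))"
      by (auto simp: F_def)
    then show "openin (manifold_topology N) V"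
      using inN[of c] \<B>(2)[of B] cot.open_chart_img[of "cot_chart A c"]
      by (simp add: cot.openin_chart open_Int)
  next
    fix W q assume W: "openin (manifold_topology N) W" "q \<in> W"
    then have "q \<in> points N" using openin_subset by fastforce
    then obtain p \<omega> where q: "q = (p, \<omega>)" "p \<in> points A" "\<omega> \<in> cotangent_space A p"
      by (cases q) (auto simp: points_cot)
    then obtain c where c: "c \<in> C" "p \<in> fst c" using C by blast
    let ?c = "cot_chart A c"
    have qc: "q \<in> fst ?c" using c q by (simp add: fst_cot_chart)
    have "open {w \<in> chart_img ?c. chart_inv ?c w \<in> W}" by (rule cot.open_in_chart[OF W(1) inN[OF c(1)]])
    moreover have "snd ?c q \<in> {w \<in> chart_img ?c. chart_inv ?c w \<in> W}" using qc W(2) inN[OF c(1)] by simp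
    moreover from \<B>(3)[OF calculation(1)] obtain U where "U \<subseteq> \<B>" "{w \<in> chart_img ?c. chart_inv ?c w \<in> W} = \<Union>U"
      by (elim exE conjE)
    ultimately obtain B where B: "B \<in> \<B>" "snd ?c q \<in> B" "B \<subseteq> {w \<in> chart_img ?c. chart_inv ?c w \<in> W}"
      by blast
    show "\<exists>V\<in>F ` (C \<times> \<B>). q \<in> V \<and> V \<subseteq> W"
    proof (intro bexI[of _ "F (c, B)"] conjI)
      show "q \<in> F (c, B)"
        unfolding F_def using B qc inN[OF c(1)] by (auto intro!: image_eqI[of _ _ "snd ?c q"])
      show "F (c, B) \<subseteq> W" using B by (auto simp: F_def)
    qed (use c B in auto)
  qed
qed

theorem smooth_manifold_cot: "smooth_manifold N"
  unfolding smooth_manifold_def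
  using cot.inj_chart cot.open_chart_img cot.open_overlap cot.smooth_transition Hausdorff_cot second_countable_cot
  by (simp add: overlap_def)

section \<open>Lifts in arbitrary induced charts\<close>

text \<open>The fibre component is the adjoint Jacobian of the reverse transition, evaluated along
  the forward one. Differentiating it in the base direction gives the term with second
  derivatives.\<close>

lemma jacobian_cot:
  assumes c: "c \<in> charts_at A p" and d: "d \<in> charts_at A p" and \<omega>: "\<omega> \<in> cotangent_space A p"
  shows "jacobian (cot_chart A c) (cot_chart A d) (p, \<omega>) Z =
    (jacobian c d p (fst Z),
     transp (\<lambda>b. frechet_derivative (\<lambda>w. frechet_derivative (transition d c) (at w) b) (at (snd d p)) (jacobian c d p (fst Z)))
       (covec_comp A c p \<omega>) + transp (jacobian d c p) (snd Z))"
proof -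
  have A: "c \<in> A" "d \<in> A" "p \<in> fst c" "p \<in> fst d" using c d by (auto simp: charts_at_iff)
  let ?\<phi> = "transition c d" and ?\<psi> = "transition d c" and ?u = "snd c p" and ?\<eta> = "covec_comp A c p \<omega>"
  let ?D2 = "\<lambda>b. frechet_derivative (\<lambda>w. frechet_derivative ?\<psi> (at w) b) (at (snd d p))"
  have S: "open (overlap c d \<times> (UNIV :: 'v set))" by (simp add: open_Times open_overlap A)
  have u: "(?u, ?\<eta>) \<in> overlap c d \<times> UNIV" using snd_overlap[OF c d] by simp
  have \<phi>u: "?\<phi> ?u = snd d p" using transition_snd[OF A(1,3)] .
  have "((\<lambda>w. frechet_derivative ?\<psi> (at w) b) has_derivative ?D2 b) (at (?\<phi> ?u))" for b
    unfolding \<phi>u by (rule smooth_on_has_derivative[OF smooth_on_frechet[OF smooth_transition[OF A(2,1)]] snd_overlap[OF d c]])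
  note D2 = has_derivative_fst_compose[OF has_derivative_compose[OF transition_has_derivative[OF c d] this]]
  have "((\<lambda>q. (?\<phi> (fst q), transp (frechet_derivative ?\<psi> (at (?\<phi> (fst q)))) (snd q))) has_derivative
    (\<lambda>Z. (jacobian c d p (fst Z), transp (\<lambda>b. ?D2 b (jacobian c d p (fst Z))) ?\<eta> + transp (jacobian d c p) (snd Z)))) (at (?u, ?\<eta>))"
    unfolding transp_def
    by (auto intro!: derivative_eq_intros has_derivative_fst_compose[OF transition_has_derivative[OF c d]] D2
        simp: jacobian_def[of d c] \<phi>u sum.distrib[symmetric] scaleR_add_left)
  then have "(transition (cot_chart A c) (cot_chart A d) has_derivative
    (\<lambda>Z. (jacobian c d p (fst Z), transp (\<lambda>b. ?D2 b (jacobian c d p (fst Z))) ?\<eta> + transp (jacobian d c p) (snd Z)))) (at (?u, ?\<eta>))"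
    by (rule has_derivative_transform_within_open[OF _ S u]) (auto simp: transition_cot[OF A(1,2)])
  then show ?thesis
    by (simp add: jacobian_def[of "cot_chart A c"] snd_cot_chart frechet_derivative_eq)
qed

text \<open>A vertical vector has no base component, which kills the second-derivative part of the
  Jacobian, so the selected chart can be traded for any other. The hypothesis on
  \<open>\<xi>\<close> is linearity on the tangent space, as the covector in
  \<open>contracted\<close> may be nonzero off that space.\<close>

lemma vertical_vec_chart:
  assumes c: "c \<in> charts_at A p" and \<omega>: "\<omega> \<in> cotangent_space A p" and \<xi>: "linear_on (tangent_space A p) \<xi>"
  shows "vertical_vec A (p, \<omega>) \<xi> = of_chart N (cot_chart A c) (p, \<omega>) (0, covec_comp A c p \<xi>)"
proof -
  let ?d = "chart_at A p"
  have d: "?d \<in> charts_at A p" using chart_at charts_at_points c by blast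
  have "transp (\<lambda>b. frechet_derivative (\<lambda>w. frechet_derivative (transition ?d c) (at w) b) (at (snd ?d p)) (jacobian c ?d p 0)) y = 0" for y
  proof -
    have A: "c \<in> A" "?d \<in> A" using c d by (auto simp: charts_at_iff)
    have "linear (frechet_derivative (\<lambda>w. frechet_derivative (transition ?d c) (at w) b) (at (snd ?d p)))" for b
      by (rule smooth_on_linear_frechet[OF smooth_on_frechet[OF smooth_transition[OF A(2,1)]] snd_overlap[OF d c]])
    then show ?thesis by (simp add: transp_def linear_0 linear_0[OF linear_jacobian[OF c d]])
  qed
  then have "jacobian (cot_chart A c) (cot_chart A ?d) (p, \<omega>) (0, covec_comp A c p \<xi>) = (0, covec_comp A ?d p \<xi>)"
    by (simp add: jacobian_cot[OF c d \<omega>] linear_0[OF linear_jacobian[OF c d]] covec_comp_change[OF c d \<xi>])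
  then show ?thesis
    using cot.of_chart_change[OF cot_chart_mem[OF c \<omega>] cot_chart_mem[OF d \<omega>], of "(0, covec_comp A c p \<xi>)"]
    by (simp add: vertical_vec_def Let_def)
qed

text \<open>The change of the derivative of \<open>X\<close> and the Jacobian of the cotangent
  bundle both produce second derivatives of the transition; they cancel, so the formula of the
  selected chart holds in every chart.\<close>

lemma complete_lift_chart:
  assumes c: "c \<in> charts_at A p" and \<omega>: "\<omega> \<in> cotangent_space A p" and X: "vector_field A X"
  shows "complete_lift A X (p, \<omega>) = of_chart N (cot_chart A c) (p, \<omega>)
    (X p c, - transp (frechet_derivative (\<lambda>u. X (chart_inv c u) c) (at (snd c p))) (covec_comp A c p \<omega>))"
proof -
  let ?d = "chart_at A p"
  have p: "p \<in> points A" using charts_at_points[OF c] .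
  have d: "?d \<in> charts_at A p" using chart_at[OF p] .
  have A: "c \<in> A" "?d \<in> A" using c d by (auto simp: charts_at_iff)
  let ?DX = "\<lambda>c. frechet_derivative (\<lambda>u. X (chart_inv c u) c) (at (snd c p))"
  let ?\<eta> = "\<lambda>c. covec_comp A c p \<omega>" and ?J = "jacobian c ?d p"
  let ?D2 = "\<lambda>b. frechet_derivative (\<lambda>w. frechet_derivative (transition c ?d) (at w) b) (at (snd c p))"
  have lin: "linear (?D2 b)" for b
    by (rule smooth_on_linear_frechet[OF smooth_on_frechet[OF smooth_transition[OF A(1,2)]] snd_overlap[OF c d]])
  have sym: "?D2 b z = ?D2 z b" for b z
    by (rule second_derivative_symmetric[OF open_overlap[OF A] snd_overlap[OF c d] smooth_transition[OF A]])
  have linX: "linear (?DX c)" if "c \<in> charts_at A p" for c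
    using has_derivative_linear[OF vector_field_has_derivative[OF X that]] .
  have lin2: "linear (\<lambda>b. ?D2 b (X p c))" unfolding sym[of _ "X p c"] by (rule lin)
  have Xc: "jacobian ?d c p (X p ?d) = X p c"
    using tangent_apply[OF vector_field_tangent[OF X p] d c] by simp
  have "transp (\<lambda>b. ?D2 b (X p c)) (?\<eta> ?d) + transp ?J (- transp (?DX ?d) (?\<eta> ?d)) = - transp (?DX c) (?\<eta> c)"
  proof (rule vector_eq_rdot[THEN iffD1], rule allI)
    fix w
    have "?DX ?d (?J w) = ?D2 (X p c) w + ?J (?DX c w)"
      using field_change[OF c d X of_chart_tangent[OF c], of w] by (simp add: of_chart_apply[OF d] c)
    then show "(transp (\<lambda>b. ?D2 b (X p c)) (?\<eta> ?d) + transp ?J (- transp (?DX ?d) (?\<eta> ?d))) \<bullet> w = (- transp (?DX c) (?\<eta> c)) \<bullet> w"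
      by (simp add: inner_add_left transp_inner lin2 linX c d linear_jacobian[OF c d] sym[of w]
          covec_comp_change[OF d c cotangent_linear_on[OF \<omega>]] inner_add_right)
  qed
  then have "jacobian (cot_chart A ?d) (cot_chart A c) (p, \<omega>) (X p ?d, - transp (?DX ?d) (?\<eta> ?d)) = (X p c, - transp (?DX c) (?\<eta> c))"
    by (simp add: jacobian_cot[OF d c \<omega>] Xc)
  then show ?thesis
    using cot.of_chart_change[OF cot_chart_mem[OF d \<omega>] cot_chart_mem[OF c \<omega>], of "(X p ?d, - transp (?DX ?d) (?\<eta> ?d))"]
    by (simp add: complete_lift_def Let_def transp_def)
qed

text \<open>A cutoff times the covector with constant components \<open>\<eta>\<close>; it provides
  the 1-form whose vertical lift realises a given vertical vector.\<close>

lemma one_form_exists: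
  assumes c: "c \<in> charts_at A p"
  obtains \<alpha> where "one_form A \<alpha>" "\<alpha> p = covec A c p \<eta>"
proof -
  have cA: "c \<in> A" using c by (simp add: charts_at_iff)
  obtain W where W: "cutoff_on A (fst c) (bump_at c p)" "p \<in> W" "\<And>q. q \<in> W \<Longrightarrow> bump_at c p q = 1"
    by (rule bump_at[OF c]) blast
  define \<alpha> where "\<alpha> q = (\<lambda>v. bump_at c p q * covec A c q \<eta> v)" for q
  have "one_form A \<alpha>"
    unfolding one_form_def
  proof (intro conjI ballI allI)
    fix q assume "q \<in> points A"
    show "\<alpha> q \<in> cotangent_space A q"
    proof (cases "q \<in> fst c")
      case True
      then have "covec A c q \<eta> \<in> cotangent_space A q" using cA by (intro covec_cotangent) (simp add: charts_at_iff)
      then show ?thesis by (simp add: \<alpha>_def cotangent_space_def linear_on_def algebra_simps)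
    next
      case False
      then show ?thesis using cutoff_zero[OF W(1)] by (simp add: \<alpha>_def cotangent_space_def linear_on_def)
    qed
  next
    fix d w assume d: "d \<in> A"
    have "smooth_at A (\<lambda>q. \<alpha> q (of_chart A d q w)) q" if q: "q \<in> fst d" for q
    proof -
      have qA: "q \<in> points A" "d \<in> charts_at A q" using q d by (auto simp: points_def charts_at_iff)
      have "smooth_at A (\<lambda>q. bump_at c p q *\<^sub>R covec A c q \<eta> (of_chart A d q w)) q"
      proof (rule smooth_at_cutoff[OF W(1) qA(1)])
        assume "q \<in> fst c"
        then have cq: "c \<in> charts_at A q" using cA by (simp add: charts_at_iff)
        show "smooth_at A (\<lambda>q. covec A c q \<eta> (of_chart A d q w)) q"
        proof (rule smooth_at_cong)
          show "openin (manifold_topology A) (fst c \<inter> fst d)" by (rule openin_Int_charts[OF cA d])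
          show "q \<in> fst c \<inter> fst d" using q cq by (simp add: charts_at_iff)
          show "covec A c q' \<eta> (of_chart A d q' w) = \<eta> \<bullet> jacobian d c q' w" if "q' \<in> fst c \<inter> fst d" for q'
            using that cA d by (simp add: covec_def of_chart_tangent of_chart_apply charts_at_iff)
          show "smooth_at A (\<lambda>q. \<eta> \<bullet> jacobian d c q w) q"
            by (intro smooth_at_inner smooth_at_const smooth_at_jacobian qA cq)
        qed
      qed
      then show ?thesis by (simp add: \<alpha>_def)
    qed
    then show "smooth_on (chart_img d) (\<lambda>u. \<alpha> (chart_inv d u) (of_chart A d (chart_inv d u) w))"
      using smooth_on_chart_iff[OF d, of "\<lambda>q. \<alpha> q (of_chart A d q w)"] by simp
  qed
  moreover have "\<alpha> p = covec A c p \<eta>" using W by (simp add: \<alpha>_def)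
  ultimately show ?thesis by (rule that)
qed

end

section \<open>The Riemann extension in coordinates\<close>

lemma transp_zero [simp]: "transp (\<lambda>_. 0) y = 0"
  by (simp add: transp_def)

locale local_extension =
  fixes S :: "'v::euclidean_space set" and \<Gamma> :: "'v \<Rightarrow> 'v \<Rightarrow> 'v \<Rightarrow> 'v" and a :: real
    and G :: "'v \<times> 'v \<Rightarrow> 'v \<times> 'v \<Rightarrow> 'v \<times> 'v \<Rightarrow> real" and P :: "'v \<times> 'v \<Rightarrow> 'v \<times> 'v \<Rightarrow> 'v \<times> 'v"
  assumes open_S: "open S" and a: "a > 0"
    and bilinear_\<Gamma>: "u \<in> S \<Longrightarrow> bilinear (\<Gamma> u)"
    and \<Gamma>_commute: "u \<in> S \<Longrightarrow> \<Gamma> u x y = \<Gamma> u y x"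
    and smooth_\<Gamma>: "smooth_on S (\<lambda>u. \<Gamma> u x y)"
    and G: "u \<in> S \<Longrightarrow> G (u, \<eta>) X Y = a * (fst X \<bullet> snd Y + fst Y \<bullet> snd X - 2 * (\<eta> \<bullet> \<Gamma> u (fst X) (fst Y)))"
    and P: "u \<in> S \<Longrightarrow> P (u, \<eta>) X = (fst X, 2 *\<^sub>R transp (\<lambda>b. \<Gamma> u b (fst X)) \<eta> - snd X)"
begin

lemma open_SU: "open (S \<times> UNIV)"
  by (simp add: open_Times open_S)

lemmas \<Gamma>_simps = bilinear_ladd[OF bilinear_\<Gamma>] bilinear_lmul[OF bilinear_\<Gamma>] bilinear_radd[OF bilinear_\<Gamma>]
  bilinear_rmul[OF bilinear_\<Gamma>] bilinear_lzero[OF bilinear_\<Gamma>] bilinear_rzero[OF bilinear_\<Gamma>]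

lemma linear_\<Gamma>: "u \<in> S \<Longrightarrow> linear (\<Gamma> u x)" "u \<in> S \<Longrightarrow> linear (\<lambda>b. \<Gamma> u b x)"
  using bilinear_\<Gamma> by (simp_all add: bilinear_def)

definition d\<Gamma> :: "'v \<Rightarrow> 'v \<Rightarrow> 'v \<Rightarrow> 'v \<Rightarrow> 'v"
  where "d\<Gamma> u z x y = frechet_derivative (\<lambda>u. \<Gamma> u x y) (at u) z"

lemma bilinear_d\<Gamma>: "u \<in> S \<Longrightarrow> bilinear (d\<Gamma> u z)"
  unfolding d\<Gamma>_def by (rule bilinear_frechet_param[OF open_S _ bilinear_\<Gamma> smooth_on_differentiable[OF smooth_\<Gamma>]])

lemma has_derivative_\<Gamma>: "u \<in> S \<Longrightarrow> ((\<lambda>u. \<Gamma> u x y) has_derivative (\<lambda>z. d\<Gamma> u z x y)) (at u)"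
  unfolding d\<Gamma>_def using smooth_on_has_derivative[OF smooth_\<Gamma>] .

lemma linear_d\<Gamma>: "u \<in> S \<Longrightarrow> linear (\<lambda>z. d\<Gamma> u z x y)" "u \<in> S \<Longrightarrow> linear (\<lambda>x. d\<Gamma> u z x y)" "u \<in> S \<Longrightarrow> linear (\<lambda>y. d\<Gamma> u z x y)"
  using has_derivative_linear[OF has_derivative_\<Gamma>] bilinear_d\<Gamma>[of u z] by (simp_all add: bilinear_def)

lemma d\<Gamma>_commute:
  assumes "u \<in> S"
  shows "d\<Gamma> u z x y = d\<Gamma> u z y x"
proof -
  have "((\<lambda>u. \<Gamma> u x y) has_derivative (\<lambda>z. d\<Gamma> u z y x)) (at u)"
    by (rule has_derivative_transform_within_open[OF has_derivative_\<Gamma> open_S])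
       (use assms \<Gamma>_commute in auto)
  then show ?thesis by (simp add: d\<Gamma>_def frechet_derivative_eq)
qed

lemma smooth_\<Gamma>_fst:
  "smooth_on (S \<times> UNIV) (\<lambda>q. \<Gamma> (fst q) x y)" "smooth_on (S \<times> UNIV) (\<lambda>q. d\<Gamma> (fst q) z x y)"
  unfolding d\<Gamma>_def
  by (rule smooth_on_compose[OF open_SU open_S]; auto intro: smooth_\<Gamma> smooth_on_frechet smooth_on_fst smooth_on_ident open_SU)+

lemma bilinear_G: "u \<in> S \<Longrightarrow> bilinear (G (u, \<eta>))"
  unfolding bilinear_def by (auto intro!: linearI simp: G \<Gamma>_simps inner_add_left inner_add_right algebra_simps)

sublocale local_metric "S \<times> UNIV" G
proof
  show "open (S \<times> (UNIV :: 'v set))" by (rule open_SU)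
  fix q :: "'v \<times> 'v" and X Y :: "'v \<times> 'v" assume q: "q \<in> S \<times> UNIV"
  then obtain u \<eta> where u: "q = (u, \<eta>)" "u \<in> S" by blast
  show "bilinear (G q)" using bilinear_G u by simp
  show "G q X Y = G q Y X" by (simp add: u G \<Gamma>_commute[OF u(2), of "fst X" "fst Y"])
  show "X = 0" if "\<And>W. G q X W = 0"
  proof -
    \<comment> \<open>Pairing with vertical vectors isolates the base component, for
      \<open>\<Gamma>\<close> enters only through base components.\<close>
    have "fst X \<bullet> fst X = 0" using that[of "(0, fst X)"] a by (simp add: u G \<Gamma>_simps)
    then have x: "fst X = 0" by simp
    have "snd X \<bullet> snd X = 0" using that[of "(snd X, 0)"] a x by (simp add: u G \<Gamma>_simps)
    then show ?thesis using x by (simp add: prod_eq_iff)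
  qed
next
  fix X Y
  have "smooth_on (S \<times> UNIV) (\<lambda>q. a * (fst X \<bullet> snd Y + fst Y \<bullet> snd X - 2 * (snd q \<bullet> \<Gamma> (fst q) (fst X) (fst Y))))"
    by (intro smooth_on_mult smooth_on_diff smooth_on_inner smooth_on_const smooth_\<Gamma>_fst smooth_on_snd smooth_on_ident open_SU)
  then show "smooth_on (S \<times> UNIV) (\<lambda>q. G q X Y)"
    by (subst smooth_on_cong[OF open_SU]) (auto simp: G)
qed

lemma derivative_G:
  assumes u: "u \<in> S"
  shows "dG (u, \<eta>) Z X Y = - 2 * a * (snd Z \<bullet> \<Gamma> u (fst X) (fst Y) + \<eta> \<bullet> d\<Gamma> u (fst Z) (fst X) (fst Y))"
proof -
  have "((\<lambda>q. a * (fst X \<bullet> snd Y + fst Y \<bullet> snd X - 2 * (snd q \<bullet> \<Gamma> (fst q) (fst X) (fst Y)))) has_derivative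
      (\<lambda>Z. - 2 * a * (snd Z \<bullet> \<Gamma> u (fst X) (fst Y) + \<eta> \<bullet> d\<Gamma> u (fst Z) (fst X) (fst Y)))) (at (u, \<eta>))"
    by (auto intro!: derivative_eq_intros has_derivative_fst_compose[OF has_derivative_\<Gamma>[OF u]] simp: algebra_simps)
  then have "((\<lambda>q. G q X Y) has_derivative
      (\<lambda>Z. - 2 * a * (snd Z \<bullet> \<Gamma> u (fst X) (fst Y) + \<eta> \<bullet> d\<Gamma> u (fst Z) (fst X) (fst Y)))) (at (u, \<eta>))"
    by (rule has_derivative_transform_within_open[OF _ open_SU]) (use u in \<open>auto simp: G\<close>)
  then show ?thesis by (simp add: frechet_derivative_eq)
qed

text \<open>Fibre part of the Christoffel symbol of \<open>G\<close>, paired with \<open>w\<close>;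
  found by solving the Koszul formula against the test vector \<open>(w, 0)\<close>.\<close>

definition vert :: "'v \<Rightarrow> 'v \<Rightarrow> 'v \<times> 'v \<Rightarrow> 'v \<times> 'v \<Rightarrow> 'v \<Rightarrow> real"
  where "vert u \<eta> X Y w = 2 * (\<eta> \<bullet> \<Gamma> u (\<Gamma> u (fst X) (fst Y)) w) - snd X \<bullet> \<Gamma> u (fst Y) w - snd Y \<bullet> \<Gamma> u (fst X) w
    - \<eta> \<bullet> (d\<Gamma> u (fst X) (fst Y) w + d\<Gamma> u (fst Y) (fst X) w - d\<Gamma> u w (fst X) (fst Y))"

lemma linear_vert:
  assumes u: "u \<in> S"
  shows "linear (vert u \<eta> X Y)"
  by (rule linearI)
     (simp_all add: vert_def \<Gamma>_simps u linear_add[OF linear_d\<Gamma>(1)[OF u]] linear_add[OF linear_d\<Gamma>(3)[OF u]]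
       linear_scale[OF linear_d\<Gamma>(1)[OF u]] linear_scale[OF linear_d\<Gamma>(3)[OF u]] inner_add_right inner_diff_right algebra_simps)

text \<open>Vertical test vectors see only \<open>\<Gamma>\<close>, which fixes the base part;
  horizontal ones determine the fibre part. Linearity of \<open>vert\<close> in \<open>w\<close>
  turns its values on a basis into a vector.\<close>

lemma christoffel_G:
  assumes u: "u \<in> S"
  shows "christoffel G (u, \<eta>) X Y = (\<Gamma> u (fst X) (fst Y), \<Sum>b\<in>Basis. vert u \<eta> X Y b *\<^sub>R b)"
proof -
  have v: "w \<bullet> (\<Sum>b\<in>Basis. vert u \<eta> X Y b *\<^sub>R b) = vert u \<eta> X Y w" for w
    using linear_Basis_sum[OF linear_vert[OF u], of \<eta> X Y w] by (simp add: inner_sum_right mult.commute)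
  show ?thesis
  proof (rule christoffel_eqI)
    show "(u, \<eta>) \<in> S \<times> UNIV" using u by simp
    fix W
    show "2 * G (u, \<eta>) (\<Gamma> u (fst X) (fst Y), \<Sum>b\<in>Basis. vert u \<eta> X Y b *\<^sub>R b) W = koszul G (u, \<eta>) X Y W"
      by (simp add: G[OF u] koszul_def derivative_G[OF u] v)
         (simp add: vert_def inner_add_right inner_diff_right algebra_simps inner_commute[of "snd W"])
  qed
qed

text \<open>The explicit formula supplies the smoothness hypothesis of
  \<open>levi_civita_LC\<close>.\<close>

lemma smooth_christoffel_G: "smooth_on (S \<times> UNIV) (\<lambda>q. christoffel G q X Y)"
proof -
  have 1: "smooth_on (S \<times> UNIV) (\<lambda>q. \<Gamma> (fst q) (\<Gamma> (fst q) x y) w)" for x y w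
    by (rule smooth_on_apply_linear[of _ "\<lambda>q z. \<Gamma> (fst q) z w"])
       (auto intro: open_SU linear_\<Gamma> smooth_\<Gamma>_fst)
  have 2: "smooth_on (S \<times> UNIV) (\<lambda>q. vert (fst q) (snd q) X Y b)" for b
    unfolding vert_def
    by (intro smooth_on_mult smooth_on_diff smooth_on_add smooth_on_inner smooth_on_const smooth_\<Gamma>_fst 1
        smooth_on_snd smooth_on_ident open_SU)
  have "smooth_on (S \<times> UNIV) (\<lambda>q. (\<Gamma> (fst q) (fst X) (fst Y), \<Sum>b\<in>Basis. vert (fst q) (snd q) X Y b *\<^sub>R b))"
    by (intro smooth_on_Pair smooth_on_sum smooth_on_scaleR smooth_on_const 2 smooth_\<Gamma>_fst open_SU)
  then show ?thesis
    by (subst smooth_on_cong[OF open_SU]) (auto simp: christoffel_G)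
qed

text \<open>Coordinate form of the curvature \<open>R(w, x) z\<close> of the connection on the
  base.\<close>

definition curv :: "'v \<Rightarrow> 'v \<Rightarrow> 'v \<Rightarrow> 'v \<Rightarrow> 'v"
  where "curv u w x z = d\<Gamma> u w x z - d\<Gamma> u x w z + \<Gamma> u w (\<Gamma> u x z) - \<Gamma> u x (\<Gamma> u w z)"

lemma linear_curv:
  assumes u: "u \<in> S"
  shows "linear (\<lambda>w. curv u w x z)"
  by (rule linearI)
     (simp_all add: curv_def \<Gamma>_simps u linear_add[OF linear_d\<Gamma>(1)[OF u]] linear_add[OF linear_d\<Gamma>(2)[OF u]]
       linear_scale[OF linear_d\<Gamma>(1)[OF u]] linear_scale[OF linear_d\<Gamma>(2)[OF u]] algebra_simps)

lemma derivative_P: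
  assumes u: "u \<in> S"
  shows "frechet_derivative (\<lambda>q. P q X) (at (u, \<eta>)) Z =
    (0, 2 *\<^sub>R (transp (\<lambda>b. \<Gamma> u b (fst X)) (snd Z) + transp (\<lambda>b. d\<Gamma> u (fst Z) b (fst X)) \<eta>))"
proof -
  have "((\<lambda>q. (fst X, 2 *\<^sub>R transp (\<lambda>b. \<Gamma> (fst q) b (fst X)) (snd q) - snd X)) has_derivative
     (\<lambda>Z. (0, 2 *\<^sub>R (transp (\<lambda>b. \<Gamma> u b (fst X)) (snd Z) + transp (\<lambda>b. d\<Gamma> u (fst Z) b (fst X)) \<eta>)))) (at (u, \<eta>))"
    unfolding transp_def
    by (auto intro!: derivative_eq_intros has_derivative_fst_compose[OF has_derivative_\<Gamma>[OF u]]
        simp: sum.distrib[symmetric] scaleR_add_left add.commute)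
  then have "((\<lambda>q. P q X) has_derivative
     (\<lambda>Z. (0, 2 *\<^sub>R (transp (\<lambda>b. \<Gamma> u b (fst X)) (snd Z) + transp (\<lambda>b. d\<Gamma> u (fst Z) b (fst X)) \<eta>)))) (at (u, \<eta>))"
    by (rule has_derivative_transform_within_open[OF _ open_SU]) (use u in \<open>auto simp: P\<close>)
  then show ?thesis by (simp add: frechet_derivative_eq)
qed

text \<open>The fibre components of \<open>X\<close> and \<open>Z\<close> cancel, as do the
  derivatives of \<open>\<Gamma>\<close> in the direction \<open>fst Z\<close>; two derivative terms
  and two quadratic terms survive and form the curvature.\<close>

lemma nabla_P:
  assumes u: "u \<in> S"
  shows "frechet_derivative (\<lambda>q. P q X) (at (u, \<eta>)) Z + christoffel G (u, \<eta>) Z (P (u, \<eta>) X) - P (u, \<eta>) (christoffel G (u, \<eta>) Z X)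
    = (0, 2 *\<^sub>R transp (\<lambda>w. curv u w (fst X) (fst Z)) \<eta>)" (is "?l = ?r")
proof (rule prod_eqI)
  show "fst ?l = fst ?r" by (simp add: derivative_P[OF u] christoffel_G[OF u] P[OF u])
  show "snd ?l = snd ?r"
  proof (rule vector_eq_rdot[THEN iffD1], rule allI)
    fix w
    have v: "(\<Sum>b\<in>Basis. vert u \<eta> Z X b *\<^sub>R b) \<bullet> w = vert u \<eta> Z X w" for Z X
      using linear_Basis_sum[OF linear_vert[OF u], of \<eta> Z X w] by (simp add: inner_sum_left inner_commute[of w] mult.commute)
    let ?x = "fst X" and ?z = "fst Z"
    have e: "\<Gamma> u w ?x = \<Gamma> u ?x w" "\<Gamma> u w (\<Gamma> u ?z ?x) = \<Gamma> u (\<Gamma> u ?z ?x) w"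
      "\<Gamma> u w (\<Gamma> u ?x ?z) = \<Gamma> u (\<Gamma> u ?z ?x) w" "\<Gamma> u ?x (\<Gamma> u w ?z) = \<Gamma> u (\<Gamma> u ?z w) ?x"
      "d\<Gamma> u ?z w ?x = d\<Gamma> u ?z ?x w" "d\<Gamma> u w ?x ?z = d\<Gamma> u w ?z ?x" "d\<Gamma> u ?x w ?z = d\<Gamma> u ?x ?z w"
      using \<Gamma>_commute[OF u] d\<Gamma>_commute[OF u] by metis+
    have t: "transp (\<lambda>b. \<Gamma> u b x) y \<bullet> w = y \<bullet> \<Gamma> u w x" for x y w
      by (rule transp_inner[OF linear_\<Gamma>(2)[OF u]])
    show "snd ?l \<bullet> w = snd ?r \<bullet> w"
      by (simp add: derivative_P[OF u] christoffel_G[OF u] P[OF u] inner_add_left inner_diff_left v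
          t transp_inner[OF linear_d\<Gamma>(2)[OF u]] transp_inner[OF linear_curv[OF u]])
         (simp add: vert_def curv_def inner_add_left inner_diff_left t inner_add_right inner_diff_right e)
  qed
qed

lemma sharp_eqI:
  assumes "q \<in> S \<times> UNIV" "\<And>W. G q Z W = X \<bullet> W"
  shows "sharp (G q) X = Z"
  unfolding sharp_def
proof (rule the_equality)
  fix Z' assume "\<forall>W. G q Z' W = X \<bullet> W"
  then have "G q Z' W = G q Z W" for W using assms(2) by metis
  then show "Z' = Z" by (rule G_eqI[OF assms(1)])
qed (use assms in simp)

lemma trace_nabla_P:
  assumes u: "u \<in> S"
  shows "(\<Sum>B\<in>Basis. let B' = sharp (G (u, \<eta>)) B in
     frechet_derivative (\<lambda>q. P q B') (at (u, \<eta>)) B + christoffel G (u, \<eta>) B (P (u, \<eta>) B')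
       - P (u, \<eta>) (christoffel G (u, \<eta>) B B')) = 0"
proof -
  have q: "(u, \<eta>) \<in> S \<times> UNIV" using u by simp
  have 1: "fst (sharp (G (u, \<eta>)) (b, 0)) = 0" for b
  proof -
    \<comment> \<open>The factor \<open>1 / a\<close> inverts the pairing of horizontal with
      vertical directions.\<close>
    have "sharp (G (u, \<eta>)) (b, 0) = (0, (1 / a) *\<^sub>R b)"
      by (rule sharp_eqI[OF q]) (use a in \<open>simp add: G[OF u] \<Gamma>_simps u inner_prod_def inner_commute\<close>)
    then show ?thesis by simp
  qed
  have "curv u w 0 z = 0" "curv u w x 0 = 0" for w x z
    using u by (simp_all add: curv_def \<Gamma>_simps linear_0[OF linear_d\<Gamma>(1)] linear_0[OF linear_d\<Gamma>(2)] linear_0[OF linear_d\<Gamma>(3)])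
  then show ?thesis
    by (simp add: Let_def nabla_P[OF u] sum_Basis_prod_eq 1 sum.neutral zero_prod_def[symmetric])
qed

lemma G_P:
  assumes u: "u \<in> S"
  shows "G (u, \<eta>) X (P (u, \<eta>) Y) = a * (fst Y \<bullet> snd X - fst X \<bullet> snd Y)"
    "G (u, \<eta>) (P (u, \<eta>) X) (P (u, \<eta>) Y) = - G (u, \<eta>) X Y"
    "P (u, \<eta>) (P (u, \<eta>) X) = X"
proof -
  have t: "w \<bullet> transp (\<lambda>b. \<Gamma> u b x) \<eta> = \<eta> \<bullet> \<Gamma> u w x" for w x
    using transp_inner[OF linear_\<Gamma>(2)[OF u]] by (simp add: inner_commute)
  show "G (u, \<eta>) X (P (u, \<eta>) Y) = a * (fst Y \<bullet> snd X - fst X \<bullet> snd Y)"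
    "G (u, \<eta>) (P (u, \<eta>) X) (P (u, \<eta>) Y) = - G (u, \<eta>) X Y"
    by (simp_all add: G[OF u] P[OF u] inner_diff_right t \<Gamma>_commute[OF u, of "fst Y" "fst X"] algebra_simps)
  show "P (u, \<eta>) (P (u, \<eta>) X) = X" by (simp add: P[OF u])
qed

end

section \<open>The para-Hermitian structure\<close>

locale riemann_extension = connection A D for A :: "('a, 'v::euclidean_space) chart set" and D +
  fixes a :: real
    and g :: "('a \<times> ('a, 'v) covec, 'v \<times> 'v) bilin"
    and P :: "('a \<times> ('a, 'v) covec, 'v \<times> 'v) endo"
  assumes torsion: "torsion_free A D" and a: "a > 0"
    and extension: "nonproper_riemann_extension A D a g"
    and tensor_P: "tensor11 (cotangent_bundle A) P"
    and P_complete: "vector_field A X \<Longrightarrow> q \<in> points (cotangent_bundle A) \<Longrightarrow>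
      P q (complete_lift A X q) = complete_lift A X q + 2 *\<^sub>R contracted A (\<lambda>p v. D p v X) q"
    and P_vertical: "one_form A \<alpha> \<Longrightarrow> q \<in> points (cotangent_bundle A) \<Longrightarrow>
      P q (vertical_lift A \<alpha> q) = - vertical_lift A \<alpha> q"

section \<open>Metric and structure in induced charts\<close>

context riemann_extension
begin

interpretation cotm: manifold N
  by unfold_locales (rule smooth_manifold_cot)

lemma metric_tensor: "symmetric_tensor02 N g"
  using extension unfolding nonproper_riemann_extension_def by blast

lemma extension_values:
  assumes "(p, \<omega>) \<in> points N"
  shows "vector_field A X \<Longrightarrow> vector_field A Y \<Longrightarrow>
         g (p, \<omega>) (complete_lift A X (p, \<omega>)) (complete_lift A Y (p, \<omega>)) = - a * \<omega> (D p (X p) Y + D p (Y p) X)"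
    and "vector_field A X \<Longrightarrow> one_form A \<alpha> \<Longrightarrow>
         g (p, \<omega>) (complete_lift A X (p, \<omega>)) (vertical_lift A \<alpha> (p, \<omega>)) = a * \<alpha> p (X p)"
    and "one_form A \<alpha> \<Longrightarrow> one_form A \<beta> \<Longrightarrow>
         g (p, \<omega>) (vertical_lift A \<alpha> (p, \<omega>)) (vertical_lift A \<beta> (p, \<omega>)) = 0"
  using extension assms unfolding nonproper_riemann_extension_def by blast+

lemma horizontal_lift:
  assumes c: "c \<in> charts_at A p" and \<omega>: "\<omega> \<in> cotangent_space A p"
  shows "of_chart N (cot_chart A c) (p, \<omega>) (x, 0) = complete_lift A (coord_field c p x) (p, \<omega>)"
  using frechet_derivative_eq[OF coord_field_derivative[OF c, of x]]
  by (simp add: complete_lift_chart[OF c \<omega> vector_field_coord[OF c]] coord_field_at[OF c] of_chart_self[OF c])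

lemma vertical_lift_covec:
  assumes c: "c \<in> charts_at A p" and \<omega>: "\<omega> \<in> cotangent_space A p" and \<alpha>: "\<alpha> p = covec A c p y"
  shows "of_chart N (cot_chart A c) (p, \<omega>) (0, y) = vertical_lift A \<alpha> (p, \<omega>)"
  using vertical_vec_chart[OF c \<omega> cotangent_linear_on[OF covec_cotangent[OF c]]]
  by (simp add: vertical_lift_def \<alpha> covec_comp_covec[OF c])

text \<open>A vector is split into \<open>(x, 0)\<close> and \<open>(0, y)\<close>, which are values
  of a complete and of a vertical lift. The defining identities then give three blocks of the form,
  and symmetry of \<open>g\<close> the remaining mixed one.\<close>

lemma g_in_chart:
  assumes c: "c \<in> A" and u: "u \<in> chart_img c"
  shows "in_chart N g (cot_chart A c) (u, \<eta>) X Y =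
    a * (fst X \<bullet> snd Y + fst Y \<bullet> snd X - 2 * (\<eta> \<bullet> Gam c u (fst X) (fst Y)))"
proof -
  define p where "p = chart_inv c u"
  define \<omega> where "\<omega> = covec A c p \<eta>"
  have cp: "c \<in> charts_at A p" and up: "snd c p = u" using c u by (auto simp: p_def)
  have p: "p \<in> points A" using charts_at_points[OF cp] .
  have \<omega>: "\<omega> \<in> cotangent_space A p" unfolding \<omega>_def by (rule covec_cotangent[OF cp])
  have q: "(p, \<omega>) \<in> points N" using p \<omega> by (simp add: points_cot)
  have cq: "cot_chart A c \<in> charts_at N (p, \<omega>)" by (rule cot_chart_mem[OF cp \<omega>])
  let ?V = "of_chart N (cot_chart A c) (p, \<omega>)"
  let ?B = "\<lambda>X Y. g (p, \<omega>) (?V X) (?V Y)"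
  have tan: "?V X \<in> tangent_space N (p, \<omega>)" for X by (rule cot.of_chart_tangent[OF cq])
  have "linear_on (tangent_space N (p, \<omega>)) (g (p, \<omega>) v)" "linear_on (tangent_space N (p, \<omega>)) (\<lambda>w. g (p, \<omega>) w v)"
    if "v \<in> tangent_space N (p, \<omega>)" for v
    using metric_tensor q that unfolding symmetric_tensor02_def tensor02_def by blast+
  then have B: "bilinear ?B"
    unfolding bilinear_def using cotm.linear_on_of_chart[OF _ cq] tan by blast
  have hh: "?B (x, 0) (y, 0) = - 2 * a * (\<eta> \<bullet> Gam c u x y)" for x y
  proof -
    let ?E = "coord_field c p"
    have D: "D p (?E x p) (?E y) \<in> tangent_space A p" for x y
      using p vector_field_coord[OF cp] vector_field_tangent by (intro connection_tangent) auto
    have Dc: "D p (?E x p) (?E y) c = Gam c u x y" for x y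
      by (simp add: Gam_def p_def[symmetric] coord_field_at[OF cp])
    \<comment> \<open>For coordinate fields the covariant derivatives reduce to Christoffel symbols;
      their symmetry produces the factor 2 of the coordinate formula.\<close>
    have "\<omega> (D p (?E x p) (?E y) + D p (?E y p) (?E x)) = \<eta> \<bullet> (Gam c u x y + Gam c u y x)"
      using tangent_add[OF D D] by (simp add: \<omega>_def covec_def Dc)
    then show ?thesis
      using extension_values(1)[OF q vector_field_coord[OF cp] vector_field_coord[OF cp]]
      by (simp add: horizontal_lift[OF cp \<omega>] Gam_symmetric[OF torsion c u, of y x] inner_add_right)
  qed
  have hv: "?B (x, 0) (0, y) = a * (x \<bullet> y)" for x y
  proof -
    obtain \<alpha> where \<alpha>: "one_form A \<alpha>" "\<alpha> p = covec A c p y" by (rule one_form_exists[OF cp]) blast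
    have "\<alpha> p (coord_field c p x p) = x \<bullet> y"
      by (simp add: \<alpha> covec_def coord_field_at[OF cp] of_chart_tangent[OF cp] of_chart_self[OF cp] inner_commute)
    then show ?thesis
      using extension_values(2)[OF q vector_field_coord[OF cp, of x] \<alpha>(1)]
      by (simp add: horizontal_lift[OF cp \<omega>] vertical_lift_covec[where \<alpha>=\<alpha>, OF cp \<omega> \<alpha>(2)])
  qed
  have vh: "?B (0, y) (x, 0) = a * (x \<bullet> y)" for x y
    using metric_tensor q tan hv unfolding symmetric_tensor02_def by metis
  have vv: "?B (0, x) (0, y) = 0" for x y
  proof -
    obtain \<alpha> \<beta> where \<alpha>: "one_form A \<alpha>" "\<alpha> p = covec A c p x" and \<beta>: "one_form A \<beta>" "\<beta> p = covec A c p y"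
      by (metis one_form_exists[OF cp])
    show ?thesis
      using extension_values(3)[OF q \<alpha>(1) \<beta>(1)]
      by (simp add: vertical_lift_covec[where \<alpha>=\<alpha>, OF cp \<omega> \<alpha>(2)] vertical_lift_covec[where \<alpha>=\<beta>, OF cp \<omega> \<beta>(2)])
  qed
  have "in_chart N g (cot_chart A c) (u, \<eta>) X Y = ?B X Y"
    by (simp add: in_chart_def chart_inv_cot[OF c u] p_def \<omega>_def)
  also have "\<dots> = ?B ((fst X, 0) + (0, snd X)) ((fst Y, 0) + (0, snd Y))" by simp
  also have "\<dots> = a * (fst X \<bullet> snd Y + fst Y \<bullet> snd X - 2 * (\<eta> \<bullet> Gam c u (fst X) (fst Y)))"
    unfolding bilinear_ladd[OF B] bilinear_radd[OF B] hh hv vh vv by (simp add: algebra_simps)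
  finally show ?thesis .
qed

text \<open>On horizontal vectors the term \<open>C(\<nabla>X)\<close> supplies the adjoint of the
  Christoffel symbol, since the covariant derivative of a coordinate field is given by
  \<open>Gam\<close> alone; vertical vectors change sign. Linearity of \<open>P\<close> combines the
  two cases.\<close>

lemma P_in_chart:
  assumes c: "c \<in> A" and u: "u \<in> chart_img c"
  shows "endo_chart N P (cot_chart A c) (u, \<eta>) X = (fst X, 2 *\<^sub>R transp (\<lambda>b. Gam c u b (fst X)) \<eta> - snd X)"
proof -
  define p where "p = chart_inv c u"
  define \<omega> where "\<omega> = covec A c p \<eta>"
  have cp: "c \<in> charts_at A p" and up: "snd c p = u" using c u by (auto simp: p_def)
  have p: "p \<in> points A" using charts_at_points[OF cp] .
  have \<omega>: "\<omega> \<in> cotangent_space A p" unfolding \<omega>_def by (rule covec_cotangent[OF cp])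
  have q: "(p, \<omega>) \<in> points N" using p \<omega> by (simp add: points_cot)
  have cq: "cot_chart A c \<in> charts_at N (p, \<omega>)" by (rule cot_chart_mem[OF cp \<omega>])
  let ?C = "cot_chart A c"
  let ?V = "of_chart N ?C (p, \<omega>)"
  have "linear_on (tangent_space N (p, \<omega>)) (P (p, \<omega>))"
    using tensor_P q unfolding tensor11_def by blast
  note lin = cotm.linear_on_of_chart[OF this cq]
  have h: "P (p, \<omega>) (?V (x, 0)) ?C = (x, 2 *\<^sub>R transp (\<lambda>b. Gam c u b x) \<eta>)" for x
  proof -
    let ?E = "coord_field c p x" and ?\<xi> = "\<lambda>v. \<omega> (D p v (coord_field c p x))"
    have \<xi>: "linear_on (tangent_space A p) ?\<xi>"
      using connection_linear[OF p vector_field_coord[OF cp]] connection_tangent[OF p vector_field_coord[OF cp]]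
        cotangent_linear_on[OF \<omega>] unfolding linear_on_def by simp
    have "?\<xi> (of_chart A c p b) = \<eta> \<bullet> Gam c u b x" for b
      using connection_tangent[OF p vector_field_coord[OF cp] of_chart_tangent[OF cp]]
      by (simp add: \<omega>_def covec_def Gam_def p_def[symmetric])
    then have "covec_comp A c p ?\<xi> = transp (\<lambda>b. Gam c u b x) \<eta>"
      by (simp add: covec_comp_def transp_def)
    then have "contracted A (\<lambda>p v. D p v ?E) (p, \<omega>) = ?V (0, transp (\<lambda>b. Gam c u b x) \<eta>)"
      using vertical_vec_chart[OF cp \<omega> \<xi>] by (simp add: contracted_def)
    then have "P (p, \<omega>) (?V (x, 0)) = ?V (x, 0) + 2 *\<^sub>R ?V (0, transp (\<lambda>b. Gam c u b x) \<eta>)"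
      using P_complete[OF vector_field_coord[OF cp] q] by (simp add: horizontal_lift[OF cp \<omega>])
    then show ?thesis by (simp add: cot.of_chart_self[OF cq] scaleR_fun_apply)
  qed
  have v: "P (p, \<omega>) (?V (0, y)) ?C = (0, - y)" for y
  proof -
    obtain \<alpha> where \<alpha>: "one_form A \<alpha>" "\<alpha> p = covec A c p y" by (rule one_form_exists[OF cp]) blast
    have "P (p, \<omega>) (?V (0, y)) = - ?V (0, y)"
      using P_vertical[OF \<alpha>(1) q] by (simp add: vertical_lift_covec[where \<alpha>=\<alpha>, OF cp \<omega> \<alpha>(2)])
    then show ?thesis by (simp add: cot.of_chart_self[OF cq])
  qed
  have "endo_chart N P ?C (u, \<eta>) X = P (p, \<omega>) (?V X) ?C"
    by (simp add: endo_chart_def chart_inv_cot[OF c u] p_def \<omega>_def)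
  also have "\<dots> = P (p, \<omega>) (?V ((fst X, 0) + (0, snd X))) ?C" by simp
  also have "\<dots> = (fst X, 2 *\<^sub>R transp (\<lambda>b. Gam c u b (fst X)) \<eta> - snd X)"
    unfolding linear_add[OF lin] plus_fun_apply h v by simp
  finally show ?thesis .
qed

lemma local_extension_chart:
  assumes c: "c \<in> A"
  shows "local_extension (chart_img c) (Gam c) a (in_chart N g (cot_chart A c)) (endo_chart N P (cot_chart A c))"
  by unfold_locales
     (simp_all add: a c open_chart_img bilinear_Gam smooth_Gam g_in_chart P_in_chart Gam_symmetric[OF torsion c])

lemma cot_chartE:
  assumes "C \<in> charts_at N q"
  obtains c p \<omega> where "C = cot_chart A c" "q = (p, \<omega>)" "c \<in> charts_at A p" "\<omega> \<in> cotangent_space A p"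
    "snd C q = (snd c p, covec_comp A c p \<omega>)"
proof -
  obtain c where c: "c \<in> A" "C = cot_chart A c" using assms by (auto simp: charts_at_iff cotangent_bundle_def)
  obtain p \<omega> where q: "q = (p, \<omega>)" by (cases q)
  show ?thesis
    using assms c q by (intro that[of c p \<omega>]) (auto simp: charts_at_iff fst_cot_chart snd_cot_chart)
qed

lemma metric_cot: "metric_manifold N g"
proof
  show "symmetric_tensor02 N g" by (rule metric_tensor)
  fix q v assume q: "q \<in> points N" and v: "v \<in> tangent_space N q"
    and 0: "\<And>w. w \<in> tangent_space N q \<Longrightarrow> g q v w = 0"
  obtain C where C: "C \<in> charts_at N q" using q cot.points_iff by blast
  obtain c p \<omega> where c: "C = cot_chart A c" "q = (p, \<omega>)" "c \<in> charts_at A p" "\<omega> \<in> cotangent_space A p"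
    "snd C q = (snd c p, covec_comp A c p \<omega>)" by (rule cot_chartE[OF C])
  have cA: "c \<in> A" "p \<in> fst c" using c(3) by (auto simp: charts_at_iff)
  interpret L: local_extension "chart_img c" "Gam c" a "in_chart N g C" "endo_chart N P C"
    unfolding c(1) by (rule local_extension_chart[OF cA(1)])
  have mem: "snd C q \<in> chart_img c \<times> UNIV" using c cA by simp
  have inv: "chart_inv C (snd C q) = q" using C by (simp add: charts_at_iff)
  have "v C = 0"
  proof (rule L.nondegenerate[OF mem])
    fix W
    have "in_chart N g C (snd C q) (v C) W = g q v (of_chart N C q W)"
      by (simp add: in_chart_def inv v C)
    then show "in_chart N g C (snd C q) (v C) W = 0" using 0 cot.of_chart_tangent[OF C] by simp
  qed
  then show "v = 0" using cot.tangent_eqI[OF v cot.tangent_zero C] by simp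
qed

interpretation M: metric_manifold N g
  by (rule metric_cot)

lemma smooth_christoffel_cot:
  assumes "C \<in> N"
  shows "smooth_on (chart_img C) (\<lambda>u. christoffel (in_chart N g C) u X Y)"
proof -
  obtain c where c: "c \<in> A" "C = cot_chart A c" using assms by (auto simp: cotangent_bundle_def)
  interpret L: local_extension "chart_img c" "Gam c" a "in_chart N g C" "endo_chart N P C"
    unfolding c(2) by (rule local_extension_chart[OF c(1)])
  show ?thesis using L.smooth_christoffel_G chart_img_cot[OF c(1)] by (simp add: c(2))
qed

lemma harmonic_P: "harmonic_endo N g P"
proof (rule M.harmonic_endoI[OF tensor_P])
  fix C U assume C: "C \<in> N" and U: "U \<in> chart_img C"
  obtain c where c: "c \<in> A" "C = cot_chart A c" using C by (auto simp: cotangent_bundle_def)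
  interpret L: local_extension "chart_img c" "Gam c" a "in_chart N g C" "endo_chart N P C"
    unfolding c(2) by (rule local_extension_chart[OF c(1)])
  obtain u \<eta> where u: "U = (u, \<eta>)" "u \<in> chart_img c" using U chart_img_cot[OF c(1)] c(2) by auto
  show "(\<Sum>b\<in>Basis. let b' = sharp (in_chart N g C U) b in
         frechet_derivative (\<lambda>u. endo_chart N P C u b') (at U) b
         + christoffel (in_chart N g C) U b (endo_chart N P C U b')
         - endo_chart N P C U (christoffel (in_chart N g C) U b b')) = 0"
    unfolding u(1) by (rule L.trace_nabla_P[OF u(2)])
qed

lemma g_P_point:
  assumes "q \<in> points N" "v \<in> tangent_space N q" "w \<in> tangent_space N q" "C \<in> charts_at N q"
  shows "g q v (P q w) = a * (fst (w C) \<bullet> snd (v C) - fst (v C) \<bullet> snd (w C))"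
    "g q (P q v) (P q w) = - g q v w" "P q (P q v) = v"
proof -
  obtain c p \<omega> where c: "C = cot_chart A c" "q = (p, \<omega>)" "c \<in> charts_at A p" "\<omega> \<in> cotangent_space A p"
    "snd C q = (snd c p, covec_comp A c p \<omega>)" by (rule cot_chartE[OF assms(4)])
  have cA: "c \<in> A" "p \<in> fst c" using c(3) by (auto simp: charts_at_iff)
  interpret L: local_extension "chart_img c" "Gam c" a "in_chart N g C" "endo_chart N P C"
    unfolding c(1) by (rule local_extension_chart[OF cA(1)])
  have u: "snd c p \<in> chart_img c" using cA by simp
  note PT = cotm.tensor11_tangent[OF tensor_P assms(1)]
  note simps = M.g_chart[OF assms(4)] cotm.endo_chart[OF assms(4), of _ P] PT assms(2,3) c(5)
  show "g q v (P q w) = a * (fst (w C) \<bullet> snd (v C) - fst (v C) \<bullet> snd (w C))"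
    "g q (P q v) (P q w) = - g q v w"
    by (simp add: simps L.G_P(1)[OF u], simp add: simps L.G_P(2)[OF u])
  show "P q (P q v) = v"
    by (rule cot.tangent_eqI[OF _ _ assms(4)]) (simp_all add: simps L.G_P(3)[OF u])
qed

section \<open>Signature of the metric and ranks of the eigendistributions\<close>

lemma dim_of_chart_image:
  fixes f :: "'v \<Rightarrow> 'v \<times> 'v"
  assumes C: "C \<in> charts_at N q" and f: "linear f" "inj f"
  shows "dim (of_chart N C q ` range f) = DIM('v)"
proof -
  have lin: "linear (\<lambda>x. of_chart N C q (f x))"
    using linear_compose[OF f(1) cot.linear_of_chart[OF C]] by (simp add: comp_def)
  have inj: "inj (\<lambda>x. of_chart N C q (f x))"
    by (rule injI) (metis C cot.of_chart_self f(2) injD)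
  have "of_chart N C q ` range f = (\<lambda>x. of_chart N C q (f x)) ` UNIV" by auto
  then show ?thesis using dim_image_eq[OF lin, of UNIV] inj by (simp add: dim_UNIV)
qed

text \<open>Vertical vectors are null, so a negative definite subspace meets the vertical space
  trivially and projects injectively to the base, which bounds its dimension. A graph over the base
  attains the bound.\<close>

lemma form_index_cot:
  assumes q: "q \<in> points N"
  shows "form_index (tangent_space N q) (g q) = DIM('v)"
proof -
  obtain C where C: "C \<in> charts_at N q" using q cot.points_iff by blast
  obtain c p \<omega> where c: "C = cot_chart A c" "q = (p, \<omega>)" "c \<in> charts_at A p" "\<omega> \<in> cotangent_space A p"
    "snd C q = (snd c p, covec_comp A c p \<omega>)" by (rule cot_chartE[OF C])
  have cA: "c \<in> A" "p \<in> fst c" using c(3) by (auto simp: charts_at_iff)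
  interpret L: local_extension "chart_img c" "Gam c" a "in_chart N g C" "endo_chart N P C"
    unfolding c(1) by (rule local_extension_chart[OF cA(1)])
  let ?u = "snd c p" and ?\<eta> = "covec_comp A c p \<omega>" and ?V = "of_chart N C q"
  have u: "?u \<in> chart_img c" using cA by simp
  have gV: "g q v v = 2 * a * (fst (v C) \<bullet> snd (v C) - ?\<eta> \<bullet> Gam c ?u (fst (v C)) (fst (v C)))"
    if "v \<in> tangent_space N q" for v
    using that by (simp add: M.g_chart[OF C] c(5) L.G[OF u] algebra_simps)
  define \<D> where "\<D> = {dim S |S. subspace S \<and> S \<subseteq> tangent_space N q \<and> (\<forall>v\<in>S. v \<noteq> 0 \<longrightarrow> g q v v < 0)}"
  have le: "n \<le> DIM('v)" if n: "n \<in> \<D>" for n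
  proof -
    from n obtain S where S': "n = dim S \<and> subspace S \<and> S \<subseteq> tangent_space N q \<and> (\<forall>v\<in>S. v \<noteq> 0 \<longrightarrow> g q v v < 0)"
      unfolding \<D>_def mem_Collect_eq by (rule exE)
    then have S: "n = dim S" "subspace S" "S \<subseteq> tangent_space N q" "\<And>v. v \<in> S \<Longrightarrow> v \<noteq> 0 \<Longrightarrow> g q v v < 0"
      by simp_all
    define S' where "S' = {X. ?V X \<in> S}"
    have linV: "linear ?V" by (rule cot.linear_of_chart[OF C])
    have S': "subspace S'"
      using S(2) unfolding S'_def subspace_def
      by (simp add: linear_0[OF linV] linear_add[OF linV] linear_scale[OF linV])
    have "S = ?V ` S'"
    proof (intro set_eqI iffI)
      fix v assume "v \<in> S"
      then have "?V (v C) = v" using S(3) C by auto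
      then show "v \<in> ?V ` S'" using \<open>v \<in> S\<close> unfolding S'_def by (intro image_eqI[of _ _ "v C"]) auto
    qed (auto simp: S'_def)
    moreover have "inj_on ?V (span S')"
      by (rule inj_onI) (metis C cot.of_chart_self)
    ultimately have "dim S = dim S'" using dim_image_eq[OF linV] by blast
    moreover have "dim (fst ` S') = dim S'"
    proof (rule dim_image_eq[OF linear_fst])
      show "inj_on fst (span S')"
        unfolding span_eq_iff[THEN iffD2, OF S'] linear_inj_on_iff_eq_0[OF linear_fst S']
      proof (intro ballI impI)
        fix X assume X: "X \<in> S'" "fst X = 0"
        then have "g q (?V X) (?V X) = 0"
          by (subst gV[OF cot.of_chart_tangent[OF C]]) (simp add: cot.of_chart_self[OF C] L.\<Gamma>_simps[OF u])
        then have "?V X = 0" using S(4)[of "?V X"] X(1) by (auto simp: S'_def)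
        then show "X = 0" by (metis C cot.of_chart_self zero_fun_apply)
      qed
    qed
    moreover have "dim (fst ` S') \<le> DIM('v)" by (rule dim_subset_UNIV)
    ultimately show ?thesis using S(1) by simp
  qed
  have "DIM('v) \<in> \<D>"
  proof -
    \<comment> \<open>The \<open>transp\<close> term cancels the Christoffel term of the metric, and
      the correction \<open>- x\<close> leaves the value
      \<open>- 2 * a * (x \<bullet> x)\<close>.\<close>
    let ?f = "\<lambda>x. (x, transp (\<lambda>b. Gam c ?u b x) ?\<eta> - x)"
    have f: "linear ?f"
      by (rule linearI)
         (simp_all add: transp_def L.\<Gamma>_simps[OF u] inner_add_right scaleR_add_left sum.distrib scaleR_sum_right scaleR_diff_right)
    have inj: "inj ?f" by (rule injI) simp
    let ?S = "?V ` range ?f"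
    have 1: "subspace ?S"
      by (intro linear_subspace_image cot.linear_of_chart[OF C] f subspace_UNIV)
    have 2: "?S \<subseteq> tangent_space N q" using cot.of_chart_tangent[OF C] by auto
    have 3: "g q v v < 0" if v: "v \<in> ?S" "v \<noteq> 0" for v
    proof -
      obtain x where x: "v = ?V (?f x)" using v by auto
      have "x \<noteq> 0"
      proof
        assume "x = 0"
        then have "?f x = 0" using linear_0[OF f] by simp
        then show False using v(2) x linear_0[OF cot.linear_of_chart[OF C]] by simp
      qed
      moreover have "x \<bullet> transp (\<lambda>b. Gam c ?u b x) ?\<eta> = ?\<eta> \<bullet> Gam c ?u x x"
        using transp_inner[OF L.linear_\<Gamma>(2)[OF u]] by (simp add: inner_commute)
      ultimately show ?thesis
        using a by (subst gV) (auto simp: x cot.of_chart_tangent[OF C] cot.of_chart_self[OF C] inner_diff_right mult_pos_pos)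
    qed
    show ?thesis
      unfolding \<D>_def mem_Collect_eq
      by (rule exI[of _ ?S], intro conjI ballI impI dim_of_chart_image[OF C f inj, symmetric] 1 2 3)
  qed
  \<comment> \<open>The upper bound also gives the finiteness on which \<open>Max\<close>
    relies.\<close>
  then have "Max \<D> = DIM('v)"
    using le by (intro Max_eqI) (auto intro: finite_subset[of _ "{..DIM('v)}"])
  then show ?thesis by (simp add: form_index_def \<D>_def)
qed

text \<open>In coordinates \<open>P\<close> sends \<open>(x, y)\<close> to
  \<open>(x, 2 *\<^sub>R t - y)\<close> with \<open>t\<close> depending linearly on
  \<open>x\<close>. Its fixed vectors form the graph \<open>y = t\<close>, and the vectors sent to
  their negatives are those with \<open>x = 0\<close>; both spaces have the dimension of the
  base.\<close>

lemma eigenspace_dims: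
  assumes q: "q \<in> points N"
  shows "dim {v \<in> tangent_space N q. P q v = v} = DIM('v)" "dim {v \<in> tangent_space N q. P q v = - v} = DIM('v)"
proof -
  obtain C where C: "C \<in> charts_at N q" using q cot.points_iff by blast
  obtain c p \<omega> where c: "C = cot_chart A c" "q = (p, \<omega>)" "c \<in> charts_at A p" "\<omega> \<in> cotangent_space A p"
    "snd C q = (snd c p, covec_comp A c p \<omega>)" by (rule cot_chartE[OF C])
  have cA: "c \<in> A" "p \<in> fst c" using c(3) by (auto simp: charts_at_iff)
  interpret L: local_extension "chart_img c" "Gam c" a "in_chart N g C" "endo_chart N P C"
    unfolding c(1) by (rule local_extension_chart[OF cA(1)])
  let ?u = "snd c p" and ?\<eta> = "covec_comp A c p \<omega>" and ?V = "of_chart N C q"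
  have u: "?u \<in> chart_img c" using cA by simp
  note V = cot.of_chart_tangent[OF C] cot.of_chart_self[OF C]
  have Pc: "P q v C = (fst (v C), 2 *\<^sub>R transp (\<lambda>b. Gam c ?u b (fst (v C))) ?\<eta> - snd (v C))"
    if "v \<in> tangent_space N q" for v
    using that by (simp add: cotm.endo_chart[OF C] c(5) L.P[OF u])
  have eqI: "P q v = w \<longleftrightarrow> P q v C = w C" if "v \<in> tangent_space N q" "w \<in> tangent_space N q" for v w
    using cot.tangent_eqI[OF cotm.tensor11_tangent[OF tensor_P q that(1)] that(2) C] by auto
  have neg: "- v \<in> tangent_space N q" if "v \<in> tangent_space N q" for v
    using cot.tangent_scale[OF that, of "-1"] by simp
  let ?f = "\<lambda>x. (x, transp (\<lambda>b. Gam c ?u b x) ?\<eta>)"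
  have f: "linear ?f"
    by (rule linearI)
       (simp_all add: transp_def L.\<Gamma>_simps[OF u] inner_add_right scaleR_add_left sum.distrib scaleR_sum_right)
  have half: "2 *\<^sub>R t - y = y \<longleftrightarrow> y = t" for t y :: 'v
    by (auto simp: scaleR_2 algebra_simps) (metis scaleR_2 scaleR_cancel_left zero_neq_numeral)
  have "{v \<in> tangent_space N q. P q v = v} = ?V ` range ?f"
  proof (intro set_eqI iffI)
    fix v assume "v \<in> {v \<in> tangent_space N q. P q v = v}"
    then have v: "v \<in> tangent_space N q" "P q v C = v C" by auto
    have "v C = ?f (fst (v C))"
      using v(2) unfolding Pc[OF v(1)] by (simp add: prod_eq_iff half)
    then have "v = ?V (?f (fst (v C)))" using v(1) C by (metis cot.of_chart_eq)
    then show "v \<in> ?V ` range ?f" by blast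
  next
    fix v assume "v \<in> ?V ` range ?f"
    then obtain x where x: "v = ?V (?f x)" by auto
    then have "v \<in> tangent_space N q" "v C = ?f x" using V by auto
    then show "v \<in> {v \<in> tangent_space N q. P q v = v}"
      by (simp add: eqI Pc half)
  qed
  then show "dim {v \<in> tangent_space N q. P q v = v} = DIM('v)"
    using dim_of_chart_image[OF C f] by (simp add: inj_def)
  let ?h = "\<lambda>y::'v. (0::'v, y)"
  have h: "linear ?h" by (rule linearI) simp_all
  have "{v \<in> tangent_space N q. P q v = - v} = ?V ` range ?h"
  proof (intro set_eqI iffI)
    fix v assume "v \<in> {v \<in> tangent_space N q. P q v = - v}"
    then have v: "v \<in> tangent_space N q" "P q v C = - v C" by auto
    have "fst (v C) = - fst (v C)"
      using v(2) unfolding Pc[OF v(1)] by (simp add: prod_eq_iff)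
    then have "2 *\<^sub>R fst (v C) = 0" by (simp only: scaleR_2 eq_neg_iff_add_eq_0)
    then have "fst (v C) = 0" by simp
    then have "v = ?V (?h (snd (v C)))" using v(1) C by (metis cot.of_chart_eq prod.collapse)
    then show "v \<in> ?V ` range ?h" by blast
  next
    fix v assume "v \<in> ?V ` range ?h"
    then obtain x where x: "v = ?V (?h x)" by auto
    then have "v \<in> tangent_space N q" "v C = ?h x" using V by auto
    then show "v \<in> {v \<in> tangent_space N q. P q v = - v}"
      using neg[of v] by (simp add: eqI Pc L.\<Gamma>_simps[OF u])
  qed
  then show "dim {v \<in> tangent_space N q. P q v = - v} = DIM('v)"
    using dim_of_chart_image[OF C h] by (simp add: inj_def)
qed

lemma almost_para_hermitian_P:
  assumes "points A \<noteq> {}"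
  shows "almost_para_hermitian N P g"
proof -
  obtain p where p: "p \<in> points A" using assms by blast
  \<comment> \<open>The zero covector; excluding \<open>P = Id\<close> and \<open>P = - Id\<close>
    requires a point of the bundle.\<close>
  have "(\<lambda>_. 0) \<in> cotangent_space A p" by (simp add: cotangent_space_def linear_on_def)
  then obtain q where q: "q \<in> points N" using p points_cot by blast
  obtain C where C: "C \<in> charts_at N q" using q cot.points_iff by blast
  obtain b :: 'v where b: "b \<in> Basis" using nonempty_Basis by blast
  let ?v = "of_chart N C q (b, 0)" and ?w = "of_chart N C q (0, b)"
  have t: "?v \<in> tangent_space N q" "?w \<in> tangent_space N q" using cot.of_chart_tangent[OF C] by auto
  \<comment> \<open>These two values differ, which contradicts symmetry of \<open>g\<close> if
    \<open>P\<close> is plus or minus the identity.\<close>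
  have "g q ?v (P q ?w) = - a" "g q ?w (P q ?v) = a"
    using b by (simp_all add: g_P_point(1)[OF q _ _ C] t cot.of_chart_self[OF C])
  note gP = this
  have sym: "g q ?v ?w = g q ?w ?v"
    using metric_tensor q t unfolding symmetric_tensor02_def by blast
  have "\<not> (\<forall>v\<in>tangent_space N q. P q v = v)"
  proof
    assume "\<forall>v\<in>tangent_space N q. P q v = v"
    then have "P q ?v = ?v" "P q ?w = ?w" using t by blast+
    then show False using gP sym a by simp
  qed
  moreover have neg: "g q v (- w) = - g q v w" if "v \<in> tangent_space N q" "w \<in> tangent_space N q" for v w
  proof -
    have "linear_on (tangent_space N q) (g q v)"
      using metric_tensor q that unfolding symmetric_tensor02_def tensor02_def by blast
    then have "g q v ((-1) *\<^sub>R w + 0 *\<^sub>R w) = (-1) *\<^sub>R g q v w + 0 *\<^sub>R g q v w"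
      using that(2) unfolding linear_on_def by blast
    then show ?thesis by simp
  qed
  have "\<not> (\<forall>v\<in>tangent_space N q. P q v = - v)"
  proof
    assume "\<forall>v\<in>tangent_space N q. P q v = - v"
    then have "P q ?v = - ?v" "P q ?w = - ?w" using t by blast+
    then show False using gP sym a neg t by simp
  qed
  moreover have "P q (P q v) = v" if "q \<in> points N" "v \<in> tangent_space N q" for q v
    using g_P_point(3)[OF that that(2)] cot.points_iff that(1) by blast
  ultimately have "almost_para_complex N P"
    unfolding almost_para_complex_def using q by (auto simp only: DIM_prod tensor_P eigenspace_dims even_add)
  moreover have "semi_riemannian_metric N g"
    unfolding semi_riemannian_metric_def
  proof (intro conjI ballI impI exI)
    show "symmetric_tensor02 N g" by (rule metric_tensor)
    show "v = 0" if "q \<in> points N" "v \<in> tangent_space N q" "\<forall>w\<in>tangent_space N q. g q v w = 0" for q v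
      using M.nondegenerate[OF that(1,2)] that(3) by blast
    show "form_index (tangent_space N q) (g q) = DIM('v)" if "q \<in> points N" for q
      by (rule form_index_cot[OF that])
  qed
  moreover have "g q (P q v) (P q w) = - g q v w"
    if "q \<in> points N" "v \<in> tangent_space N q" "w \<in> tangent_space N q" for q v w
    using g_P_point(2)[OF that] that(1) cot.points_iff by blast
  ultimately show ?thesis
    unfolding almost_para_hermitian_def using smooth_manifold_cot by blast
qed

section \<open>Closedness of the fundamental form and the flat case\<close>

lemma closed_P: "closed_2form N (\<lambda>q v w. g q v (P q w))"
proof (rule cotm.closed_2formI)
  show "bilinear (\<lambda>X Y. a * (fst Y \<bullet> snd X - fst X \<bullet> snd (Y :: 'v \<times> 'v)))"
    unfolding bilinear_def by (auto intro!: linearI simp: inner_add_left inner_add_right algebra_simps)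
  show "g q v (P q w) = a * (fst (w C) \<bullet> snd (v C) - fst (v C) \<bullet> snd (w C))"
    if "C \<in> charts_at N q" "v \<in> tangent_space N q" "w \<in> tangent_space N q" for C q v w
    using g_P_point(1)[OF cotm.charts_at_points[OF that(1)] that(2,3,1)] .
qed (simp add: algebra_simps)

text \<open>Flatness is tested on three coordinate fields. Their brackets vanish at the point, and
  the first covariant derivative is a global field whose components near the point are Christoffel
  symbols, so the second one is read off from \<open>connection_chart\<close>.\<close>

lemma curvature_chart:
  assumes flat: "flat A D" and c: "c \<in> A" and u: "u \<in> chart_img c"
  shows "frechet_derivative (\<lambda>u. Gam c u x z) (at u) w - frechet_derivative (\<lambda>u. Gam c u w z) (at u) x
    + Gam c u w (Gam c u x z) - Gam c u x (Gam c u w z) = 0"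
proof -
  define p where "p = chart_inv c u"
  have cp: "c \<in> charts_at A p" and up: "snd c p = u" using c u by (auto simp: p_def)
  have p: "p \<in> points A" using charts_at_points[OF cp] .
  let ?E = "coord_field c p"
  note E = vector_field_coord[OF cp]
  have Ep: "?E x p \<in> tangent_space A p" for x using vector_field_tangent[OF E p] .
  have Epc: "?E x p c = x" for x by (simp add: coord_field_at[OF cp] of_chart_self[OF cp])
  obtain U where U: "open U" "snd c p \<in> U" "U \<subseteq> chart_img c"
    "\<And>u x y. u \<in> U \<Longrightarrow> Gam c u x y = D (chart_inv c u) (?E x (chart_inv c u)) (?E y) c"
    by (rule Gam_near[OF cp]) blast
  have second: "D p (?E w p) (\<lambda>q. D q (?E x q) (?E z)) c =
      frechet_derivative (\<lambda>u. Gam c u x z) (at u) w + Gam c u w (Gam c u x z)" for w x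
  proof -
    have W: "vector_field A (\<lambda>q. D q (?E x q) (?E z))" by (rule connection_field[OF E E])
    have "((\<lambda>u. Gam c u x z) has_derivative frechet_derivative (\<lambda>u. Gam c u x z) (at u)) (at u)"
      by (rule smooth_on_has_derivative[OF smooth_Gam[OF c] u])
    then have "((\<lambda>u. D (chart_inv c u) (?E x (chart_inv c u)) (?E z) c) has_derivative
        frechet_derivative (\<lambda>u. Gam c u x z) (at u)) (at u)"
      by (rule has_derivative_transform_within_open[OF _ U(1)]) (use U up in auto)
    moreover have "D p (?E x p) (?E z) c = Gam c u x z"
      using U(4)[OF U(2), of x z] by (simp add: up p_def[symmetric])
    ultimately show ?thesis
      using connection_chart[OF cp W Ep] by (simp add: frechet_derivative_eq up Epc)
  qed
  have "lie_bracket A (?E w) (?E x) p c = 0"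
    using frechet_derivative_eq[OF coord_field_derivative[OF cp]] by (simp add: lie_bracket_chart[OF cp])
  then have "D p (lie_bracket A (?E w) (?E x) p) (?E z) c = 0"
    using connection_chart[OF cp E[of z] lie_bracket_tangent[OF E[of w] E[of x] p]]
      frechet_derivative_eq[OF coord_field_derivative[OF cp]] bilinear_lzero[OF bilinear_Gam[OF c u]]
    by (simp add: up)
  moreover have "D p (?E w p) (\<lambda>q. D q (?E x q) (?E z)) - D p (?E x p) (\<lambda>q. D q (?E w q) (?E z))
         - D p (lie_bracket A (?E w) (?E x) p) (?E z) = 0"
    using flat[unfolded flat_def, rule_format, OF E E E p] .
  from fun_cong[OF this, of c] have "D p (?E w p) (\<lambda>q. D q (?E x q) (?E z)) c - D p (?E x p) (\<lambda>q. D q (?E w q) (?E z)) c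
         - D p (lie_bracket A (?E w) (?E x) p) (?E z) c = 0"
    by simp
  ultimately show ?thesis by (simp add: second algebra_simps)
qed

lemma parallel_P:
  assumes flat: "flat A D"
  shows "parallel11 N M.LC P"
proof (rule M.parallel_LC[OF tensor_P])
  fix C U Z X assume C: "C \<in> N" and U: "U \<in> chart_img C"
  obtain c where c: "c \<in> A" "C = cot_chart A c" using C by (auto simp: cotangent_bundle_def)
  interpret L: local_extension "chart_img c" "Gam c" a "in_chart N g C" "endo_chart N P C"
    unfolding c(2) by (rule local_extension_chart[OF c(1)])
  obtain u \<eta> where u: "U = (u, \<eta>)" "u \<in> chart_img c" using U chart_img_cot[OF c(1)] c(2) by auto
  have "L.curv u w x z = 0" for w x z
    using curvature_chart[OF flat c(1) u(2)] by (simp add: L.curv_def L.d\<Gamma>_def)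
  then show "frechet_derivative (\<lambda>u. endo_chart N P C u X) (at U) Z
      + christoffel (in_chart N g C) U Z (endo_chart N P C U X)
      = endo_chart N P C U (christoffel (in_chart N g C) U Z X)"
    using L.nabla_P[OF u(2), of X \<eta> Z] by (simp add: u(1) zero_prod_def[symmetric])
qed

lemma para_kahler_P:
  assumes "points A \<noteq> {}" "flat A D"
  shows "para_kahler N P g"
  unfolding para_kahler_def
  using almost_para_hermitian_P[OF assms(1)] M.levi_civita_LC[OF smooth_christoffel_cot] parallel_P[OF assms(2)]
  by blast

lemma almost_para_kahler_P: "points A \<noteq> {} \<Longrightarrow> almost_para_kahler N P g"
  unfolding almost_para_kahler_def using almost_para_hermitian_P closed_P by blast

end

theorem theorem3p2:
  fixes A :: "('a, 'v::euclidean_space) chart set"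
    and D :: "('a, 'v) connection"
    and a :: real
    and g :: "('a \<times> ('a, 'v) covec, 'v \<times> 'v) bilin"
    and P :: "('a \<times> ('a, 'v) covec, 'v \<times> 'v) endo"
  assumes "smooth_manifold A" and "points A \<noteq> {}" and "connected_space (manifold_topology A)"
    and "DIM('v) \<ge> 2"
    and "linear_connection A D" and "torsion_free A D"
    and "a > 0"
    and "nonproper_riemann_extension A D a g"
    and "tensor11 (cotangent_bundle A) P"
    and "\<And>X q. vector_field A X \<Longrightarrow> q \<in> points (cotangent_bundle A) \<Longrightarrow>
           P q (complete_lift A X q) =
             complete_lift A X q + 2 *\<^sub>R contracted A (\<lambda>p v. D p v X) q"
    and "\<And>\<alpha> q. one_form A \<alpha> \<Longrightarrow> q \<in> points (cotangent_bundle A) \<Longrightarrow>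
           P q (vertical_lift A \<alpha> q) = - vertical_lift A \<alpha> q"
  shows "almost_para_hermitian (cotangent_bundle A) P g \<and>
    (\<not> flat A D \<longrightarrow> almost_para_kahler (cotangent_bundle A) P g) \<and>
    (flat A D \<longrightarrow> para_kahler (cotangent_bundle A) P g) \<and>
    harmonic_endo (cotangent_bundle A) g P"
proof -
  interpret riemann_extension A D a g P
    using assms by unfold_locales
  show ?thesis
    using almost_para_hermitian_P almost_para_kahler_P para_kahler_P harmonic_P assms(2) by blast
qed

end
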